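(* Let $X$ be an $n$-dimensional Riemannian manifold (not necessarily compact or complete) and let $U\subset X$ be an open subset. Let $\tilde g(t)$, $t\in\mathbb{R}$, be a family of Riemannian metrics on $X$, and let $\eta(t)$, $t\in\mathbb{R}$, be a family of smooth functions or tensor fields (of a fixed type) on $X$. Suppose there exist positive constants $A_1,A_2,\dots$ and a positive function $h_0(t)$ with $h_0(t)\to 0$ as $t\to\infty$ such that: (A) $\|\eta(t)\|_{C^0(U,\tilde g(t))}\le h_0(t)$ for all $t$; (B) $\|\eta(t)\|_{C^k(U,\tilde g(t))}\le A_k$ for all $t$ and all $k=1,2,\dots$; (C) for any compact subset $K\subset\subset U$ there exists a smooth cut-off function $\rho$ (independent of $t$) with compact support $\hat K\subset\subset U$ such that $0\le\rho\le 1$, $\rho\equiv 1$ in a neighborhood of $K$, and $$|\nabla\rho|^2_{\tilde g(t)}+|\Delta_{\tilde g(t)}\rho|\le B_K\quad\text{on }\hat K\times[0,\infty),$$ for some constant $B_K$ independent of $t$ (but which may depend on the geometry of $K$). Then for any compact subset $K\subset\subset U$ and every integer $k\ge 0$ one has $$\|\eta(t)\|_{C^k(K,\tilde g(t))}\le h_{K,k}(t),$$ where $h_{K,k}(t)$ is a positive function tending to zero as $t\to\infty$, depending on the constants $A_1,\dots,A_{k+2}$, $B_K$ and the function $h_0(t)$.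
   Context: For a tensor field $\eta$ and a Riemannian metric $g$, $\|\eta\|_{C^k(U,g)}$ is the supremum over $U$ of $\sum_{j=0}^k|\nabla^{j,g}\eta|_g$, where $\nabla^{j,g}$ is the $j$-th covariant derivative with respect to the Levi-Civita connection of $g$ and the pointwise norm is taken with $g$. $\Delta_{g}$ is the Laplacian of $g$. The metrics are smooth; no uniform non-degeneracy or curvature bound on $\tilde g(t)$ is assumed. *)

theory Defs
  imports "HOL-Analysis.Analysis"
begin

section \<open>Smooth functions on open subsets of Euclidean space\<close>

definition partial :: "'n::finite \<Rightarrow> (real^'n \<Rightarrow> real) \<Rightarrow> real^'n \<Rightarrow> real" where
  "partial i f x = frechet_derivative f (at x) (axis i 1)"

text \<open>For open \<open>S\<close> this is \<open>C\<close>-infinity on \<open>S\<close>: all iterated partial derivatives exist and are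
  (totally) differentiable, hence continuous.\<close>

definition smooth_on :: "(real^'n::finite) set \<Rightarrow> (real^'n \<Rightarrow> real) \<Rightarrow> bool" where
  "smooth_on S f \<longleftrightarrow> (\<forall>is. foldr partial is f differentiable_on S)"


section \<open>Smooth manifolds\<close>

text \<open>A chart is a pair \<open>(D, \<phi>)\<close>; the values of \<open>\<phi>\<close> outside \<open>D\<close> are irrelevant. The manifold is the
  whole type \<open>'a\<close>, which is to be Hausdorff and second countable.\<close>

type_synonym ('a, 'n) chart = "'a set \<times> ('a \<Rightarrow> real^'n)"

abbreviation chart_dom :: "('a, 'n) chart \<Rightarrow> 'a set" where "chart_dom \<equiv> fst"
abbreviation coord :: "('a, 'n) chart \<Rightarrow> 'a \<Rightarrow> real^'n" where "coord \<equiv> snd"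

definition chart_image :: "('a, 'n) chart \<Rightarrow> (real^'n) set" where
  "chart_image c = coord c ` chart_dom c"

definition param :: "('a, 'n) chart \<Rightarrow> real^'n \<Rightarrow> 'a" where
  "param c = inv_into (chart_dom c) (coord c)"

definition smooth_atlas ::
    "('a::{t2_space, second_countable_topology}, 'n::finite) chart set \<Rightarrow> bool" where
  "smooth_atlas atl \<longleftrightarrow>
     (\<Union>c\<in>atl. chart_dom c) = UNIV \<and>
     (\<forall>c\<in>atl. open (chart_dom c) \<and> open (chart_image c) \<and>
        homeomorphism (chart_dom c) (chart_image c) (coord c) (param c)) \<and>
     (\<forall>c\<in>atl. \<forall>d\<in>atl. \<forall>i.
        smooth_on (coord c ` (chart_dom c \<inter> chart_dom d)) (\<lambda>x. coord d (param c x) $ i))"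

definition smooth_fun :: "('a, 'n::finite) chart set \<Rightarrow> ('a \<Rightarrow> real) \<Rightarrow> bool" where
  "smooth_fun atl f \<longleftrightarrow> (\<forall>c\<in>atl. smooth_on (chart_image c) (\<lambda>x. f (param c x)))"

text \<open>\<open>chart_partial c i f\<close> is \<open>\<partial>f/\<partial>x\<^sup>i\<close>, where \<open>x\<close> are the coordinates of \<open>c\<close>, and
  \<open>jacobian c d p i j\<close> is \<open>\<partial>y\<^sup>i/\<partial>x\<^sup>j\<close> at \<open>p\<close>, where \<open>x\<close> are the coordinates of \<open>c\<close> and
  \<open>y\<close> those of \<open>d\<close>.\<close>

definition chart_partial :: "('a, 'n::finite) chart \<Rightarrow> 'n \<Rightarrow> ('a \<Rightarrow> real) \<Rightarrow> 'a \<Rightarrow> real" where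
  "chart_partial c i f p = partial i (\<lambda>x. f (param c x)) (coord c p)"

definition jacobian ::
    "('a, 'n::finite) chart \<Rightarrow> ('a, 'n) chart \<Rightarrow> 'a \<Rightarrow> 'n \<Rightarrow> 'n \<Rightarrow> real" where
  "jacobian c d p i j = chart_partial c j (\<lambda>q. coord d q $ i) p"


section \<open>Tensor fields\<close>

text \<open>A tensor field of type \<open>(r, s)\<close> is given by its components in each chart, subject to the
  classical transformation law: \<open>T c p I J\<close> is the component at \<open>p\<close> in the chart \<open>c\<close> with upper
  (contravariant) indices \<open>I\<close>, of length \<open>r\<close>, and lower (covariant) indices \<open>J\<close>, of length \<open>s\<close>.
  The values are meaningful only for \<open>p\<close> in the domain of \<open>c\<close> and lists of these lengths.\<close>

type_synonym ('a, 'n) tensor = "('a, 'n) chart \<Rightarrow> 'a \<Rightarrow> 'n list \<Rightarrow> 'n list \<Rightarrow> real"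

definition multi_indices :: "nat \<Rightarrow> 'n list set" where
  "multi_indices r = {I. length I = r}"

definition smooth_tensor_field ::
    "('a, 'n::finite) chart set \<Rightarrow> nat \<Rightarrow> nat \<Rightarrow> ('a, 'n) tensor \<Rightarrow> bool" where
  "smooth_tensor_field atl r s T \<longleftrightarrow>
     (\<forall>c\<in>atl. \<forall>I\<in>multi_indices r. \<forall>J\<in>multi_indices s.
        smooth_on (chart_image c) (\<lambda>x. T c (param c x) I J)) \<and>
     (\<forall>c\<in>atl. \<forall>d\<in>atl. \<forall>p\<in>chart_dom c \<inter> chart_dom d.
        \<forall>I\<in>multi_indices r. \<forall>J\<in>multi_indices s.
          T d p I J =
            (\<Sum>I'\<in>multi_indices r. \<Sum>J'\<in>multi_indices s.
               (\<Prod>a<r. jacobian c d p (I ! a) (I' ! a)) *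
               (\<Prod>b<s. jacobian d c p (J' ! b) (J ! b)) * T c p I' J'))"

definition fun_tensor :: "('a \<Rightarrow> real) \<Rightarrow> ('a, 'n) tensor" where
  "fun_tensor f = (\<lambda>c p I J. f p)"


section \<open>Riemannian metrics\<close>

definition metric_mat :: "('a, 'n::finite) tensor \<Rightarrow> ('a, 'n) chart \<Rightarrow> 'a \<Rightarrow> real^'n^'n" where
  "metric_mat g c p = (\<chi> i j. g c p [] [i, j])"

definition riemannian_metric :: "('a, 'n::finite) chart set \<Rightarrow> ('a, 'n) tensor \<Rightarrow> bool" where
  "riemannian_metric atl g \<longleftrightarrow>
     smooth_tensor_field atl 0 2 g \<and>
     (\<forall>c\<in>atl. \<forall>p\<in>chart_dom c.
        transpose (metric_mat g c p) = metric_mat g c p \<and>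
        (\<forall>v. v \<noteq> 0 \<longrightarrow> v \<bullet> (metric_mat g c p *v v) > 0))"

definition riemannian_manifold ::
    "('a::{t2_space, second_countable_topology}, 'n::finite) chart set \<Rightarrow> ('a, 'n) tensor \<Rightarrow> bool"
  where "riemannian_manifold atl g \<longleftrightarrow> smooth_atlas atl \<and> riemannian_metric atl g"

definition inv_metric :: "('a, 'n::finite) tensor \<Rightarrow> ('a, 'n) chart \<Rightarrow> 'a \<Rightarrow> 'n \<Rightarrow> 'n \<Rightarrow> real" where
  "inv_metric g c p i j = matrix_inv (metric_mat g c p) $ i $ j"

text \<open>\<open>christoffel g c p k i j\<close> is the symbol with upper index \<open>k\<close> and lower indices \<open>i\<close>, \<open>j\<close>.\<close>

definition christoffel ::
    "('a, 'n::finite) tensor \<Rightarrow> ('a, 'n) chart \<Rightarrow> 'a \<Rightarrow> 'n \<Rightarrow> 'n \<Rightarrow> 'n \<Rightarrow> real" where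
  "christoffel g c p k i j =
     (1/2) * (\<Sum>l\<in>UNIV. inv_metric g c p k l *
        (chart_partial c i (\<lambda>q. g c q [] [j, l]) p
         + chart_partial c j (\<lambda>q. g c q [] [i, l]) p
         - chart_partial c l (\<lambda>q. g c q [] [i, j]) p))"

text \<open>The Levi-Civita covariant derivative of a tensor field of type \<open>(r, s)\<close>, which is of type
  \<open>(r, s + 1)\<close>. The new index (the direction of differentiation) is the first lower index.\<close>

definition cov_deriv :: "('a, 'n::finite) tensor \<Rightarrow> ('a, 'n) tensor \<Rightarrow> ('a, 'n) tensor" where
  "cov_deriv g T c p I L =
     (case L of [] \<Rightarrow> 0
      | k # J \<Rightarrow>
          chart_partial c k (\<lambda>q. T c q I J) p
          + (\<Sum>a<length I. \<Sum>m\<in>UNIV. christoffel g c p (I ! a) k m * T c p (I[a := m]) J)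
          - (\<Sum>b<length J. \<Sum>m\<in>UNIV. christoffel g c p m k (J ! b) * T c p I (J[b := m])))"

text \<open>Norm and Laplacian are independent of the chart, by tensoriality; they are computed in some
  chart of the atlas around the point.\<close>

definition chart_at :: "('a, 'n) chart set \<Rightarrow> 'a \<Rightarrow> ('a, 'n) chart" where
  "chart_at atl p = (SOME c. c \<in> atl \<and> p \<in> chart_dom c)"

definition tensor_norm ::
    "('a, 'n::finite) chart set \<Rightarrow> ('a, 'n) tensor \<Rightarrow> nat \<Rightarrow> nat \<Rightarrow> ('a, 'n) tensor \<Rightarrow> 'a \<Rightarrow> real"
  where
  "tensor_norm atl g r s T p =
     (let c = chart_at atl p in
      sqrt (\<Sum>I\<in>multi_indices r. \<Sum>I'\<in>multi_indices r.
            \<Sum>J\<in>multi_indices s. \<Sum>J'\<in>multi_indices s.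
              (\<Prod>a<r. metric_mat g c p $ (I ! a) $ (I' ! a)) *
              (\<Prod>b<s. inv_metric g c p (J ! b) (J' ! b)) *
              T c p I J * T c p I' J'))"

definition grad_norm ::
    "('a, 'n::finite) chart set \<Rightarrow> ('a, 'n) tensor \<Rightarrow> ('a \<Rightarrow> real) \<Rightarrow> 'a \<Rightarrow> real" where
  "grad_norm atl g f p = tensor_norm atl g 0 1 (cov_deriv g (fun_tensor f)) p"

definition laplacian ::
    "('a, 'n::finite) chart set \<Rightarrow> ('a, 'n) tensor \<Rightarrow> ('a \<Rightarrow> real) \<Rightarrow> 'a \<Rightarrow> real" where
  "laplacian atl g f p =
     (let c = chart_at atl p in
      \<Sum>i\<in>UNIV. \<Sum>j\<in>UNIV.
        inv_metric g c p i j * cov_deriv g (cov_deriv g (fun_tensor f)) c p [] [i, j])"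

text \<open>The norm of \<open>C\<^sup>k(U, g)\<close> for fields of type \<open>(r, s)\<close>, possibly infinite.\<close>

definition Ck_norm ::
    "('a, 'n::finite) chart set \<Rightarrow> nat \<Rightarrow> nat \<Rightarrow> nat \<Rightarrow> 'a set \<Rightarrow> ('a, 'n) tensor \<Rightarrow>
     ('a, 'n) tensor \<Rightarrow> ennreal" where
  "Ck_norm atl r s k U g T =
     (SUP p\<in>U. ennreal (\<Sum>j\<le>k. tensor_norm atl g r (s + j) ((cov_deriv g ^^ j) T) p))"

end

theory Submission
  imports Defs
begin

text \<open>
  Write \<open>T\<close> for the \<open>k\<close>-th covariant derivative of the field \<open>\<eta>\<close> at a fixed time, and suppose that \<open>|T|\<close> is
  already known to be small while \<open>|\<nabla>T|\<close>, \<open>|\<nabla>\<^sup>2T|\<close>, \<open>|\<nabla>\<^sup>3T|\<close> are bounded. Bochner's formula for the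
  rough Laplacian,
    \<open>\<Delta>|T|\<^sup>2 = 2|\<nabla>T|\<^sup>2 + 2\<langle>tr \<nabla>\<^sup>2T, T\<rangle>\<close>,
  involves no curvature: its last term is at most a constant times \<open>|\<nabla>\<^sup>2T| |T|\<close>, hence small. Applied to
  \<open>\<nabla>T\<close> it bounds \<open>\<Delta>|\<nabla>T|\<^sup>2\<close> from below. Hence \<open>F = |\<nabla>T|\<^sup>2 + M |T|\<^sup>2\<close> satisfies
    \<open>\<Delta>F \<ge> 2M |\<nabla>T|\<^sup>2 - C - M \<cdot> small\<close>,
  and at a maximum of a cut-off multiple of \<open>F\<close> the maximum principle gives
  \<open>|\<nabla>T|\<^sup>2 \<le> C/M + small\<close>. If \<open>|T|\<^sup>2 \<le> h\<close>, the choice \<open>M = 1/\<surd>h\<close> makes both \<open>1/M\<close> and \<open>M |T|\<^sup>2\<close> at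
  most \<open>\<surd>h\<close>, so that \<open>|\<nabla>T|\<^sup>2\<close> is of order \<open>\<surd>h\<close>.

  Only one cut-off function \<open>\<rho>\<close> is available, and only the constant \<open>B\<^sub>K\<close> belonging to it may enter the
  rate; smallness of \<open>|T|\<close> on the set where \<open>\<rho> = 1\<close> would therefore not suffice for the next step.
  What is propagated instead is a weighted bound \<open>\<rho>\<^sup>2\<^sup>k |T|\<^sup>2 \<le> h\<^sub>k\<close> on the whole support of \<open>\<rho>\<close>. The
  function to be maximised is \<open>\<rho>\<^sup>2\<^sup>k\<^sup>+\<^sup>2 F\<close>: its Laplacian loses two powers of \<open>\<rho>\<close>, and exactly
  \<open>\<rho>\<^sup>2\<^sup>k M |T|\<^sup>2 \<le> M h\<^sub>k\<close> is left. The mixed gradient term is removed by the vanishing of the first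
  derivative at the maximum, so that only \<open>|\<nabla>\<rho>|\<^sup>2 + |\<Delta>\<rho>|\<close> enters. This step is
  \<open>weighted_derivative_estimate\<close>, its iteration \<open>weighted_decay_bound\<close>. All estimates are made at one
  point in a frame that is orthonormal for the metric at that time, so their constants depend on the
  dimension and on \<open>k\<close> only.

  Tensor fields are families of components in charts, and the norm at a point is taken in a chart
  that depends on the point. That \<open>|\<nabla>\<^sup>k\<eta>|\<^sup>2\<close> is nevertheless a smooth function rests on the
  transformation law of the Levi-Civita connection (\<open>jacobian_mat_partial\<close>) and the resulting
  tensoriality of the covariant derivative (\<open>components_cov_deriv_law\<close>). Tensoriality and the
  Leibniz rule for the metric have the same algebraic source: if the derivative of a matrix in each
  slot of a tensor is given by commuting it with the connection, the same holds for the tensor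
  product of these matrices (\<open>contract_derivative\<close>, \<open>pairing_derivative\<close>).
\<close>

section \<open>Calculus of smooth functions on open sets\<close>

text \<open>Smoothness is defined by words of partial derivatives whose last letter is applied first. The
  recursion peels off that letter, so that closure properties follow by induction on the order.\<close>

primrec Ck_on :: "nat \<Rightarrow> (real^'n::finite) set \<Rightarrow> (real^'n \<Rightarrow> real) \<Rightarrow> bool" where
  "Ck_on 0 S f \<longleftrightarrow> f differentiable_on S"
| "Ck_on (Suc k) S f \<longleftrightarrow> f differentiable_on S \<and> (\<forall>i. Ck_on k S (partial i f))"

lemma Ck_on_iff: "Ck_on k S f \<longleftrightarrow> (\<forall>is. length is \<le> k \<longrightarrow> foldr partial is f differentiable_on S)"
proof (induction k arbitrary: f)
  case 0 show ?case by simp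
next
  case (Suc k)
  show ?case
  proof
    assume l: "Ck_on (Suc k) S f"
    show "\<forall>is. length is \<le> Suc k \<longrightarrow> foldr partial is f differentiable_on S"
    proof (intro allI impI)
      fix "is" :: "'a list" assume len: "length is \<le> Suc k"
      show "foldr partial is f differentiable_on S"
      proof (cases "is" rule: rev_cases)
        case Nil then show ?thesis using l by simp
      next
        case (snoc js i)
        have "Ck_on k S (partial i f)" using l by simp
        then show ?thesis using Suc[of "partial i f"] len snoc by simp
      qed
    qed
  next
    assume r: "\<forall>is. length is \<le> Suc k \<longrightarrow> foldr partial is f differentiable_on S"
    have "f differentiable_on S" using r[rule_format, of "[]"] by simp
    moreover have "Ck_on k S (partial i f)" for i
      using r[rule_format, of "js @ [i]" for js] Suc[of "partial i f"] by simp
    ultimately show "Ck_on (Suc k) S f" by simp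
  qed
qed

lemma smooth_on_iff_Ck_on: "smooth_on S f \<longleftrightarrow> (\<forall>k. Ck_on k S f)"
  unfolding smooth_on_def Ck_on_iff by auto

lemma Ck_on_SucD: "Ck_on (Suc k) S f \<Longrightarrow> Ck_on k S f"
  by (auto simp: Ck_on_iff)

lemma Ck_on_differentiable: "Ck_on k S f \<Longrightarrow> f differentiable_on S"
  by (cases k) auto

lemma partial_eqI:
  assumes "(f has_derivative f') (at x)" shows "partial i f x = f' (axis i 1)"
  using frechet_derivative_at[OF assms] by (simp add: partial_def)

lemma partial_cong:
  assumes "open S" "x \<in> S" "\<And>y. y \<in> S \<Longrightarrow> f y = g y" "f differentiable (at x)"
  shows "partial i f x = partial i g x"
  using frechet_derivative_transform_within_open[of f x S g] assms by (simp add: partial_def)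

lemma Ck_on_cong:
  assumes "open S"
  shows "(\<And>y. y \<in> S \<Longrightarrow> f y = g y) \<Longrightarrow> Ck_on k S f \<Longrightarrow> Ck_on k S g"
proof (induction k arbitrary: f g)
  case 0 then show ?case by (metis Ck_on.simps(1) differentiable_on_def differentiable_transform_within zero_less_one)
next
  case (Suc k)
  have fd: "f differentiable_on S" using Suc.prems by simp
  then have "g differentiable_on S" using Suc.prems(1)
    by (metis differentiable_on_def differentiable_transform_within zero_less_one)
  moreover have "Ck_on k S (partial i g)" for i
  proof (rule Suc.IH)
    show "Ck_on k S (partial i f)" using Suc.prems by simp
    show "partial i f y = partial i g y" if "y \<in> S" for y
      using assms that Suc.prems(1) fd
      by (intro partial_cong[of S]) (auto simp: differentiable_on_eq_differentiable_at)
  qed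
  ultimately show ?case by simp
qed

lemma partial_const: "partial i (\<lambda>x. c) = (\<lambda>x. 0)"
  by (simp add: partial_def fun_eq_iff)

lemma Ck_on_const: "Ck_on k S (\<lambda>x. c)"
  by (induction k arbitrary: c) (auto simp: partial_const)

lemma partial_add:
  assumes "f differentiable (at x)" "g differentiable (at x)"
  shows "partial i (\<lambda>x. f x + g x) x = partial i f x + partial i g x"
proof -
  obtain f' g' where "(f has_derivative f') (at x)" "(g has_derivative g') (at x)"
    using assms by (auto simp: differentiable_def)
  then show ?thesis
    by (simp add: partial_eqI partial_eqI[OF has_derivative_add])
qed

lemma partial_mult:
  assumes "f differentiable (at x)" "g differentiable (at x)"
  shows "partial i (\<lambda>x. f x * g x) x = f x * partial i g x + partial i f x * g x"
proof -
  obtain f' g' where "(f has_derivative f') (at x)" "(g has_derivative g') (at x)"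
    using assms by (auto simp: differentiable_def)
  then show ?thesis
    by (simp add: partial_eqI partial_eqI[OF has_derivative_mult])
qed

lemma partial_inverse:
  assumes "f differentiable (at x)" "f x \<noteq> 0"
  shows "partial i (\<lambda>x. inverse (f x)) x = (- 1) * (partial i f x * (inverse (f x) * inverse (f x)))"
proof -
  obtain f' where f': "(f has_derivative f') (at x)"
    using assms by (auto simp: differentiable_def)
  show ?thesis
    using partial_eqI[OF Deriv.has_derivative_inverse[of f x f' UNIV, OF assms(2) f']] partial_eqI[OF f']
    by (simp add: mult_ac)
qed

context
  fixes S :: "(real^'n::finite) set"
  assumes S: "open S"
begin

lemma Ck_on_add: "Ck_on k S f \<Longrightarrow> Ck_on k S g \<Longrightarrow> Ck_on k S (\<lambda>x. f x + g x)"
proof (induction k arbitrary: f g)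
  case 0 then show ?case by simp
next
  case (Suc k)
  have d: "f differentiable_on S" "g differentiable_on S" using Suc.prems by auto
  have "Ck_on k S (partial i (\<lambda>x. f x + g x))" for i
  proof (rule Ck_on_cong[OF S])
    show "Ck_on k S (\<lambda>x. partial i f x + partial i g x)" using Suc by simp
    show "partial i f y + partial i g y = partial i (\<lambda>x. f x + g x) y" if "y \<in> S" for y
      using d that S by (simp add: partial_add differentiable_on_eq_differentiable_at)
  qed
  then show ?case using d by simp
qed

lemma Ck_on_mult: "Ck_on k S f \<Longrightarrow> Ck_on k S g \<Longrightarrow> Ck_on k S (\<lambda>x. f x * g x)"
proof (induction k arbitrary: f g)
  case 0 then show ?case by simp
next
  case (Suc k)
  have d: "f differentiable_on S" "g differentiable_on S" using Suc.prems by auto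
  have "Ck_on k S (partial i (\<lambda>x. f x * g x))" for i
  proof (rule Ck_on_cong[OF S])
    show "Ck_on k S (\<lambda>x. f x * partial i g x + partial i f x * g x)"
      using Suc.prems Suc.IH[of f "partial i g"] Suc.IH[of "partial i f" g] Ck_on_SucD
      by (intro Ck_on_add) auto
    show "f y * partial i g y + partial i f y * g y = partial i (\<lambda>x. f x * g x) y" if "y \<in> S" for y
      using d that S by (simp add: partial_mult differentiable_on_eq_differentiable_at)
  qed
  then show ?case using d by simp
qed

lemma Ck_on_inverse:
  "Ck_on k S f \<Longrightarrow> (\<And>x. x \<in> S \<Longrightarrow> f x \<noteq> 0) \<Longrightarrow> Ck_on k S (\<lambda>x. inverse (f x))"
proof (induction k arbitrary: f)
  case 0 then show ?case by simp
next
  case (Suc k)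
  have d: "f differentiable_on S" using Suc.prems by auto
  have "Ck_on k S (partial i (\<lambda>x. inverse (f x)))" for i
  proof (rule Ck_on_cong[OF S])
    show "Ck_on k S (\<lambda>x. (- 1) * (partial i f x * (inverse (f x) * inverse (f x))))"
      using Suc.prems Suc.IH[of f] Ck_on_SucD by (intro Ck_on_mult Ck_on_const) auto
    show "(- 1) * (partial i f y * (inverse (f y) * inverse (f y))) = partial i (\<lambda>x. inverse (f x)) y"
      if "y \<in> S" for y
      using d that S Suc.prems(2)[OF that]
      by (subst partial_inverse) (auto simp: differentiable_on_eq_differentiable_at)
  qed
  then show ?case using d Suc.prems by simp
qed

lemma smooth_on_cong: "(\<And>y. y \<in> S \<Longrightarrow> f y = g y) \<Longrightarrow> smooth_on S f \<Longrightarrow> smooth_on S g"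
  unfolding smooth_on_iff_Ck_on using Ck_on_cong[OF S] by blast

lemma smooth_on_const: "smooth_on S (\<lambda>x. c)"
  unfolding smooth_on_iff_Ck_on using Ck_on_const by blast

lemma smooth_on_add: "smooth_on S f \<Longrightarrow> smooth_on S g \<Longrightarrow> smooth_on S (\<lambda>x. f x + g x)"
  unfolding smooth_on_iff_Ck_on using Ck_on_add by blast

lemma smooth_on_mult: "smooth_on S f \<Longrightarrow> smooth_on S g \<Longrightarrow> smooth_on S (\<lambda>x. f x * g x)"
  unfolding smooth_on_iff_Ck_on using Ck_on_mult by blast

lemma smooth_on_inverse:
  "smooth_on S f \<Longrightarrow> (\<And>x. x \<in> S \<Longrightarrow> f x \<noteq> 0) \<Longrightarrow> smooth_on S (\<lambda>x. inverse (f x))"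
  unfolding smooth_on_iff_Ck_on using Ck_on_inverse by blast

lemma smooth_on_minus: "smooth_on S f \<Longrightarrow> smooth_on S (\<lambda>x. - f x)"
  using smooth_on_mult[OF smooth_on_const[of "-1"], of f] by simp

lemma smooth_on_diff: "smooth_on S f \<Longrightarrow> smooth_on S g \<Longrightarrow> smooth_on S (\<lambda>x. f x - g x)"
  using smooth_on_add[of f "\<lambda>x. - g x"] smooth_on_minus by simp

lemma smooth_on_power: "smooth_on S f \<Longrightarrow> smooth_on S (\<lambda>x. f x ^ m)"
  by (induction m) (auto intro: smooth_on_mult smooth_on_const)

lemma smooth_on_sum: "(\<And>a. a \<in> A \<Longrightarrow> smooth_on S (f a)) \<Longrightarrow> smooth_on S (\<lambda>x. \<Sum>a\<in>A. f a x)"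
  by (induction A rule: infinite_finite_induct) (auto intro: smooth_on_add smooth_on_const)

lemma smooth_on_prod: "(\<And>a. a \<in> A \<Longrightarrow> smooth_on S (f a)) \<Longrightarrow> smooth_on S (\<lambda>x. \<Prod>a\<in>A. f a x)"
  by (induction A rule: infinite_finite_induct) (auto intro: smooth_on_mult smooth_on_const)

end

lemma smooth_on_partial: "smooth_on S f \<Longrightarrow> smooth_on S (partial i f)"
  unfolding smooth_on_iff_Ck_on by (metis Ck_on.simps(2))

lemma smooth_on_differentiable: "smooth_on S f \<Longrightarrow> open S \<Longrightarrow> x \<in> S \<Longrightarrow> f differentiable (at x)"
  by (metis Ck_on.simps(1) differentiable_on_eq_differentiable_at smooth_on_iff_Ck_on)

lemma smooth_on_continuous_on: "smooth_on S f \<Longrightarrow> continuous_on S f"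
  using Ck_on_differentiable differentiable_imp_continuous_on smooth_on_iff_Ck_on by blast

lemma frechet_derivative_eq_sum_partial:
  assumes "f differentiable (at x)"
  shows "frechet_derivative f (at x) v = (\<Sum>i\<in>UNIV. v $ i * partial i f x)"
proof -
  interpret linear "frechet_derivative f (at x)" by (rule linear_frechet_derivative[OF assms])
  have "v = (\<Sum>i\<in>UNIV. v $ i *\<^sub>R axis i 1)"
    using basis_expansion[of v] by (simp add: scalar_mult_eq_scaleR)
  then have "frechet_derivative f (at x) v = frechet_derivative f (at x) (\<Sum>i\<in>UNIV. v $ i *\<^sub>R axis i 1)"
    by simp
  also have "\<dots> = (\<Sum>i\<in>UNIV. v $ i * partial i f x)"
    by (simp add: sum scale partial_def)
  finally show ?thesis .
qed

lemma line_derivative: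
  assumes "f differentiable (at (x + s *\<^sub>R v))"
  shows "((\<lambda>s. f (x + s *\<^sub>R v)) has_real_derivative (\<Sum>i\<in>UNIV. v $ i * partial i f (x + s *\<^sub>R v))) (at s)"
proof -
  let ?F = "frechet_derivative f (at (x + s *\<^sub>R v))"
  have "(f has_derivative ?F) (at (x + s *\<^sub>R v))"
    using assms frechet_derivative_works by blast
  moreover have "((\<lambda>s. x + s *\<^sub>R v) has_derivative (\<lambda>h. h *\<^sub>R v)) (at s)"
    by (auto intro!: derivative_eq_intros)
  ultimately have "((\<lambda>s. f (x + s *\<^sub>R v)) has_derivative (\<lambda>h. ?F (h *\<^sub>R v))) (at s)"
    using has_derivative_compose[of "\<lambda>s. x + s *\<^sub>R v" "\<lambda>h. h *\<^sub>R v" s UNIV f ?F] by (simp add: o_def)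
  moreover have "?F (h *\<^sub>R v) = (\<Sum>i\<in>UNIV. v $ i * partial i f (x + s *\<^sub>R v)) * h" for h
    by (simp add: frechet_derivative_eq_sum_partial[OF assms] sum_distrib_left mult_ac)
  ultimately show ?thesis
    unfolding has_field_derivative_def by simp
qed

lemma axis_derivative:
  assumes "f differentiable (at (x + s *\<^sub>R axis i 1))"
  shows "((\<lambda>s. f (x + s *\<^sub>R axis i 1)) has_real_derivative partial i f (x + s *\<^sub>R axis i 1)) (at s)"
proof -
  have "(\<Sum>j\<in>UNIV. (axis i 1 :: real^'a) $ j * partial j f (x + s *\<^sub>R axis i 1)) = partial i f (x + s *\<^sub>R axis i 1)"
    by (simp add: axis_def if_distrib if_distribR cong: if_cong)
  then show ?thesis using line_derivative[OF assms] by simp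
qed

text \<open>Two applications of the mean value theorem. The second difference is symmetric in \<open>i\<close> and \<open>j\<close>,
  so it is also a value of the other mixed derivative; in the limit of small squares the mixed
  derivatives agree.\<close>

lemma second_difference_mean_value:
  fixes f :: "real^'n::finite \<Rightarrow> real"
  assumes f: "smooth_on S f" and S: "open S" and d: "ball x d \<subseteq> S" and h: "0 < h" "2 * h < d"
  shows "\<exists>z\<in>ball x d. f (x + h *\<^sub>R axis i 1 + h *\<^sub>R axis j 1) - f (x + h *\<^sub>R axis i 1)
    - f (x + h *\<^sub>R axis j 1) + f x = h * h * partial j (partial i f) z"
proof -
  let ?a = "axis i 1 :: real^'n" and ?b = "axis j 1 :: real^'n"
  have inS: "x + s *\<^sub>R ?a + t *\<^sub>R ?b \<in> ball x d" if "0 \<le> s" "s \<le> h" "0 \<le> t" "t \<le> h" for s t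
  proof -
    have "norm (s *\<^sub>R ?a + t *\<^sub>R ?b) \<le> s + t"
      using norm_triangle_ineq[of "s *\<^sub>R ?a" "t *\<^sub>R ?b"] that by simp
    then have "norm (s *\<^sub>R ?a + t *\<^sub>R ?b) < d" using that h by linarith
    moreover have "dist x (x + s *\<^sub>R ?a + t *\<^sub>R ?b) = norm (- (s *\<^sub>R ?a + t *\<^sub>R ?b))"
      unfolding dist_norm by (simp add: algebra_simps)
    ultimately show ?thesis unfolding mem_ball norm_minus_cancel by simp
  qed
  have df: "f differentiable (at y)" "partial i f differentiable (at y)" if "y \<in> ball x d" for y
    using that d smooth_on_differentiable[OF f S] smooth_on_differentiable[OF smooth_on_partial[OF f] S] by auto
  have der: "((\<lambda>s. f (x + s *\<^sub>R ?a + h *\<^sub>R ?b) - f (x + s *\<^sub>R ?a)) has_real_derivative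
      partial i f (x + s *\<^sub>R ?a + h *\<^sub>R ?b) - partial i f (x + s *\<^sub>R ?a)) (at s)"
    if s: "0 \<le> s" "s \<le> h" for s
  proof (rule DERIV_diff)
    show "((\<lambda>s. f (x + s *\<^sub>R ?a)) has_real_derivative partial i f (x + s *\<^sub>R ?a)) (at s)"
      using inS[of s 0] s h by (intro axis_derivative df) auto
    show "((\<lambda>s. f (x + s *\<^sub>R ?a + h *\<^sub>R ?b)) has_real_derivative partial i f (x + s *\<^sub>R ?a + h *\<^sub>R ?b)) (at s)"
      using axis_derivative[of f "x + h *\<^sub>R ?b" s i] inS[of s h] s h df(1)[of "x + s *\<^sub>R ?a + h *\<^sub>R ?b"]
      by (simp add: algebra_simps)
  qed
  obtain s where s: "0 < s" "s < h" and es: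
    "f (x + h *\<^sub>R ?a + h *\<^sub>R ?b) - f (x + h *\<^sub>R ?a) - (f (x + 0 *\<^sub>R ?a + h *\<^sub>R ?b) - f (x + 0 *\<^sub>R ?a))
     = (h - 0) * (partial i f (x + s *\<^sub>R ?a + h *\<^sub>R ?b) - partial i f (x + s *\<^sub>R ?a))"
    using MVT2[OF h(1), of "\<lambda>s. f (x + s *\<^sub>R ?a + h *\<^sub>R ?b) - f (x + s *\<^sub>R ?a)", OF der] by blast
  have der2: "((\<lambda>t. partial i f (x + s *\<^sub>R ?a + t *\<^sub>R ?b)) has_real_derivative
      partial j (partial i f) (x + s *\<^sub>R ?a + t *\<^sub>R ?b)) (at t)" if "0 \<le> t" "t \<le> h" for t
    using inS[of s t] s that by (intro axis_derivative df) auto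
  obtain t where t: "0 < t" "t < h" and et:
    "partial i f (x + s *\<^sub>R ?a + h *\<^sub>R ?b) - partial i f (x + s *\<^sub>R ?a + 0 *\<^sub>R ?b)
     = (h - 0) * partial j (partial i f) (x + s *\<^sub>R ?a + t *\<^sub>R ?b)"
    using MVT2[OF h(1), of "\<lambda>t. partial i f (x + s *\<^sub>R ?a + t *\<^sub>R ?b)", OF der2] by blast
  show ?thesis
    using es et inS[of s t] s t by (intro bexI[of _ "x + s *\<^sub>R ?a + t *\<^sub>R ?b"]) (auto simp: algebra_simps)
qed

lemma partial_commute:
  fixes f :: "real^'n::finite \<Rightarrow> real"
  assumes f: "smooth_on S f" and S: "open S" and x: "x \<in> S"
  shows "partial i (partial j f) x = partial j (partial i f) x"
proof (rule ccontr)
  assume ne: "\<not> ?thesis"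
  define e where "e = \<bar>partial i (partial j f) x - partial j (partial i f) x\<bar> / 2"
  have e: "e > 0" using ne by (simp add: e_def)
  have cont: "isCont (partial a (partial b f)) x" for a b
    using smooth_on_continuous_on[OF smooth_on_partial[OF smooth_on_partial[OF f]]] S x
      continuous_on_eq_continuous_at by blast
  obtain d1 where d1: "d1 > 0" "\<And>y. dist y x < d1 \<Longrightarrow> dist (partial i (partial j f) y) (partial i (partial j f) x) < e"
    using cont[of i j] e unfolding continuous_at_eps_delta by metis
  obtain d2 where d2: "d2 > 0" "\<And>y. dist y x < d2 \<Longrightarrow> dist (partial j (partial i f) y) (partial j (partial i f) x) < e"
    using cont[of j i] e unfolding continuous_at_eps_delta by metis
  obtain d3 where d3: "d3 > 0" "ball x d3 \<subseteq> S" using S x open_contains_ball by blast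
  define d where "d = min d1 (min d2 d3)"
  have d: "d > 0" "ball x d \<subseteq> S" using d1 d2 d3 by (auto simp: d_def)
  define h where "h = d / 3"
  have h: "0 < h" "2 * h < d" using d by (auto simp: h_def)
  obtain y where y: "y \<in> ball x d" "f (x + h *\<^sub>R axis j 1 + h *\<^sub>R axis i 1) - f (x + h *\<^sub>R axis j 1)
    - f (x + h *\<^sub>R axis i 1) + f x = h * h * partial i (partial j f) y"
    using second_difference_mean_value[OF f S d(2) h] by blast
  obtain z where z: "z \<in> ball x d" "f (x + h *\<^sub>R axis i 1 + h *\<^sub>R axis j 1) - f (x + h *\<^sub>R axis i 1)
    - f (x + h *\<^sub>R axis j 1) + f x = h * h * partial j (partial i f) z"
    using second_difference_mean_value[OF f S d(2) h] by blast
  have "h * h * partial i (partial j f) y = h * h * partial j (partial i f) z"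
    using y(2) z(2) by (simp add: algebra_simps)
  then have "partial i (partial j f) y = partial j (partial i f) z" using h by simp
  moreover have "\<bar>partial i (partial j f) y - partial i (partial j f) x\<bar> < e"
    using d1(2)[of y] y(1) by (simp add: d_def dist_commute dist_real_def)
  moreover have "\<bar>partial j (partial i f) z - partial j (partial i f) x\<bar> < e"
    using d2(2)[of z] z(1) by (simp add: d_def dist_commute dist_real_def)
  moreover have "2 * e = \<bar>partial i (partial j f) x - partial j (partial i f) x\<bar>" by (simp add: e_def)
  ultimately show False by linarith
qed

section \<open>Second order necessary conditions at a maximum\<close>

text \<open>If the second derivative were positive, the first one, which vanishes at the maximum, would be
  positive immediately to the right of it, and the function would increase there.\<close>

lemma max_line_second_derivative:
  fixes \<phi> \<phi>' :: "real \<Rightarrow> real"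
  assumes e: "e > 0" and d: "\<And>s. \<bar>s\<bar> < e \<Longrightarrow> (\<phi> has_real_derivative \<phi>' s) (at s)"
    and d2: "(\<phi>' has_real_derivative l) (at 0)" and mx: "\<And>s. \<bar>s\<bar> < e \<Longrightarrow> \<phi> s \<le> \<phi> 0"
  shows "\<phi>' 0 = 0" "l \<le> 0"
proof -
  show z: "\<phi>' 0 = 0"
    by (rule DERIV_local_max[OF d[of 0] e]) (use e mx in auto)
  show "l \<le> 0"
  proof (rule ccontr)
    assume "\<not> l \<le> 0"
    then obtain b where b: "b > 0" "\<And>h. h > 0 \<Longrightarrow> h < b \<Longrightarrow> \<phi>' 0 < \<phi>' (0 + h)"
      using DERIV_pos_inc_right[OF d2] by (metis not_le)
    define h where "h = min b e / 2"
    have h: "0 < h" "h < b" "h < e" using b(1) e by (auto simp: h_def min_def)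
    obtain s where s: "0 < s" "s < h" "\<phi> h - \<phi> 0 = (h - 0) * \<phi>' s"
      using MVT2[OF h(1), of \<phi> \<phi>'] d h by (metis abs_of_nonneg le_less_trans)
    have "\<phi>' s > 0" using b(2)[of s] s h z by simp
    then have "h * \<phi>' s > 0" using h by simp
    then have "\<phi> h > \<phi> 0" using s(3) by simp
    then show False using mx[of h] h by simp
  qed
qed

lemma max_second_derivative:
  fixes f :: "real^'n::finite \<Rightarrow> real"
  assumes f: "smooth_on S f" and S: "open S" and x: "x \<in> S" and mx: "\<And>y. y \<in> S \<Longrightarrow> f y \<le> f x"
  shows "partial i f x = 0" "(\<Sum>i\<in>UNIV. \<Sum>j\<in>UNIV. v $ i * v $ j * partial i (partial j f) x) \<le> 0"
proof -
  have *: "(\<Sum>i\<in>UNIV. v $ i * partial i f x) = 0 \<and>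
     (\<Sum>j\<in>UNIV. v $ j * (\<Sum>i\<in>UNIV. v $ i * partial i (partial j f) x)) \<le> 0" for v
  proof -
    have "open ((\<lambda>s. x + s *\<^sub>R v) -` S)"
      by (intro continuous_open_vimage S) (auto intro!: continuous_intros)
    then obtain e where e: "e > 0" "ball 0 e \<subseteq> (\<lambda>s. x + s *\<^sub>R v) -` S"
      using x unfolding open_contains_ball by force
    have inS: "x + s *\<^sub>R v \<in> S" if "\<bar>s\<bar> < e" for s using e(2) that by (auto simp: subset_iff)
    define \<phi>' where "\<phi>' = (\<lambda>s. \<Sum>j\<in>UNIV. v $ j * partial j f (x + s *\<^sub>R v))"
    have 1: "((\<lambda>s. f (x + s *\<^sub>R v)) has_real_derivative \<phi>' s) (at s)" if "\<bar>s\<bar> < e" for s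
      unfolding \<phi>'_def by (intro line_derivative smooth_on_differentiable[OF f S] inS that)
    have 2: "(\<phi>' has_real_derivative (\<Sum>j\<in>UNIV. v $ j * (\<Sum>i\<in>UNIV. v $ i * partial i (partial j f) (x + 0 *\<^sub>R v)))) (at 0)"
      unfolding \<phi>'_def
      by (intro DERIV_sum DERIV_cmult line_derivative smooth_on_differentiable[OF smooth_on_partial[OF f] S] inS) (use e in simp)
    have "\<phi>' 0 = 0 \<and> (\<Sum>j\<in>UNIV. v $ j * (\<Sum>i\<in>UNIV. v $ i * partial i (partial j f) (x + 0 *\<^sub>R v))) \<le> 0"
      using max_line_second_derivative[OF e(1) 1 2] mx inS by simp
    then show ?thesis by (simp add: \<phi>'_def)
  qed
  have "(\<Sum>j\<in>UNIV. (axis i 1 :: real^'n) $ j * partial j f x) = partial i f x"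
    by (simp add: axis_def if_distrib if_distribR cong: if_cong)
  then show "partial i f x = 0" using *[of "axis i 1"] by simp
  show "(\<Sum>i\<in>UNIV. \<Sum>j\<in>UNIV. v $ i * v $ j * partial i (partial j f) x) \<le> 0"
    using *[of v] by (subst sum.swap) (simp add: sum_distrib_left mult_ac)
qed

section \<open>Multi-index algebra\<close>

text \<open>The components of a tensor are a function of a single index list, whose slots are tagged with their
  variance (\<open>True\<close> for covariant). The three operations are the extensions of slotwise matrices to
  tensors: \<open>contract\<close> is their tensor product, \<open>pairing\<close> the bilinear form with the given Gram matrix in
  each slot, and \<open>act\<close> the extension as a derivation, which is how the Christoffel symbols enter a
  covariant derivative. Recursion on the list of variances reduces each of their properties to a
  statement about one matrix.\<close>

primrec contract ::
  "(bool \<Rightarrow> 'n::finite \<Rightarrow> 'n \<Rightarrow> real) \<Rightarrow> bool list \<Rightarrow> ('n list \<Rightarrow> real) \<Rightarrow> 'n list \<Rightarrow> real" where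
  "contract N [] T L = T []"
| "contract N (v # vs) T L = (\<Sum>j\<in>UNIV. N v (hd L) j * contract N vs (\<lambda>M. T (j # M)) (tl L))"

primrec pairing ::
  "(bool \<Rightarrow> 'n::finite \<Rightarrow> 'n \<Rightarrow> real) \<Rightarrow> bool list \<Rightarrow> ('n list \<Rightarrow> real) \<Rightarrow> ('n list \<Rightarrow> real) \<Rightarrow> real" where
  "pairing W [] T S = T [] * S []"
| "pairing W (v # vs) T S =
     (\<Sum>i\<in>UNIV. \<Sum>j\<in>UNIV. W v i j * pairing W vs (\<lambda>L. T (i # L)) (\<lambda>L. S (j # L)))"

primrec act ::
  "(bool \<Rightarrow> 'n::finite \<Rightarrow> 'n \<Rightarrow> real) \<Rightarrow> bool list \<Rightarrow> ('n list \<Rightarrow> real) \<Rightarrow> 'n list \<Rightarrow> real" where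
  "act C [] T L = 0"
| "act C (v # vs) T L =
     (\<Sum>m\<in>UNIV. C v (hd L) m * T (m # tl L)) + act C vs (\<lambda>M. T (hd L # M)) (tl L)"

lemma contract_cong:
  "(\<And>L. length L = length vs \<Longrightarrow> T L = S L) \<Longrightarrow> contract N vs T L = contract N vs S L"
proof (induction vs arbitrary: T S L)
  case (Cons v vs)
  have "contract N vs (\<lambda>M. T (j # M)) (tl L) = contract N vs (\<lambda>M. S (j # M)) (tl L)" for j
    by (rule Cons.IH) (simp add: Cons.prems)
  then show ?case by simp
qed simp

lemma pairing_cong:
  "(\<And>L. length L = length vs \<Longrightarrow> T L = T' L) \<Longrightarrow> (\<And>L. length L = length vs \<Longrightarrow> S L = S' L)
   \<Longrightarrow> pairing W vs T S = pairing W vs T' S'"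
proof (induction vs arbitrary: T T' S S')
  case (Cons v vs)
  have "pairing W vs (\<lambda>L. T (i # L)) (\<lambda>L. S (j # L)) = pairing W vs (\<lambda>L. T' (i # L)) (\<lambda>L. S' (j # L))" for i j
    by (rule Cons.IH) (simp_all add: Cons.prems)
  then show ?case by simp
qed simp

lemma act_cong:
  "(\<And>M. length M = length vs \<Longrightarrow> T M = S M) \<Longrightarrow> length L = length vs \<Longrightarrow> act C vs T L = act C vs S L"
proof (induction vs arbitrary: T S L)
  case (Cons v vs)
  have "act C vs (\<lambda>M. T (hd L # M)) (tl L) = act C vs (\<lambda>M. S (hd L # M)) (tl L)"
    by (rule Cons.IH) (use Cons.prems in auto)
  then show ?case using Cons.prems by (cases L) auto
qed simp

lemma contract_sum:
  "contract N vs (\<lambda>L. \<Sum>a\<in>A. c a * T a L) L = (\<Sum>a\<in>A. c a * contract N vs (T a) L)"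
proof (induction vs arbitrary: T L)
  case (Cons v vs)
  show ?case
    by (simp add: Cons.IH sum_distrib_left mult_ac) (subst sum.swap, simp)
qed simp

lemma contract_add: "contract N vs (\<lambda>L. T L + S L) L = contract N vs T L + contract N vs S L"
  by (induction vs arbitrary: T S L) (simp_all add: algebra_simps sum.distrib)

lemma act_sum:
  "act C vs (\<lambda>L. \<Sum>a\<in>A. c a * T a L) L = (\<Sum>a\<in>A. c a * act C vs (T a) L)"
proof (induction vs arbitrary: T L)
  case (Cons v vs)
  have "(\<Sum>m\<in>UNIV. C v (hd L) m * (\<Sum>a\<in>A. c a * T a (m # tl L))) =
        (\<Sum>a\<in>A. c a * (\<Sum>m\<in>UNIV. C v (hd L) m * T a (m # tl L)))"
    by (simp add: sum_distrib_left mult_ac) (subst sum.swap, simp)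
  then show ?case by (simp add: Cons.IH distrib_left sum.distrib)
qed simp

lemma act_sum_coeff:
  "act (\<lambda>v i m. \<Sum>e\<in>A. c e * C e v i m) vs T L = (\<Sum>e\<in>A. c e * act (C e) vs T L)"
proof (induction vs arbitrary: T L)
  case (Cons v vs)
  have "(\<Sum>m\<in>UNIV. (\<Sum>e\<in>A. c e * C e v (hd L) m) * T (m # tl L)) =
        (\<Sum>e\<in>A. c e * (\<Sum>m\<in>UNIV. C e v (hd L) m * T (m # tl L)))"
    by (simp add: sum_distrib_left sum_distrib_right mult_ac) (subst sum.swap, simp)
  then show ?case by (simp add: Cons.IH distrib_left sum.distrib)
qed simp

lemma pairing_sum_left:
  "pairing W vs (\<lambda>L. \<Sum>a\<in>A. c a * T a L) S = (\<Sum>a\<in>A. c a * pairing W vs (T a) S)"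
proof (induction vs arbitrary: T S)
  case Nil show ?case by (simp add: sum_distrib_left mult_ac)
next
  case (Cons v vs)
  have "pairing W (v # vs) (\<lambda>L. \<Sum>a\<in>A. c a * T a L) S =
     (\<Sum>i\<in>UNIV. \<Sum>j\<in>UNIV. \<Sum>a\<in>A. c a * (W v i j * pairing W vs (\<lambda>L. T a (i # L)) (\<lambda>L. S (j # L))))"
    by (simp add: Cons.IH sum_distrib_left mult_ac)
  also have "\<dots> = (\<Sum>i\<in>UNIV. \<Sum>a\<in>A. \<Sum>j\<in>UNIV. c a * (W v i j * pairing W vs (\<lambda>L. T a (i # L)) (\<lambda>L. S (j # L))))"
    by (intro sum.cong refl sum.swap)
  also have "\<dots> = (\<Sum>a\<in>A. \<Sum>i\<in>UNIV. \<Sum>j\<in>UNIV. c a * (W v i j * pairing W vs (\<lambda>L. T a (i # L)) (\<lambda>L. S (j # L))))"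
    by (rule sum.swap)
  finally show ?case by (simp add: sum_distrib_left)
qed

lemma pairing_commute_gen:
  "pairing W vs T S = pairing (\<lambda>v i j. W v j i) vs S T"
proof (induction vs arbitrary: T S)
  case (Cons v vs)
  show ?case unfolding pairing.simps by (subst sum.swap) (simp add: Cons.IH[symmetric])
qed simp

lemma pairing_sum_right:
  "pairing W vs S (\<lambda>L. \<Sum>a\<in>A. c a * T a L) = (\<Sum>a\<in>A. c a * pairing W vs S (T a))"
  by (subst (1 2) pairing_commute_gen) (rule pairing_sum_left)

lemma pairing_add_left: "pairing W vs (\<lambda>L. T L + T' L) S = pairing W vs T S + pairing W vs T' S"
  by (induction vs arbitrary: T T' S) (simp_all add: algebra_simps sum.distrib)

lemma pairing_add_right: "pairing W vs S (\<lambda>L. T L + T' L) = pairing W vs S T + pairing W vs S T'"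
  by (induction vs arbitrary: T T' S) (simp_all add: algebra_simps sum.distrib)

lemma pairing_cmult_left: "pairing W vs (\<lambda>L. c * T L) S = c * pairing W vs T S"
  using pairing_sum_left[of W vs "\<lambda>_. c" "\<lambda>_. T" "{()}"] by simp

lemma pairing_cmult_right: "pairing W vs S (\<lambda>L. c * T L) = c * pairing W vs S T"
  using pairing_sum_right[of W vs S "\<lambda>_. c" "\<lambda>_. T" "{()}"] by simp

lemma pairing_commute: "(\<And>v i j. W v i j = W v j i) \<Longrightarrow> pairing W vs T S = pairing W vs S T"
  by (subst pairing_commute_gen) (simp add: fun_eq_iff[symmetric])

text \<open>The two applications are the change of charts, with \<open>N\<close> the Jacobian, and the passage to an
  orthonormal frame, with \<open>W'\<close> the identity.\<close>

lemma pairing_contract: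
  assumes W: "\<And>v i j. W v i j = (\<Sum>k\<in>UNIV. \<Sum>l\<in>UNIV. N v k i * W' v k l * N v l j)"
  shows "pairing W' vs (contract N vs T) (contract N vs S) = pairing W vs T S"
proof (induction vs arbitrary: T S)
  case (Cons v vs)
  let ?T = "\<lambda>i M. T (i # M)" and ?S = "\<lambda>i M. S (i # M)"
  have "pairing W' (v # vs) (contract N (v # vs) T) (contract N (v # vs) S) =
    (\<Sum>k\<in>UNIV. \<Sum>l\<in>UNIV. W' v k l * pairing W' vs (\<lambda>L. \<Sum>i\<in>UNIV. N v k i * contract N vs (?T i) L)
       (\<lambda>L. \<Sum>j\<in>UNIV. N v l j * contract N vs (?S j) L))"
    by simp
  also have "\<dots> = (\<Sum>k\<in>UNIV. \<Sum>l\<in>UNIV. \<Sum>i\<in>UNIV. \<Sum>j\<in>UNIV. N v k i * W' v k l * N v l j * pairing W vs (?T i) (?S j))"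
    by (simp add: pairing_sum_left pairing_sum_right Cons.IH sum_distrib_left sum_distrib_right mult_ac)
  also have "\<dots> = (\<Sum>k\<in>UNIV. \<Sum>i\<in>UNIV. \<Sum>l\<in>UNIV. \<Sum>j\<in>UNIV. N v k i * W' v k l * N v l j * pairing W vs (?T i) (?S j))"
    by (intro sum.cong refl sum.swap)
  also have "\<dots> = (\<Sum>i\<in>UNIV. \<Sum>k\<in>UNIV. \<Sum>l\<in>UNIV. \<Sum>j\<in>UNIV. N v k i * W' v k l * N v l j * pairing W vs (?T i) (?S j))"
    by (rule sum.swap)
  also have "\<dots> = (\<Sum>i\<in>UNIV. \<Sum>k\<in>UNIV. \<Sum>j\<in>UNIV. \<Sum>l\<in>UNIV. N v k i * W' v k l * N v l j * pairing W vs (?T i) (?S j))"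
    by (intro sum.cong refl sum.swap)
  also have "\<dots> = (\<Sum>i\<in>UNIV. \<Sum>j\<in>UNIV. \<Sum>k\<in>UNIV. \<Sum>l\<in>UNIV. N v k i * W' v k l * N v l j * pairing W vs (?T i) (?S j))"
    by (intro sum.cong refl sum.swap)
  also have "\<dots> = pairing W (v # vs) T S"
    by (simp add: W sum_distrib_right)
  finally show ?case .
qed simp

subsection \<open>Derivatives\<close>

text \<open>The Leibniz rule for the inner product of tensors: the hypothesis says that the connection \<open>C\<close> is
  compatible with \<open>W\<close> on a single slot, and then it is compatible with the inner product on all tensors.\<close>

lemma pairing_derivative:
  fixes W :: "real \<Rightarrow> bool \<Rightarrow> 'n::finite \<Rightarrow> 'n \<Rightarrow> real"
  assumes W: "\<And>v i j. ((\<lambda>x. W x v i j) has_real_derivative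
      (\<Sum>m\<in>UNIV. C v m i * W x0 v m j) + (\<Sum>m\<in>UNIV. C v m j * W x0 v i m)) (at x0)"
  shows "(\<And>L. length L = length vs \<Longrightarrow> ((\<lambda>x. T x L) has_real_derivative T' L) (at x0)) \<Longrightarrow>
    (\<And>L. length L = length vs \<Longrightarrow> ((\<lambda>x. S x L) has_real_derivative S' L) (at x0)) \<Longrightarrow>
    ((\<lambda>x. pairing (W x) vs (T x) (S x)) has_real_derivative
      pairing (W x0) vs (\<lambda>L. T' L + act C vs (T x0) L) (S x0)
      + pairing (W x0) vs (T x0) (\<lambda>L. S' L + act C vs (S x0) L)) (at x0)"
proof (induction vs arbitrary: T T' S S')
  case Nil
  then show ?case by (auto intro!: derivative_eq_intros)
next
  case (Cons v vs)
  let ?P = "\<lambda>T S. pairing (W x0) vs T S"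
  let ?T = "\<lambda>i M. T x0 (i # M)" and ?S = "\<lambda>i M. S x0 (i # M)"
  let ?T' = "\<lambda>i M. T' (i # M) + act C vs (?T i) M" and ?S' = "\<lambda>i M. S' (i # M) + act C vs (?S i) M"
  have IH: "((\<lambda>x. pairing (W x) vs (\<lambda>M. T x (i # M)) (\<lambda>M. S x (j # M))) has_real_derivative
      ?P (?T' i) (?S j) + ?P (?T i) (?S' j)) (at x0)" for i j
    by (rule Cons.IH) (use Cons.prems in auto)
  have "((\<lambda>x. pairing (W x) (v # vs) (T x) (S x)) has_real_derivative
     (\<Sum>i\<in>UNIV. \<Sum>j\<in>UNIV. ((\<Sum>m\<in>UNIV. C v m i * W x0 v m j) + (\<Sum>m\<in>UNIV. C v m j * W x0 v i m)) * ?P (?T i) (?S j)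
        + (?P (?T' i) (?S j) + ?P (?T i) (?S' j)) * W x0 v i j)) (at x0)"
    unfolding pairing.simps by (intro DERIV_sum DERIV_mult W IH)
  moreover have "(\<Sum>i\<in>UNIV. \<Sum>j\<in>UNIV. ((\<Sum>m\<in>UNIV. C v m i * W x0 v m j) + (\<Sum>m\<in>UNIV. C v m j * W x0 v i m)) * ?P (?T i) (?S j)
        + (?P (?T' i) (?S j) + ?P (?T i) (?S' j)) * W x0 v i j)
    = pairing (W x0) (v # vs) (\<lambda>L. T' L + act C (v # vs) (T x0) L) (S x0)
      + pairing (W x0) (v # vs) (T x0) (\<lambda>L. S' L + act C (v # vs) (S x0) L)"
  proof -
    have l: "?P (\<lambda>L. T' (i # L) + act C (v # vs) (T x0) (i # L)) (?S j) =
       ?P (?T' i) (?S j) + (\<Sum>m\<in>UNIV. C v i m * ?P (?T m) (?S j))" for i j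
      by (simp add: pairing_add_left pairing_sum_left)
    have r: "?P (?T i) (\<lambda>L. S' (j # L) + act C (v # vs) (S x0) (j # L)) =
       ?P (?T i) (?S' j) + (\<Sum>m\<in>UNIV. C v j m * ?P (?T i) (?S m))" for i j
      by (simp add: pairing_add_right pairing_sum_right)
    have 1: "(\<Sum>i\<in>UNIV. \<Sum>j\<in>UNIV. (\<Sum>m\<in>UNIV. C v m i * W x0 v m j) * ?P (?T i) (?S j)) =
       (\<Sum>i\<in>UNIV. \<Sum>j\<in>UNIV. W x0 v i j * (\<Sum>m\<in>UNIV. C v i m * ?P (?T m) (?S j)))"
    proof -
      have "(\<Sum>i\<in>UNIV. \<Sum>j\<in>UNIV. (\<Sum>m\<in>UNIV. C v m i * W x0 v m j) * ?P (?T i) (?S j)) =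
         (\<Sum>j\<in>UNIV. \<Sum>i\<in>UNIV. \<Sum>m\<in>UNIV. W x0 v m j * (C v m i * ?P (?T i) (?S j)))"
        by (subst sum.swap) (simp add: sum_distrib_right mult_ac)
      also have "\<dots> = (\<Sum>j\<in>UNIV. \<Sum>m\<in>UNIV. \<Sum>i\<in>UNIV. W x0 v m j * (C v m i * ?P (?T i) (?S j)))"
        by (intro sum.cong refl sum.swap)
      also have "\<dots> = (\<Sum>m\<in>UNIV. \<Sum>j\<in>UNIV. \<Sum>i\<in>UNIV. W x0 v m j * (C v m i * ?P (?T i) (?S j)))"
        by (rule sum.swap)
      finally show ?thesis by (simp add: sum_distrib_left)
    qed
    have 2: "(\<Sum>i\<in>UNIV. \<Sum>j\<in>UNIV. (\<Sum>m\<in>UNIV. C v m j * W x0 v i m) * ?P (?T i) (?S j)) =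
       (\<Sum>i\<in>UNIV. \<Sum>j\<in>UNIV. W x0 v i j * (\<Sum>m\<in>UNIV. C v j m * ?P (?T i) (?S m)))"
    proof -
      have "(\<Sum>i\<in>UNIV. \<Sum>j\<in>UNIV. (\<Sum>m\<in>UNIV. C v m j * W x0 v i m) * ?P (?T i) (?S j)) =
         (\<Sum>i\<in>UNIV. \<Sum>j\<in>UNIV. \<Sum>m\<in>UNIV. W x0 v i m * (C v m j * ?P (?T i) (?S j)))"
        by (simp add: sum_distrib_right mult_ac)
      also have "\<dots> = (\<Sum>i\<in>UNIV. \<Sum>m\<in>UNIV. \<Sum>j\<in>UNIV. W x0 v i m * (C v m j * ?P (?T i) (?S j)))"
        by (intro sum.cong refl sum.swap)
      finally show ?thesis by (simp add: sum_distrib_left)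
    qed
    have "(\<Sum>i\<in>UNIV. \<Sum>j\<in>UNIV. ((\<Sum>m\<in>UNIV. C v m i * W x0 v m j) + (\<Sum>m\<in>UNIV. C v m j * W x0 v i m)) * ?P (?T i) (?S j)
        + (?P (?T' i) (?S j) + ?P (?T i) (?S' j)) * W x0 v i j)
      = (\<Sum>i\<in>UNIV. \<Sum>j\<in>UNIV. (\<Sum>m\<in>UNIV. C v m i * W x0 v m j) * ?P (?T i) (?S j))
       + (\<Sum>i\<in>UNIV. \<Sum>j\<in>UNIV. (\<Sum>m\<in>UNIV. C v m j * W x0 v i m) * ?P (?T i) (?S j))
       + (\<Sum>i\<in>UNIV. \<Sum>j\<in>UNIV. W x0 v i j * ?P (?T' i) (?S j))
       + (\<Sum>i\<in>UNIV. \<Sum>j\<in>UNIV. W x0 v i j * ?P (?T i) (?S' j))"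
      by (simp only: sum.distrib distrib_right distrib_left mult.commute[of _ "W x0 v _ _"] add_ac)
    then show ?thesis
      unfolding 1 2 pairing.simps l r by (simp only: sum.distrib distrib_left add_ac)
  qed
  ultimately show ?case by simp
qed

text \<open>If \<open>N' = N C - C' N\<close> in each slot, then covariant differentiation with respect to \<open>C'\<close> after the
  transformation \<open>N\<close> is the transformation of covariant differentiation with respect to \<open>C\<close>.\<close>

lemma contract_derivative:
  fixes N :: "real \<Rightarrow> bool \<Rightarrow> 'n::finite \<Rightarrow> 'n \<Rightarrow> real"
  assumes N: "\<And>v i j. ((\<lambda>x. N x v i j) has_real_derivative
      (\<Sum>m\<in>UNIV. N x0 v i m * C v m j) - (\<Sum>m\<in>UNIV. C' v i m * N x0 v m j)) (at x0)"
  shows "(\<And>L. length L = length vs \<Longrightarrow> ((\<lambda>x. T x L) has_real_derivative T' L) (at x0)) \<Longrightarrow>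
    length L = length vs \<Longrightarrow>
    ((\<lambda>x. contract (N x) vs (T x) L) has_real_derivative
      contract (N x0) vs (\<lambda>L. T' L + act C vs (T x0) L) L - act C' vs (contract (N x0) vs (T x0)) L) (at x0)"
proof (induction vs arbitrary: T T' L)
  case Nil
  then show ?case by simp
next
  case (Cons v vs)
  obtain i M where L: "L = i # M" "length M = length vs" using Cons.prems(2) by (cases L) auto
  let ?T = "\<lambda>i M. T x0 (i # M)"
  let ?K = "\<lambda>j. contract (N x0) vs (?T j)"
  let ?K' = "\<lambda>j. contract (N x0) vs (\<lambda>M. T' (j # M) + act C vs (?T j) M)"
  have IH: "((\<lambda>x. contract (N x) vs (\<lambda>M. T x (j # M)) M) has_real_derivative
      ?K' j M - act C' vs (?K j) M) (at x0)" for j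
    by (rule Cons.IH) (use Cons.prems L in auto)
  have "((\<lambda>x. contract (N x) (v # vs) (T x) L) has_real_derivative
    (\<Sum>j\<in>UNIV. ((\<Sum>m\<in>UNIV. N x0 v i m * C v m j) - (\<Sum>m\<in>UNIV. C' v i m * N x0 v m j)) * ?K j M
       + (?K' j M - act C' vs (?K j) M) * N x0 v i j)) (at x0)"
    unfolding contract.simps L list.sel by (intro DERIV_sum DERIV_mult N IH)
  moreover have "(\<Sum>j\<in>UNIV. ((\<Sum>m\<in>UNIV. N x0 v i m * C v m j) - (\<Sum>m\<in>UNIV. C' v i m * N x0 v m j)) * ?K j M
       + (?K' j M - act C' vs (?K j) M) * N x0 v i j)
    = contract (N x0) (v # vs) (\<lambda>L. T' L + act C (v # vs) (T x0) L) L - act C' (v # vs) (contract (N x0) (v # vs) (T x0)) L"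
  proof -
    have c: "contract (N x0) vs (\<lambda>M. T' (j # M) + act C (v # vs) (T x0) (j # M)) M =
       ?K' j M + (\<Sum>m\<in>UNIV. C v j m * ?K m M)" for j
      by (simp add: contract_add contract_sum)
    have a: "act C' (v # vs) (contract (N x0) (v # vs) (T x0)) L =
       (\<Sum>m\<in>UNIV. C' v i m * (\<Sum>j\<in>UNIV. N x0 v m j * ?K j M)) + (\<Sum>j\<in>UNIV. N x0 v i j * act C' vs (?K j) M)"
      by (simp add: L act_sum)
    have 1: "(\<Sum>j\<in>UNIV. (\<Sum>m\<in>UNIV. N x0 v i m * C v m j) * ?K j M) = (\<Sum>m\<in>UNIV. N x0 v i m * (\<Sum>j\<in>UNIV. C v m j * ?K j M))"
      by (simp add: sum_distrib_left sum_distrib_right mult_ac) (rule sum.swap)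
    have 2: "(\<Sum>j\<in>UNIV. (\<Sum>m\<in>UNIV. C' v i m * N x0 v m j) * ?K j M) = (\<Sum>m\<in>UNIV. C' v i m * (\<Sum>j\<in>UNIV. N x0 v m j * ?K j M))"
      by (simp add: sum_distrib_left sum_distrib_right mult_ac) (rule sum.swap)
    have "(\<Sum>j\<in>UNIV. ((\<Sum>m\<in>UNIV. N x0 v i m * C v m j) - (\<Sum>m\<in>UNIV. C' v i m * N x0 v m j)) * ?K j M
       + (?K' j M - act C' vs (?K j) M) * N x0 v i j) =
      (\<Sum>j\<in>UNIV. (\<Sum>m\<in>UNIV. N x0 v i m * C v m j) * ?K j M) - (\<Sum>j\<in>UNIV. (\<Sum>m\<in>UNIV. C' v i m * N x0 v m j) * ?K j M)
      + ((\<Sum>j\<in>UNIV. N x0 v i j * ?K' j M) - (\<Sum>j\<in>UNIV. N x0 v i j * act C' vs (?K j) M))"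
      by (simp add: sum.distrib sum_subtractf left_diff_distrib right_diff_distrib mult.commute[of _ "N x0 v i _"])
    moreover have "contract (N x0) (v # vs) (\<lambda>L. T' L + act C (v # vs) (T x0) L) L =
        (\<Sum>j\<in>UNIV. N x0 v i j * ?K' j M) + (\<Sum>j\<in>UNIV. N x0 v i j * (\<Sum>m\<in>UNIV. C v j m * ?K m M))"
      by (simp only: contract.simps L list.sel c distrib_left sum.distrib)
    ultimately show ?thesis unfolding 1 2 a by linarith
  qed
  ultimately show ?case by simp
qed

subsection \<open>Gram decompositions\<close>

text \<open>Completion of squares. If \<open>A a a > 0\<close>, then subtracting the rank one form with coefficients
  \<open>A a i * A a j / A a a\<close> leaves a positive semidefinite form that no longer involves the index \<open>a\<close>.\<close>

lemma psd_gram_decomposition_on: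
  fixes A :: "'n::finite \<Rightarrow> 'n \<Rightarrow> real"
  assumes "finite S"
  shows "(\<And>i j. A i j = A j i) \<Longrightarrow> (\<And>x. 0 \<le> (\<Sum>i\<in>UNIV. \<Sum>j\<in>UNIV. x i * A i j * x j)) \<Longrightarrow>
    (\<And>i j. i \<notin> S \<Longrightarrow> A i j = 0) \<Longrightarrow>
    \<exists>B. (\<forall>k j. k \<notin> S \<longrightarrow> B k j = 0) \<and> (\<forall>i j. A i j = (\<Sum>k\<in>UNIV. B k i * B k j))"
  using assms
proof (induction S arbitrary: A rule: finite_induct)
  case empty
  then show ?case by (intro exI[of _ "\<lambda>_ _. 0"]) auto
next
  case (insert a S)
  have expand: "(\<Sum>i\<in>UNIV. \<Sum>j\<in>UNIV. (x i + s * of_bool (i = a)) * A i j * (x j + s * of_bool (j = a)))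
    = (\<Sum>i\<in>UNIV. \<Sum>j\<in>UNIV. x i * A i j * x j) + 2 * s * (\<Sum>j\<in>UNIV. A a j * x j) + s * s * A a a" for x s
  proof -
    have "(\<Sum>i\<in>UNIV. \<Sum>j\<in>UNIV. (x i + s * of_bool (i = a)) * A i j * (x j + s * of_bool (j = a)))
      = (\<Sum>i\<in>UNIV. \<Sum>j\<in>UNIV. x i * A i j * x j)
      + (\<Sum>i\<in>UNIV. \<Sum>j\<in>UNIV. (x i * A i j * s) * of_bool (j = a))
      + (\<Sum>i\<in>UNIV. of_bool (i = a) * (\<Sum>j\<in>UNIV. s * (A i j * x j)))
      + (\<Sum>i\<in>UNIV. of_bool (i = a) * (\<Sum>j\<in>UNIV. (s * s * A i j) * of_bool (j = a)))"
      by (simp add: sum.distrib algebra_simps sum_distrib_left)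
    also have "\<dots> = (\<Sum>i\<in>UNIV. \<Sum>j\<in>UNIV. x i * A i j * x j) + (\<Sum>i\<in>UNIV. x i * A i a * s)
      + (\<Sum>j\<in>UNIV. s * (A a j * x j)) + s * s * A a a"
      by simp
    also have "(\<Sum>i\<in>UNIV. x i * A i a * s) = (\<Sum>j\<in>UNIV. s * (A a j * x j))"
      using insert.prems(1)[of _ a] by (simp add: mult_ac)
    also have "(\<Sum>j\<in>UNIV. s * (A a j * x j)) = s * (\<Sum>j\<in>UNIV. A a j * x j)" by (simp add: sum_distrib_left)
    finally show ?thesis by simp
  qed
  have pos: "0 \<le> (\<Sum>i\<in>UNIV. \<Sum>j\<in>UNIV. x i * A i j * x j) + 2 * s * (\<Sum>j\<in>UNIV. A a j * x j) + s * s * A a a" for x s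
    unfolding expand[symmetric] by (rule insert.prems(2))
  have aa: "0 \<le> A a a" using pos[of "\<lambda>_. 0" 1] by simp
  show ?case
  proof (cases "A a a = 0")
    case True
    \<comment> \<open>A positive semidefinite form with a zero on the diagonal vanishes on the whole row; otherwise it would be negative at a suitable combination of two basis vectors.\<close>
    have row: "A a j = 0" for j
    proof (rule ccontr)
      assume ne: "A a j \<noteq> 0"
      have "(\<Sum>i\<in>UNIV. \<Sum>k\<in>UNIV. of_bool (i = j) * A i k * of_bool (k = j))
          = (\<Sum>i\<in>UNIV. of_bool (i = j) * (\<Sum>k\<in>UNIV. A i k * of_bool (k = j)))"
        by (simp only: sum_distrib_left mult.assoc)
      also have "\<dots> = A j j" by simp
      finally have "(\<Sum>i\<in>UNIV. \<Sum>k\<in>UNIV. of_bool (i = j) * A i k * of_bool (k = j)) = A j j" .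
      then have "0 \<le> A j j + 2 * s * A a j" for s
        using pos[of "\<lambda>i. of_bool (i = j)" s] True by simp
      from this[of "- (A j j + 1) / (2 * A a j)"] show False using ne by (simp add: field_simps)
    qed
    have "\<exists>B. (\<forall>k j. k \<notin> S \<longrightarrow> B k j = 0) \<and> (\<forall>i j. A i j = (\<Sum>k\<in>UNIV. B k i * B k j))"
    proof (rule insert.IH)
      show "A i j = 0" if "i \<notin> S" for i j
        using that row insert.prems(3)[of i j] by (cases "i = a") auto
    qed (rule insert.prems)+
    then show ?thesis by auto
  next
    case False
    then have a: "A a a > 0" using aa by simp
    define A' where "A' = (\<lambda>i j. A i j - A a i * A a j / A a a)"
    have "\<exists>B. (\<forall>k j. k \<notin> S \<longrightarrow> B k j = 0) \<and> (\<forall>i j. A' i j = (\<Sum>k\<in>UNIV. B k i * B k j))"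
    proof (rule insert.IH)
      show "A' i j = A' j i" for i j by (simp add: A'_def insert.prems(1)[of i j] mult.commute)
      show "A' i j = 0" if "i \<notin> S" for i j
        using that insert.prems(3)[of i] insert.prems(1)[of a i] a by (cases "i = a") (auto simp: A'_def)
      show "0 \<le> (\<Sum>i\<in>UNIV. \<Sum>j\<in>UNIV. x i * A' i j * x j)" for x
      proof -
        define c where "c = (\<Sum>j\<in>UNIV. A a j * x j)"
        have "c * c = (\<Sum>i\<in>UNIV. \<Sum>j\<in>UNIV. (A a i * x i) * (A a j * x j))"
          unfolding c_def by (rule sum_product)
        then have "(\<Sum>i\<in>UNIV. \<Sum>j\<in>UNIV. x i * (A a i * A a j / A a a) * x j) = c * c / A a a"
          by (simp add: sum_divide_distrib mult_ac)
        then have "(\<Sum>i\<in>UNIV. \<Sum>j\<in>UNIV. x i * A' i j * x j) = (\<Sum>i\<in>UNIV. \<Sum>j\<in>UNIV. x i * A i j * x j) - c * c / A a a"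
          unfolding A'_def by (simp add: algebra_simps sum_subtractf)
        moreover have "2 * (- c / A a a) * c + (- c / A a a) * (- c / A a a) * A a a = - (c * c / A a a)"
          using a by (simp add: field_simps)
        ultimately show ?thesis using pos[of x "- c / A a a"] by (simp add: c_def[symmetric])
      qed
    qed
    then obtain B where B: "\<And>k j. k \<notin> S \<Longrightarrow> B k j = 0" "\<And>i j. A' i j = (\<Sum>k\<in>UNIV. B k i * B k j)"
      by blast
    define B' where "B' = B(a := \<lambda>j. A a j / sqrt (A a a))"
    have "(\<Sum>k\<in>UNIV. B' k i * B' k j) = A i j" for i j
    proof -
      have "(\<Sum>k\<in>UNIV. B' k i * B' k j) = B' a i * B' a j + (\<Sum>k\<in>UNIV - {a}. B k i * B k j)"
        by (subst sum.remove[of UNIV a]) (auto simp: B'_def)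
      also have "(\<Sum>k\<in>UNIV - {a}. B k i * B k j) = A' i j"
        unfolding B(2) using B(1)[OF insert.hyps(2)] by (intro sum.mono_neutral_left) auto
      finally show ?thesis using a by (simp add: B'_def A'_def)
    qed
    moreover have "B' k j = 0" if "k \<notin> insert a S" for k j using that B(1) by (auto simp: B'_def)
    ultimately show ?thesis by metis
  qed
qed

lemma psd_gram_decomposition:
  fixes A :: "'n::finite \<Rightarrow> 'n \<Rightarrow> real"
  assumes "\<And>i j. A i j = A j i" "\<And>x. 0 \<le> (\<Sum>i\<in>UNIV. \<Sum>j\<in>UNIV. x i * A i j * x j)"
  obtains B :: "'n \<Rightarrow> 'n \<Rightarrow> real" where "\<And>i j. A i j = (\<Sum>k\<in>UNIV. B k i * B k j)"
  using psd_gram_decomposition_on[of "UNIV :: 'n set" A] assms by auto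

text \<open>\<open>B v\<close> maps components with respect to the coordinate frame to components with respect to a frame
  that is orthonormal for \<open>W v\<close>.\<close>

definition gram :: "(bool \<Rightarrow> 'n::finite \<Rightarrow> 'n \<Rightarrow> real) \<Rightarrow> (bool \<Rightarrow> 'n \<Rightarrow> 'n \<Rightarrow> real) \<Rightarrow> bool" where
  "gram B W \<longleftrightarrow> (\<forall>v i j. W v i j = (\<Sum>k\<in>UNIV. B v k i * B v k j))"

abbreviation kron :: "bool \<Rightarrow> 'n \<Rightarrow> 'n \<Rightarrow> real" where
  "kron \<equiv> (\<lambda>v i j. of_bool (i = j))"

lemma pairing_kron_Cons:
  "pairing kron (v # vs) T S = (\<Sum>i\<in>UNIV. pairing kron vs (\<lambda>L. T (i # L)) (\<lambda>L. S (i # L)))"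
  by simp

lemma pairing_kron_nonneg: "0 \<le> pairing kron vs T T"
  by (induction vs arbitrary: T) (auto simp del: pairing.simps(2) simp add: pairing_kron_Cons intro: sum_nonneg)

context
  fixes B W :: "bool \<Rightarrow> 'n::finite \<Rightarrow> 'n \<Rightarrow> real"
  assumes gram: "gram B W"
begin

lemma pairing_frame: "pairing W vs T S = pairing kron vs (contract B vs T) (contract B vs S)"
proof (rule pairing_contract[symmetric])
  show "W v i j = (\<Sum>k\<in>UNIV. \<Sum>l\<in>UNIV. B v k i * of_bool (k = l) * B v l j)" for v i j
  proof -
    have "(\<Sum>l\<in>UNIV. B v k i * of_bool (k = l) * B v l j) = B v k i * B v k j" for k
    proof -
      have "(\<Sum>l\<in>UNIV. B v k i * of_bool (k = l) * B v l j) = (\<Sum>l\<in>UNIV. if k = l then B v k i * B v l j else 0)"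
        by (intro sum.cong) auto
      then show ?thesis by simp
    qed
    then show ?thesis using gram by (simp add: gram_def)
  qed
qed

lemma gram_sym: "W v i j = W v j i"
  using gram by (simp add: gram_def mult.commute)

lemma pairing_nonneg: "0 \<le> pairing W vs T T"
  unfolding pairing_frame by (rule pairing_kron_nonneg)

text \<open>The discriminant of the nonnegative quadratic polynomial \<open>t \<mapsto> |T + t S|\<^sup>2\<close>; the degenerate case
  is included because a gram matrix need not be invertible.\<close>

lemma pairing_Cauchy_Schwarz: "(pairing W vs T S)\<^sup>2 \<le> pairing W vs T T * pairing W vs S S"
proof -
  define a b c where "a = pairing W vs T T" and "b = pairing W vs T S" and "c = pairing W vs S S"
  have sym: "pairing W vs S T = b" unfolding b_def by (rule pairing_commute) (rule gram_sym)
  have q: "0 \<le> a + 2 * t * b + t * t * c" for t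
  proof -
    have "0 \<le> pairing W vs (\<lambda>L. T L + t * S L) (\<lambda>L. T L + t * S L)" by (rule pairing_nonneg)
    also have "\<dots> = a + 2 * t * b + t * t * c"
      by (simp add: pairing_add_left pairing_add_right pairing_cmult_left pairing_cmult_right sym
          a_def[symmetric] b_def[symmetric] c_def[symmetric])
    finally show ?thesis .
  qed
  have "b\<^sup>2 \<le> a * c"
  proof (cases "c = 0")
    case True
    have "b = 0"
    proof (rule ccontr)
      assume "b \<noteq> 0"
      then show False using q[of "- (a + 1) / (2 * b)"] True by (simp add: field_simps)
    qed
    then show ?thesis using True by simp
  next
    case False
    then have c: "c > 0" using pairing_nonneg[of vs S] c_def by simp
    have "0 \<le> c * (a + 2 * (- b / c) * b + (- b / c) * (- b / c) * c)"
      using q[of "- b / c"] c by simp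
    also have "\<dots> = a * c - b\<^sup>2" using c by (simp add: field_simps power2_eq_square)
    finally show ?thesis by simp
  qed
  then show ?thesis by (simp add: a_def b_def c_def)
qed

lemma pairing_Cauchy_Schwarz_sqrt:
  "\<bar>pairing W vs T S\<bar> \<le> sqrt (pairing W vs T T) * sqrt (pairing W vs S S)"
  using pairing_Cauchy_Schwarz[of vs T S] by (metis real_sqrt_abs real_sqrt_le_iff real_sqrt_mult)

text \<open>In an orthonormal frame the trace is a sum of \<open>CARD('n)\<close> diagonal terms, and the norm of each
  diagonal component of \<open>S\<close> is at most the norm of \<open>S\<close>.\<close>

lemma pairing_trace_bound:
  "\<bar>\<Sum>i\<in>UNIV. \<Sum>j\<in>UNIV. W True i j * pairing W vs (\<lambda>L. S (i # j # L)) T\<bar>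
    \<le> real CARD('n) * (sqrt (pairing W (True # True # vs) S S) * sqrt (pairing W vs T T))"
proof -
  let ?S = "\<lambda>k l L. \<Sum>i\<in>UNIV. B True k i * (\<Sum>j\<in>UNIV. B True l j * S (i # j # L))"
  have norm: "pairing W (True # True # vs) S S = (\<Sum>k\<in>UNIV. \<Sum>l\<in>UNIV. pairing W vs (?S k l) (?S k l))"
  proof -
    have "contract B (True # True # vs) S (k # l # L) = contract B vs (?S k l) L" for k l L
      by (simp add: contract_sum)
    then show ?thesis
      unfolding pairing_frame by (simp only: pairing_kron_Cons)
  qed
  have "(\<Sum>i\<in>UNIV. \<Sum>j\<in>UNIV. W True i j * pairing W vs (\<lambda>L. S (i # j # L)) T) = (\<Sum>k\<in>UNIV. pairing W vs (?S k k) T)"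
  proof -
    have "(\<Sum>i\<in>UNIV. \<Sum>j\<in>UNIV. W True i j * pairing W vs (\<lambda>L. S (i # j # L)) T) =
      (\<Sum>i\<in>UNIV. \<Sum>j\<in>UNIV. \<Sum>k\<in>UNIV. B True k i * (B True k j * pairing W vs (\<lambda>L. S (i # j # L)) T))"
      using gram by (simp add: gram_def sum_distrib_left sum_distrib_right mult_ac)
    also have "\<dots> = (\<Sum>i\<in>UNIV. \<Sum>k\<in>UNIV. \<Sum>j\<in>UNIV. B True k i * (B True k j * pairing W vs (\<lambda>L. S (i # j # L)) T))"
      by (intro sum.cong refl sum.swap)
    also have "\<dots> = (\<Sum>k\<in>UNIV. \<Sum>i\<in>UNIV. \<Sum>j\<in>UNIV. B True k i * (B True k j * pairing W vs (\<lambda>L. S (i # j # L)) T))"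
      by (rule sum.swap)
    finally show ?thesis unfolding pairing_sum_left by (simp add: sum_distrib_left)
  qed
  also have "\<bar>\<dots>\<bar> \<le> (\<Sum>k\<in>UNIV. \<bar>pairing W vs (?S k k) T\<bar>)" by (rule sum_abs)
  also have "\<dots> \<le> (\<Sum>k\<in>(UNIV :: 'n set). sqrt (pairing W (True # True # vs) S S) * sqrt (pairing W vs T T))"
  proof (rule sum_mono)
    fix k
    have "pairing W vs (?S k k) (?S k k) \<le> (\<Sum>l\<in>UNIV. pairing W vs (?S k l) (?S k l))"
      by (rule member_le_sum) (auto intro: pairing_nonneg)
    also have "\<dots> \<le> (\<Sum>k\<in>UNIV. \<Sum>l\<in>UNIV. pairing W vs (?S k l) (?S k l))"
      by (rule member_le_sum[of k UNIV "\<lambda>k. \<Sum>l\<in>UNIV. pairing W vs (?S k l) (?S k l)"]) (auto intro!: sum_nonneg pairing_nonneg)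
    finally have "sqrt (pairing W vs (?S k k) (?S k k)) \<le> sqrt (pairing W (True # True # vs) S S)"
      unfolding norm by simp
    then have "sqrt (pairing W vs (?S k k) (?S k k)) * sqrt (pairing W vs T T)
      \<le> sqrt (pairing W (True # True # vs) S S) * sqrt (pairing W vs T T)"
      by (rule mult_right_mono) (simp add: pairing_nonneg)
    then show "\<bar>pairing W vs (?S k k) T\<bar> \<le> sqrt (pairing W (True # True # vs) S S) * sqrt (pairing W vs T T)"
      using pairing_Cauchy_Schwarz_sqrt[of vs "?S k k" T] by linarith
  qed
  finally show ?thesis by simp
qed

end

subsection \<open>Blocks of equal variance\<close>

lemma sum_multi_indices_0: "(\<Sum>J\<in>multi_indices 0. f J) = f []"
  by (simp add: multi_indices_def)

lemma sum_multi_indices_Suc: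
  "(\<Sum>J\<in>multi_indices (Suc s). f J) = (\<Sum>i\<in>(UNIV :: 'n::finite set). \<Sum>J\<in>multi_indices s. f (i # J))"
proof -
  have "(\<Sum>J\<in>multi_indices (Suc s). f J) = (\<Sum>(i, J)\<in>(UNIV :: 'n set) \<times> multi_indices s. f (i # J))"
    by (rule sum.reindex_bij_witness[of _ "\<lambda>(i, J). i # J" "\<lambda>J. (hd J, tl J)"])
       (auto simp: multi_indices_def length_Suc_conv)
  then show ?thesis by (simp add: sum.cartesian_product)
qed

lemma contract_replicate:
  "length L \<ge> s \<Longrightarrow> contract N (replicate s v @ ws) T L =
    (\<Sum>J\<in>multi_indices s. (\<Prod>b<s. N v (L ! b) (J ! b)) * contract N ws (\<lambda>M. T (J @ M)) (drop s L))"
proof (induction s arbitrary: T L)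
  case 0
  then show ?case by (simp add: sum_multi_indices_0)
next
  case (Suc s)
  then obtain i M where L: "L = i # M" "s \<le> length M" by (cases L) auto
  show ?case
    using Suc.IH[of M] L
    by (simp add: sum_multi_indices_Suc prod.lessThan_Suc_shift sum_distrib_left mult_ac del: prod.lessThan_Suc)
qed

lemma pairing_replicate:
  "pairing W (replicate s v @ ws) T S =
    (\<Sum>J\<in>multi_indices s. \<Sum>J'\<in>multi_indices s.
       (\<Prod>b<s. W v (J ! b) (J' ! b)) * pairing W ws (\<lambda>M. T (J @ M)) (\<lambda>M. S (J' @ M)))"
proof (induction s arbitrary: T S)
  case 0
  then show ?case by (simp add: sum_multi_indices_0)
next
  case (Suc s)
  have "pairing W (replicate (Suc s) v @ ws) T S =
    (\<Sum>i\<in>UNIV. \<Sum>j\<in>UNIV. \<Sum>J\<in>multi_indices s. \<Sum>J'\<in>multi_indices s. W v i j *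
       ((\<Prod>b<s. W v (J ! b) (J' ! b)) * pairing W ws (\<lambda>M. T (i # J @ M)) (\<lambda>M. S (j # J' @ M))))"
    by (simp add: Suc.IH sum_distrib_left)
  also have "\<dots> = (\<Sum>i\<in>UNIV. \<Sum>J\<in>multi_indices s. \<Sum>j\<in>UNIV. \<Sum>J'\<in>multi_indices s. W v i j *
       ((\<Prod>b<s. W v (J ! b) (J' ! b)) * pairing W ws (\<lambda>M. T (i # J @ M)) (\<lambda>M. S (j # J' @ M))))"
    by (intro sum.cong refl sum.swap)
  finally show ?case
    by (simp add: sum_multi_indices_Suc prod.lessThan_Suc_shift sum_distrib_left mult_ac del: prod.lessThan_Suc)
qed

lemma act_replicate:
  "length J = s \<Longrightarrow> act C (replicate s v @ ws) T (J @ L) =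
    (\<Sum>b<s. \<Sum>m\<in>UNIV. C v (J ! b) m * T (J[b := m] @ L)) + act C ws (\<lambda>M. T (J @ M)) L"
proof (induction s arbitrary: T J)
  case 0
  then show ?case by simp
next
  case (Suc s)
  then obtain i M where J: "J = i # M" "length M = s" by (cases J) auto
  show ?case
    using Suc.IH[of M] J
    by (simp add: sum.lessThan_Suc_shift del: sum.lessThan_Suc)
qed

section \<open>Calculus in a chart\<close>

definition regular_chart :: "('a::topological_space, 'n::finite) chart \<Rightarrow> bool" where
  "regular_chart c \<longleftrightarrow> open (chart_dom c) \<and> open (chart_image c) \<and>
     homeomorphism (chart_dom c) (chart_image c) (coord c) (param c)"

definition smooth_in :: "('a, 'n::finite) chart \<Rightarrow> 'a set \<Rightarrow> ('a \<Rightarrow> real) \<Rightarrow> bool" where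
  "smooth_in c W f \<longleftrightarrow> smooth_on (coord c ` W) (\<lambda>x. f (param c x))"

definition chart_differentiable :: "('a, 'n::finite) chart \<Rightarrow> ('a \<Rightarrow> real) \<Rightarrow> 'a \<Rightarrow> bool" where
  "chart_differentiable c f p \<longleftrightarrow> (\<lambda>x. f (param c x)) differentiable (at (coord c p))"

abbreviation coord_line :: "('a, 'n::finite) chart \<Rightarrow> 'n \<Rightarrow> 'a \<Rightarrow> real \<Rightarrow> 'a" where
  "coord_line c i p s \<equiv> param c (coord c p + s *\<^sub>R axis i 1)"

lemma has_chart_partial:
  assumes "chart_differentiable c f p"
  shows "((\<lambda>s. f (coord_line c i p s)) has_real_derivative chart_partial c i f p) (at 0)"
  using axis_derivative[of "\<lambda>x. f (param c x)" "coord c p" 0 i] assms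
  by (simp add: chart_differentiable_def chart_partial_def)

lemma chart_partial_unique:
  assumes "chart_differentiable c f p" "((\<lambda>s. f (coord_line c i p s)) has_real_derivative D) (at 0)"
  shows "chart_partial c i f p = D"
  using DERIV_unique[OF has_chart_partial[OF assms(1)] assms(2)] .

lemma chart_differentiable_const: "chart_differentiable c (\<lambda>q. a) p"
  by (simp add: chart_differentiable_def)

lemma chart_differentiable_add:
  "chart_differentiable c f p \<Longrightarrow> chart_differentiable c h p \<Longrightarrow> chart_differentiable c (\<lambda>q. f q + h q) p"
  by (simp add: chart_differentiable_def)

lemma chart_differentiable_mult:
  "chart_differentiable c f p \<Longrightarrow> chart_differentiable c h p \<Longrightarrow> chart_differentiable c (\<lambda>q. f q * h q) p"
  by (simp add: chart_differentiable_def)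

lemma chart_differentiable_sum:
  "(\<And>a. a \<in> A \<Longrightarrow> chart_differentiable c (f a) p) \<Longrightarrow> chart_differentiable c (\<lambda>q. \<Sum>a\<in>A. f a q) p"
  by (induction A rule: infinite_finite_induct) (auto intro: chart_differentiable_add chart_differentiable_const)

context
  fixes c :: "('a::topological_space, 'n::finite) chart"
  assumes c: "regular_chart c"
begin

lemma param_coord: "p \<in> chart_dom c \<Longrightarrow> param c (coord c p) = p"
  using c by (auto simp: regular_chart_def homeomorphism_def)

lemma coord_in_image: "p \<in> W \<Longrightarrow> coord c p \<in> coord c ` W"
  by simp

lemma param_in: "W \<subseteq> chart_dom c \<Longrightarrow> x \<in> coord c ` W \<Longrightarrow> param c x \<in> W"
  by (auto simp: subset_iff param_coord)

lemma open_coord_image: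
  assumes "open W" "W \<subseteq> chart_dom c"
  shows "open (coord c ` W)"
proof -
  have "coord c ` W = {x \<in> chart_image c. param c x \<in> W}"
  proof (intro equalityI subsetI)
    fix x assume "x \<in> coord c ` W"
    then show "x \<in> {x \<in> chart_image c. param c x \<in> W}"
      using assms(2) by (auto simp: chart_image_def param_coord subset_iff)
  next
    fix x assume "x \<in> {x \<in> chart_image c. param c x \<in> W}"
    then show "x \<in> coord c ` W"
      by (auto simp: chart_image_def param_coord)
  qed
  also have "\<dots> = chart_image c \<inter> param c -` W" by auto
  also have "open \<dots>"
    by (rule continuous_open_preimage) (use c assms in \<open>auto simp: regular_chart_def homeomorphism_def\<close>)
  finally show ?thesis .
qed

context
  fixes W assumes W: "open W" "W \<subseteq> chart_dom c"
begin

lemma smooth_in_cong: "(\<And>q. q \<in> W \<Longrightarrow> f q = h q) \<Longrightarrow> smooth_in c W f \<Longrightarrow> smooth_in c W h"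
  unfolding smooth_in_def
  by (rule smooth_on_cong[OF open_coord_image[OF W]]) (use param_in[OF W(2)] in auto)

lemma smooth_in_const: "smooth_in c W (\<lambda>q. a)"
  unfolding smooth_in_def by (rule smooth_on_const[OF open_coord_image[OF W]])

lemma smooth_in_add: "smooth_in c W f \<Longrightarrow> smooth_in c W h \<Longrightarrow> smooth_in c W (\<lambda>q. f q + h q)"
  unfolding smooth_in_def by (rule smooth_on_add[OF open_coord_image[OF W]])

lemma smooth_in_diff: "smooth_in c W f \<Longrightarrow> smooth_in c W h \<Longrightarrow> smooth_in c W (\<lambda>q. f q - h q)"
  unfolding smooth_in_def by (rule smooth_on_diff[OF open_coord_image[OF W]])

lemma smooth_in_minus: "smooth_in c W f \<Longrightarrow> smooth_in c W (\<lambda>q. - f q)"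
  unfolding smooth_in_def by (rule smooth_on_minus[OF open_coord_image[OF W]])

lemma smooth_in_mult: "smooth_in c W f \<Longrightarrow> smooth_in c W h \<Longrightarrow> smooth_in c W (\<lambda>q. f q * h q)"
  unfolding smooth_in_def by (rule smooth_on_mult[OF open_coord_image[OF W]])

lemma smooth_in_power: "smooth_in c W f \<Longrightarrow> smooth_in c W (\<lambda>q. f q ^ m)"
  unfolding smooth_in_def by (rule smooth_on_power[OF open_coord_image[OF W]])

lemma smooth_in_inverse:
  "smooth_in c W f \<Longrightarrow> (\<And>q. q \<in> W \<Longrightarrow> f q \<noteq> 0) \<Longrightarrow> smooth_in c W (\<lambda>q. inverse (f q))"
  unfolding smooth_in_def
  by (rule smooth_on_inverse[OF open_coord_image[OF W]]) (use param_in[OF W(2)] in auto)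

lemma smooth_in_sum: "(\<And>a. a \<in> A \<Longrightarrow> smooth_in c W (f a)) \<Longrightarrow> smooth_in c W (\<lambda>q. \<Sum>a\<in>A. f a q)"
  unfolding smooth_in_def by (rule smooth_on_sum[OF open_coord_image[OF W]])

lemma smooth_in_prod: "(\<And>a. a \<in> A \<Longrightarrow> smooth_in c W (f a)) \<Longrightarrow> smooth_in c W (\<lambda>q. \<Prod>a\<in>A. f a q)"
  unfolding smooth_in_def by (rule smooth_on_prod[OF open_coord_image[OF W]])

lemma smooth_in_partial: "smooth_in c W f \<Longrightarrow> smooth_in c W (chart_partial c i f)"
  unfolding smooth_in_def
  by (rule smooth_on_cong[OF open_coord_image[OF W], of "partial i (\<lambda>x. f (param c x))"])
     (use W(2) in \<open>auto simp: chart_partial_def param_coord subset_iff intro: smooth_on_partial\<close>)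

lemma smooth_in_differentiable: "smooth_in c W f \<Longrightarrow> p \<in> W \<Longrightarrow> chart_differentiable c f p"
  unfolding smooth_in_def chart_differentiable_def
  by (rule smooth_on_differentiable[OF _ open_coord_image[OF W]]) auto

lemma smooth_in_continuous_on: "smooth_in c W f \<Longrightarrow> continuous_on W f"
proof -
  assume f: "smooth_in c W f"
  have "continuous_on W (coord c)"
    using c W(2) by (auto simp: regular_chart_def homeomorphism_def intro: continuous_on_subset)
  moreover have "continuous_on (coord c ` W) (\<lambda>x. f (param c x))"
    using f smooth_on_continuous_on unfolding smooth_in_def by blast
  ultimately have "continuous_on W (\<lambda>q. f (param c (coord c q)))"
    using continuous_on_compose[of W "coord c" "\<lambda>x. f (param c x)"] by (simp add: o_def)
  then show "continuous_on W f"
    by (rule continuous_on_cong[THEN iffD1, rotated -1]) (use W(2) in \<open>auto simp: param_coord subset_iff\<close>)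
qed

lemma smooth_in_pairing:
  assumes "\<And>v i j. smooth_in c W (\<lambda>q. K q v i j)"
  shows "(\<And>L. length L = length vs \<Longrightarrow> smooth_in c W (\<lambda>q. T q L)) \<Longrightarrow>
    (\<And>L. length L = length vs \<Longrightarrow> smooth_in c W (\<lambda>q. S q L)) \<Longrightarrow>
     smooth_in c W (\<lambda>q. pairing (K q) vs (T q) (S q))"
proof (induction vs arbitrary: T S)
  case Nil
  then show ?case by (simp add: smooth_in_mult)
next
  case (Cons v vs)
  have "smooth_in c W (\<lambda>q. pairing (K q) vs (\<lambda>M. T q (i # M)) (\<lambda>M. S q (j # M)))" for i j
    by (rule Cons.IH) (use Cons.prems in auto)
  then show ?case by (auto intro!: smooth_in_sum smooth_in_mult assms)
qed

lemma smooth_in_act: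
  assumes "\<And>v i j. smooth_in c W (\<lambda>q. K q v i j)"
  shows "(\<And>L. length L = length vs \<Longrightarrow> smooth_in c W (\<lambda>q. T q L)) \<Longrightarrow> length L = length vs \<Longrightarrow>
     smooth_in c W (\<lambda>q. act (K q) vs (T q) L)"
proof (induction vs arbitrary: T L)
  case Nil
  then show ?case by (simp add: smooth_in_const)
next
  case (Cons v vs)
  have "smooth_in c W (\<lambda>q. act (K q) vs (\<lambda>M. T q (hd L # M)) (tl L))"
    by (rule Cons.IH) (use Cons.prems in auto)
  moreover have "smooth_in c W (\<lambda>q. T q (m # tl L))" for m
    using Cons.prems by (cases L) auto
  ultimately show ?case by (auto intro!: smooth_in_add smooth_in_sum smooth_in_mult assms)
qed

lemma chart_differentiable_cong:
  assumes "p \<in> W" "\<And>q. q \<in> W \<Longrightarrow> f q = h q" "chart_differentiable c f p"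
  shows "chart_differentiable c h p" "chart_partial c i f p = chart_partial c i h p"
proof -
  have eq: "f (param c y) = h (param c y)" if "y \<in> coord c ` W" for y
    using that assms(2) param_in[OF W(2)] by blast
  show "chart_partial c i f p = chart_partial c i h p"
    unfolding chart_partial_def
    by (rule partial_cong[OF open_coord_image[OF W]]) (use assms eq in \<open>auto simp: chart_differentiable_def\<close>)
  show "chart_differentiable c h p"
  proof -
    obtain D where "((\<lambda>x. f (param c x)) has_derivative D) (at (coord c p))"
      using assms(3) by (auto simp: chart_differentiable_def differentiable_def)
    then have "((\<lambda>x. h (param c x)) has_derivative D) (at (coord c p))"
      by (rule has_derivative_transform_within_open[OF _ open_coord_image[OF W] coord_in_image[OF assms(1)]])
         (rule eq)
    then show ?thesis by (auto simp: chart_differentiable_def differentiable_def)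
  qed
qed

lemma chart_partial_commute:
  assumes "smooth_in c W f" "p \<in> W"
  shows "chart_partial c i (chart_partial c j f) p = chart_partial c j (chart_partial c i f) p"
proof -
  let ?F = "\<lambda>x. f (param c x)"
  have F: "smooth_on (coord c ` W) ?F" using assms(1) by (simp add: smooth_in_def)
  have *: "chart_partial c i (chart_partial c j f) p = partial i (partial j ?F) (coord c p)" for i j
    unfolding chart_partial_def
    by (rule partial_cong[OF open_coord_image[OF W], symmetric])
       (use W(2) assms(2) smooth_on_differentiable[OF smooth_on_partial[OF F] open_coord_image[OF W]]
         in \<open>auto simp: param_coord subset_iff\<close>)
  show ?thesis
    unfolding * by (rule partial_commute[OF F open_coord_image[OF W]]) (use assms(2) in auto)
qed

lemma max_chart_second_derivative:
  assumes f: "smooth_in c W f" and p: "p \<in> W" and mx: "\<And>q. q \<in> W \<Longrightarrow> f q \<le> f p"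
  shows "chart_partial c i f p = 0"
    "(\<Sum>i\<in>UNIV. \<Sum>j\<in>UNIV. v i * v j * chart_partial c i (chart_partial c j f) p) \<le> 0"
proof -
  let ?F = "\<lambda>x. f (param c x)"
  have F: "smooth_on (coord c ` W) ?F" using f by (simp add: smooth_in_def)
  have pc: "param c (coord c p) = p" using p W(2) param_coord by blast
  have *: "chart_partial c i (chart_partial c j f) p = partial i (partial j ?F) (coord c p)" for i j
    unfolding chart_partial_def
    by (rule partial_cong[OF open_coord_image[OF W], symmetric])
       (use W(2) p smooth_on_differentiable[OF smooth_on_partial[OF F] open_coord_image[OF W]]
         in \<open>auto simp: param_coord subset_iff\<close>)
  have mx': "?F y \<le> ?F (coord c p)" if "y \<in> coord c ` W" for y
    using mx[OF param_in[OF W(2) that]] pc by simp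
  note m = max_second_derivative[OF F open_coord_image[OF W] coord_in_image[OF p] mx']
  show "chart_partial c i f p = 0" using m(1) by (simp add: chart_partial_def)
  show "(\<Sum>i\<in>UNIV. \<Sum>j\<in>UNIV. v i * v j * chart_partial c i (chart_partial c j f) p) \<le> 0"
    using m(2)[of "\<chi> i. v i"] by (simp add: *)
qed

end

lemma chart_partial_mult:
  assumes "chart_differentiable c f p" "chart_differentiable c h p" "p \<in> chart_dom c"
  shows "chart_partial c i (\<lambda>q. f q * h q) p = f p * chart_partial c i h p + chart_partial c i f p * h p"
  unfolding chart_partial_def
  by (subst partial_mult) (use assms in \<open>auto simp: chart_differentiable_def param_coord\<close>)

lemma chart_partial_add:
  assumes "chart_differentiable c f p" "chart_differentiable c h p"
  shows "chart_partial c i (\<lambda>q. f q + h q) p = chart_partial c i f p + chart_partial c i h p"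
  unfolding chart_partial_def
  by (subst partial_add) (use assms in \<open>auto simp: chart_differentiable_def\<close>)

lemma chart_partial_const: "chart_partial c i (\<lambda>q. a) p = 0"
  unfolding chart_partial_def by (simp add: partial_const)

lemma chart_partial_sum:
  assumes "finite A" "\<And>a. a \<in> A \<Longrightarrow> chart_differentiable c (f a) p"
  shows "chart_partial c i (\<lambda>q. \<Sum>a\<in>A. f a q) p = (\<Sum>a\<in>A. chart_partial c i (f a) p)"
  using assms
  by (induction A rule: finite_induct)
     (simp_all add: chart_partial_const chart_partial_add chart_differentiable_sum)

lemma chart_partial_power:
  assumes "chart_differentiable c f p" "p \<in> chart_dom c"
  shows "chart_partial c i (\<lambda>q. f q ^ Suc m) p = real (Suc m) * f p ^ m * chart_partial c i f p"
proof (induction m)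
  case 0 show ?case by simp
next
  case (Suc m)
  have "chart_differentiable c (\<lambda>q. f q ^ k) p" for k
    by (induction k) (auto intro: chart_differentiable_const chart_differentiable_mult assms)
  then have "chart_partial c i (\<lambda>q. f q * f q ^ Suc m) p =
     f p * chart_partial c i (\<lambda>q. f q ^ Suc m) p + chart_partial c i f p * f p ^ Suc m"
    by (intro chart_partial_mult assms)
  then show ?case unfolding Suc.IH by (simp add: algebra_simps)
qed

end

section \<open>Change of charts\<close>

definition compatible :: "('a::topological_space, 'n::finite) chart \<Rightarrow> ('a, 'n) chart \<Rightarrow> bool" where
  "compatible c d \<longleftrightarrow> (\<forall>i. smooth_in c (chart_dom c \<inter> chart_dom d) (\<lambda>q. coord d q $ i))"

context
  fixes c d :: "('a::topological_space, 'n::finite) chart" and p :: 'a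
  assumes c: "regular_chart c" and d: "regular_chart d" and dc: "compatible d c"
    and p: "p \<in> chart_dom c" "p \<in> chart_dom d"
begin

private lemma overlap:
  "open (chart_dom d \<inter> chart_dom c)" "chart_dom d \<inter> chart_dom c \<subseteq> chart_dom d" "p \<in> chart_dom d \<inter> chart_dom c"
  using c d p by (auto simp: regular_chart_def)

lemma transition_has_derivative:
  "((\<lambda>y. coord c (param d y)) has_derivative
     (\<lambda>h. \<chi> e. frechet_derivative (\<lambda>y. coord c (param d y) $ e) (at (coord d p)) h)) (at (coord d p))"
proof -
  have "((\<lambda>y. coord c (param d y) $ e) has_derivative
     frechet_derivative (\<lambda>y. coord c (param d y) $ e) (at (coord d p))) (at (coord d p))" for e
    using dc smooth_on_differentiable[OF _ open_coord_image[OF d overlap(1,2)], of "\<lambda>y. coord c (param d y) $ e" "coord d p"] overlap(3)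
    by (auto simp: compatible_def smooth_in_def frechet_derivative_works)
  then show ?thesis
    by (subst has_derivative_componentwise_within) (auto simp: Basis_vec_def inner_axis)
qed

lemma chart_chain_rule:
  assumes f: "chart_differentiable c f p"
  shows "chart_differentiable d f p"
    "chart_partial d k f p = (\<Sum>e\<in>UNIV. chart_partial c e f p * jacobian d c p e k)"
proof -
  let ?t = "\<lambda>y. coord c (param d y)" and ?F = "\<lambda>x. f (param c x)"
  let ?t' = "\<lambda>h. \<chi> e. frechet_derivative (\<lambda>y. ?t y $ e) (at (coord d p)) h"
  let ?F' = "frechet_derivative ?F (at (coord c p))"
  have tp: "?t (coord d p) = coord c p" using p param_coord[OF d] by simp
  have F: "(?F has_derivative ?F') (at (?t (coord d p)))"
    using f tp by (simp add: chart_differentiable_def frechet_derivative_works)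
  have "((\<lambda>y. ?F (?t y)) has_derivative (\<lambda>h. ?F' (?t' h))) (at (coord d p))"
    using has_derivative_compose[OF transition_has_derivative F] .
  then have D: "((\<lambda>y. f (param d y)) has_derivative (\<lambda>h. ?F' (?t' h))) (at (coord d p))"
    by (rule has_derivative_transform_within_open[OF _ open_coord_image[OF d overlap(1,2)]])
       (use p in \<open>auto simp: param_coord[OF c] param_coord[OF d]\<close>)
  then show "chart_differentiable d f p" by (auto simp: chart_differentiable_def differentiable_def)
  have "chart_partial d k f p = ?F' (?t' (axis k 1))"
    unfolding chart_partial_def using partial_eqI[OF D] .
  also have "\<dots> = (\<Sum>e\<in>UNIV. ?t' (axis k 1) $ e * partial e ?F (coord c p))"
    using f by (intro frechet_derivative_eq_sum_partial) (simp add: chart_differentiable_def)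
  finally show "chart_partial d k f p = (\<Sum>e\<in>UNIV. chart_partial c e f p * jacobian d c p e k)"
    by (simp add: chart_partial_def jacobian_def partial_def mult.commute)
qed

text \<open>The chain rule applied to the coordinate functions themselves.\<close>

lemma jacobian_inverse:
  assumes cd: "compatible c d"
  shows "(\<Sum>m\<in>UNIV. jacobian c d p i m * jacobian d c p m j) = of_bool (i = j)"
proof -
  have o: "open (chart_dom c \<inter> chart_dom d)" using c d by (auto simp: regular_chart_def)
  have "chart_differentiable c (\<lambda>q. coord d q $ i) p"
    by (rule smooth_in_differentiable[OF c o]) (use cd p in \<open>auto simp: compatible_def\<close>)
  then have "chart_partial d j (\<lambda>q. coord d q $ i) p = (\<Sum>m\<in>UNIV. jacobian c d p i m * jacobian d c p m j)"
    using chart_chain_rule(2) by (simp add: jacobian_def)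
  moreover have "chart_partial d j (\<lambda>q. coord d q $ i) p = of_bool (i = j)"
  proof -
    have lin: "((\<lambda>y::real^'n. y $ i) has_derivative (\<lambda>h. h $ i)) (at (coord d p))"
      by (rule bounded_linear_imp_has_derivative) (rule bounded_linear_vec_nth)
    have "chart_partial d j (\<lambda>q. coord d q $ i) p = partial j (\<lambda>y. y $ i) (coord d p)"
      unfolding chart_partial_def
      by (rule partial_cong[OF open_coord_image[OF d overlap(1,2)], symmetric])
         (use p lin in \<open>auto simp: param_coord[OF d] differentiable_def\<close>)
    also have "\<dots> = of_bool (i = j)" using partial_eqI[OF lin] by (simp add: axis_def)
    finally show ?thesis .
  qed
  ultimately show ?thesis by simp
qed

end

section \<open>Matrix-valued functions\<close>

definition has_matrix_partial ::
  "('a, 'n::finite) chart \<Rightarrow> 'n \<Rightarrow> 'a \<Rightarrow> ('a \<Rightarrow> real^'n^'n) \<Rightarrow> real^'n^'n \<Rightarrow> bool" where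
  "has_matrix_partial c k p A A' \<longleftrightarrow>
     (\<forall>i j. chart_differentiable c (\<lambda>q. A q $ i $ j) p \<and> chart_partial c k (\<lambda>q. A q $ i $ j) p = A' $ i $ j)"

lemma has_matrix_partial_unique:
  "has_matrix_partial c k p A A' \<Longrightarrow> has_matrix_partial c k p A A'' \<Longrightarrow> A' = A''"
  by (simp add: has_matrix_partial_def vec_eq_iff)

lemma has_matrix_partial_transpose:
  "has_matrix_partial c k p A A' \<Longrightarrow> has_matrix_partial c k p (\<lambda>q. transpose (A q)) (transpose A')"
  by (simp add: has_matrix_partial_def transpose_def)

lemma has_matrix_partial_const: "regular_chart c \<Longrightarrow> has_matrix_partial c k p (\<lambda>q. A) 0"
  by (simp add: has_matrix_partial_def chart_differentiable_const chart_partial_const)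

lemma has_matrix_partial_mult:
  assumes c: "regular_chart c" and p: "p \<in> chart_dom c"
    and A: "has_matrix_partial c k p A A'" and B: "has_matrix_partial c k p B B'"
  shows "has_matrix_partial c k p (\<lambda>q. A q ** B q) (A' ** B p + A p ** B')"
proof -
  have d: "chart_differentiable c (\<lambda>q. A q $ i $ m * B q $ m $ j) p" for i m j
    using A B by (auto simp: has_matrix_partial_def intro: chart_differentiable_mult)
  have e: "chart_partial c k (\<lambda>q. A q $ i $ m * B q $ m $ j) p = A p $ i $ m * B' $ m $ j + A' $ i $ m * B p $ m $ j" for i m j
    using A B by (subst chart_partial_mult[OF c _ _ p]) (auto simp: has_matrix_partial_def)
  show ?thesis
    unfolding has_matrix_partial_def matrix_matrix_mult_def
    by (auto intro!: chart_differentiable_sum d simp: chart_partial_sum[OF c] d e sum.distrib)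
qed

lemma has_matrix_partial_cong:
  assumes "regular_chart c" "open W" "W \<subseteq> chart_dom c" "p \<in> W" "\<And>q. q \<in> W \<Longrightarrow> A q = B q"
    "has_matrix_partial c k p A A'"
  shows "has_matrix_partial c k p B A'"
  unfolding has_matrix_partial_def
proof (intro allI conjI)
  fix i j
  have A: "chart_differentiable c (\<lambda>q. A q $ i $ j) p" "chart_partial c k (\<lambda>q. A q $ i $ j) p = A' $ i $ j"
    using assms(6) by (auto simp: has_matrix_partial_def)
  note cong = chart_differentiable_cong[OF assms(1-4) _ A(1), of "\<lambda>q. B q $ i $ j"]
  show "chart_differentiable c (\<lambda>q. B q $ i $ j) p" by (rule cong(1)) (simp add: assms(5))
  show "chart_partial c k (\<lambda>q. B q $ i $ j) p = A' $ i $ j"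
    using cong(2)[of k] A(2) assms(5) by simp
qed

lemma matrix_mult_entry: "(A ** B) $ i $ j = (\<Sum>m\<in>UNIV. A $ i $ m * B $ m $ j)"
  by (simp add: matrix_matrix_mult_def)

lemma matrix_minus_mult: "(- A) ** B = - (A ** (B :: real^'n^'n))" for A :: "real^'n^'n"
  by (simp add: vec_eq_iff matrix_mult_entry sum_negf)

lemma matrix_mult_minus: "A ** (- B) = - (A ** (B :: real^'n^'n))" for A :: "real^'n^'n"
  by (simp add: vec_eq_iff matrix_mult_entry sum_negf)

lemma matrix_add_distrib_right: "(A + B) ** C = A ** C + B ** (C :: real^'n^'n)"
  by (simp add: vec_eq_iff matrix_mult_entry distrib_right sum.distrib)

lemma transpose_add: "transpose (A + B) = transpose A + transpose (B :: real^'n^'m)"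
  by (simp add: transpose_def vec_eq_iff)

lemma add_zero_imp_eq: "x + y + z = 0 \<Longrightarrow> x = - y - z" for x :: "'a::ab_group_add"
  by (metis add.assoc add_eq_0_iff2 diff_conv_add_uminus minus_add_distrib)

section \<open>The metric in one chart\<close>

definition christoffel_mat :: "('a, 'n::finite) tensor \<Rightarrow> ('a, 'n) chart \<Rightarrow> 'a \<Rightarrow> 'n \<Rightarrow> real^'n^'n" where
  "christoffel_mat g c p k = (\<chi> m i. christoffel g c p m k i)"

definition inv_metric_mat :: "('a, 'n::finite) tensor \<Rightarrow> ('a, 'n) chart \<Rightarrow> 'a \<Rightarrow> real^'n^'n" where
  "inv_metric_mat g c p = matrix_inv (metric_mat g c p)"

definition metric_in :: "('a::topological_space, 'n::finite) chart \<Rightarrow> ('a, 'n) tensor \<Rightarrow> bool" where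
  "metric_in c g \<longleftrightarrow> (\<forall>i j. smooth_in c (chart_dom c) (\<lambda>q. g c q [] [i, j])) \<and>
     (\<forall>p\<in>chart_dom c.
        transpose (metric_mat g c p) = metric_mat g c p \<and>
        (\<forall>v. v \<noteq> 0 \<longrightarrow> v \<bullet> (metric_mat g c p *v v) > 0))"

context
  fixes c :: "('a::topological_space, 'n::finite) chart" and g :: "('a, 'n) tensor"
  assumes c: "regular_chart c" and g: "metric_in c g"
begin

private lemma dom: "open (chart_dom c)" "chart_dom c \<subseteq> chart_dom c"
  using c by (auto simp: regular_chart_def)

lemma metric_mat_inverse:
  assumes p: "p \<in> chart_dom c"
  shows "metric_mat g c p ** inv_metric_mat g c p = mat 1" "inv_metric_mat g c p ** metric_mat g c p = mat 1"
    "transpose (metric_mat g c p) = metric_mat g c p" "transpose (inv_metric_mat g c p) = inv_metric_mat g c p"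
proof -
  let ?G = "metric_mat g c p" and ?I = "inv_metric_mat g c p"
  show sym: "transpose ?G = ?G" using g p by (auto simp: metric_in_def)
  have "v = 0" if "?G *v v = 0" for v using g p that unfolding metric_in_def
    by (metis inner_zero_right less_irrefl)
  then obtain B where "B ** ?G = mat 1" using matrix_left_invertible_ker[of ?G] by auto
  then have "?G ** B = mat 1 \<and> B ** ?G = mat 1" using matrix_left_right_inverse by blast
  then have "?G ** ?I = mat 1 \<and> ?I ** ?G = mat 1"
    unfolding inv_metric_mat_def matrix_inv_def by (rule someI)
  then show 1: "?G ** ?I = mat 1" "?I ** ?G = mat 1" by auto
  have "transpose ?I ** ?G = mat 1"
    using arg_cong[OF 1(1), of transpose] by (simp add: matrix_transpose_mul sym)
  then have "transpose ?I ** (?G ** ?I) = ?I" by (simp add: matrix_mul_assoc)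
  then show "transpose ?I = ?I" by (simp add: 1)
qed

lemma smooth_in_metric: "smooth_in c (chart_dom c) (\<lambda>q. metric_mat g c q $ i $ j)"
  using g by (simp add: metric_in_def metric_mat_def)

text \<open>By Cramer's rule the entries of the inverse are quotients of polynomials in the entries of the metric.\<close>

lemma smooth_in_inv_metric: "smooth_in c (chart_dom c) (\<lambda>q. inv_metric_mat g c q $ i $ j)"
proof -
  let ?M = "\<lambda>q. (\<chi> k l. if l = i then (axis j 1 :: real^'n) $ k else metric_mat g c q $ k $ l) :: real^'n^'n"
  have det: "smooth_in c (chart_dom c) (\<lambda>q. det (A q))"
    if "\<And>k l. smooth_in c (chart_dom c) (\<lambda>q. A q $ k $ l)" for A :: "'a \<Rightarrow> real^'n^'n"
    unfolding det_def using that
    by (intro smooth_in_sum[OF c dom] smooth_in_mult[OF c dom] smooth_in_const[OF c dom] smooth_in_prod[OF c dom])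
  have M: "smooth_in c (chart_dom c) (\<lambda>q. ?M q $ k $ l)" for k l
    by (cases "l = i") (auto simp: smooth_in_metric smooth_in_const[OF c dom])
  have nz: "det (metric_mat g c q) \<noteq> 0" if "q \<in> chart_dom c" for q
    using metric_mat_inverse[OF that] by (metis invertible_def invertible_det_nz)
  have eq: "det (?M q) * inverse (det (metric_mat g c q)) = inv_metric_mat g c q $ i $ j" if q: "q \<in> chart_dom c" for q
  proof -
    let ?x = "(\<chi> k. inv_metric_mat g c q $ k $ j) :: real^'n"
    have "metric_mat g c q *v ?x = axis j 1"
      using metric_mat_inverse(1)[OF q]
      by (simp add: vec_eq_iff matrix_vector_mult_def matrix_mult_entry mat_def axis_def eq_commute)
    then have "?x = (\<chi> k. det (\<chi> i l. if l = k then (axis j 1 :: real^'n) $ i else metric_mat g c q $ i $ l) / det (metric_mat g c q))"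
      using cramer[OF nz[OF q]] by blast
    then have "?x $ i = det (?M q) / det (metric_mat g c q)" by simp
    then show ?thesis by (simp add: divide_inverse)
  qed
  show ?thesis
    by (rule smooth_in_cong[OF c dom eq])
       (auto intro!: smooth_in_mult[OF c dom] smooth_in_inverse[OF c dom] det smooth_in_metric nz M[simplified])
qed

lemma smooth_in_christoffel: "smooth_in c (chart_dom c) (\<lambda>q. christoffel g c q m k i)"
proof -
  have "smooth_in c (chart_dom c) (chart_partial c a (\<lambda>q. g c q [] [b, e]))" for a b e
    using smooth_in_partial[OF c dom] g by (simp add: metric_in_def)
  then show ?thesis
    unfolding christoffel_def using smooth_in_inv_metric
    by (intro smooth_in_sum[OF c dom] smooth_in_mult[OF c dom] smooth_in_const[OF c dom]
        smooth_in_add[OF c dom] smooth_in_diff[OF c dom])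
       (auto simp: inv_metric_mat_def inv_metric_def)
qed

context
  fixes p assumes p: "p \<in> chart_dom c"
begin

lemma metric_differentiable: "chart_differentiable c (\<lambda>q. g c q [] [i, j]) p"
  using g p by (intro smooth_in_differentiable[OF c dom]) (auto simp: metric_in_def)

lemma metric_partial_sym: "chart_partial c k (\<lambda>q. g c q [] [i, j]) p = chart_partial c k (\<lambda>q. g c q [] [j, i]) p"
proof (rule chart_differentiable_cong(2)[OF c dom p _ metric_differentiable])
  show "g c q [] [i, j] = g c q [] [j, i]" if "q \<in> chart_dom c" for q
    using metric_mat_inverse(3)[OF that] by (simp add: vec_eq_iff transpose_def metric_mat_def)
qed

lemma christoffel_sym: "christoffel g c p m k i = christoffel g c p m i k"
  unfolding christoffel_def using metric_partial_sym[of _ k i] by (simp add: algebra_simps)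

lemma christoffel_lower:
  "(metric_mat g c p ** christoffel_mat g c p k) $ j $ i =
     (1/2) * (chart_partial c k (\<lambda>q. g c q [] [i, j]) p
       + chart_partial c i (\<lambda>q. g c q [] [k, j]) p - chart_partial c j (\<lambda>q. g c q [] [k, i]) p)"
proof -
  define f where "f = (\<lambda>l. chart_partial c k (\<lambda>q. g c q [] [i, l]) p
       + chart_partial c i (\<lambda>q. g c q [] [k, l]) p - chart_partial c l (\<lambda>q. g c q [] [k, i]) p)"
  have ce: "christoffel_mat g c p k $ m $ i = (1/2) * (inv_metric_mat g c p *v (\<chi> l. f l)) $ m" for m
    by (simp add: christoffel_mat_def christoffel_def inv_metric_mat_def inv_metric_def matrix_vector_mult_def f_def)
  have "(metric_mat g c p ** christoffel_mat g c p k) $ j $ i =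
     (1/2) * (metric_mat g c p *v (inv_metric_mat g c p *v (\<chi> l. f l))) $ j"
    unfolding matrix_mult_entry matrix_vector_mult_def[of "metric_mat g c p"] ce
    by (simp add: sum_divide_distrib)
  also have "\<dots> = (1/2) * f j"
    by (simp add: matrix_vector_mul_assoc metric_mat_inverse(1)[OF p])
  finally show ?thesis by (simp add: f_def)
qed

text \<open>In the sum of the two lowered Christoffel symbols all derivatives cancel but the one in direction \<open>k\<close>.\<close>

lemma metric_compatible:
  "has_matrix_partial c k p (metric_mat g c)
     (transpose (christoffel_mat g c p k) ** metric_mat g c p + metric_mat g c p ** christoffel_mat g c p k)"
proof -
  let ?L = "metric_mat g c p ** christoffel_mat g c p k"
  have t: "transpose (christoffel_mat g c p k) ** metric_mat g c p = transpose ?L"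
    by (simp add: matrix_transpose_mul metric_mat_inverse(3)[OF p])
  have "chart_partial c k (\<lambda>q. g c q [] [i, j]) p = ?L $ j $ i + ?L $ i $ j" for i j
    unfolding christoffel_lower
    using metric_partial_sym[of k i j] metric_partial_sym[of i k j] metric_partial_sym[of j k i] by (simp add: field_simps)
  then show ?thesis
    unfolding has_matrix_partial_def t
    using metric_differentiable by (simp add: metric_mat_def transpose_def)
qed

text \<open>Differentiate the relation between the metric and its inverse.\<close>

lemma inv_metric_compatible:
  "has_matrix_partial c k p (inv_metric_mat g c)
     (- (inv_metric_mat g c p ** transpose (christoffel_mat g c p k)) - christoffel_mat g c p k ** inv_metric_mat g c p)"
proof -
  let ?G = "metric_mat g c p" and ?I = "inv_metric_mat g c p" and ?C = "christoffel_mat g c p k"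
  define D where "D = (\<chi> i j. chart_partial c k (\<lambda>q. inv_metric_mat g c q $ i $ j) p)"
  have D: "has_matrix_partial c k p (inv_metric_mat g c) D"
    using smooth_in_differentiable[OF c dom smooth_in_inv_metric p] by (simp add: has_matrix_partial_def D_def)
  have "has_matrix_partial c k p (\<lambda>q. inv_metric_mat g c q ** metric_mat g c q) 0"
    by (rule has_matrix_partial_cong[OF c dom p _ has_matrix_partial_const[OF c, of k p "mat 1"]])
       (simp add: metric_mat_inverse(2))
  then have "D ** ?G + ?I ** (transpose ?C ** ?G + ?G ** ?C) = 0"
    using has_matrix_partial_unique[OF has_matrix_partial_mult[OF c p D metric_compatible]] by blast
  then have "(D ** ?G + ?I ** (transpose ?C ** ?G + ?G ** ?C)) ** ?I = 0" by simp
  moreover have "(D ** ?G + ?I ** (transpose ?C ** ?G + ?G ** ?C)) ** ?I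
     = D ** (?G ** ?I) + (?I ** transpose ?C) ** (?G ** ?I) + (?I ** ?G) ** ?C ** ?I"
    by (simp only: matrix_add_ldistrib matrix_add_distrib_right matrix_mul_assoc add.assoc)
  ultimately have "D + ?I ** transpose ?C + ?C ** ?I = 0"
    by (simp add: metric_mat_inverse[OF p])
  then have "D = - (?I ** transpose ?C) - ?C ** ?I"
    by (rule add_zero_imp_eq)
  then show ?thesis using D by simp
qed

end
end

section \<open>The metric under a change of charts\<close>

definition jacobian_mat :: "('a, 'n::finite) chart \<Rightarrow> ('a, 'n) chart \<Rightarrow> 'a \<Rightarrow> real^'n^'n" where
  "jacobian_mat c d p = (\<chi> i j. jacobian c d p i j)"

lemma jacobian_mat_inverse:
  assumes "regular_chart c" "regular_chart d" "compatible d c" "compatible c d"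
    "p \<in> chart_dom c" "p \<in> chart_dom d"
  shows "jacobian_mat c d p ** jacobian_mat d c p = mat 1" "jacobian_mat d c p ** jacobian_mat c d p = mat 1"
  using jacobian_inverse[of c d p] jacobian_inverse[of d c p] assms
  by (auto simp: vec_eq_iff matrix_mult_entry jacobian_mat_def mat_def)

text \<open>The connection matrix of the chart \<open>c\<close>, in the direction of the \<open>k\<close>-th coordinate vector field of
  the chart \<open>d\<close>.\<close>

definition directional_christoffel ::
  "('a, 'n::finite) tensor \<Rightarrow> ('a, 'n) chart \<Rightarrow> ('a, 'n) chart \<Rightarrow> 'a \<Rightarrow> 'n \<Rightarrow> real^'n^'n" where
  "directional_christoffel g c d p k = (\<Sum>e\<in>UNIV. jacobian d c p e k *\<^sub>R christoffel_mat g c p e)"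

context
  fixes c d :: "('a::topological_space, 'n::finite) chart" and p :: 'a and g :: "('a, 'n) tensor"
  assumes c: "regular_chart c" and d: "regular_chart d" and dc: "compatible d c" and cd: "compatible c d"
    and p: "p \<in> chart_dom c" "p \<in> chart_dom d"
    and gc: "metric_in c g" and gd: "metric_in d g"
    and law: "\<And>q. q \<in> chart_dom c \<Longrightarrow> q \<in> chart_dom d \<Longrightarrow>
      metric_mat g d q = transpose (jacobian_mat d c q) ** metric_mat g c q ** jacobian_mat d c q"
begin

private lemma overlaps: "open (chart_dom d \<inter> chart_dom c)" "chart_dom d \<inter> chart_dom c \<subseteq> chart_dom d" "p \<in> chart_dom d \<inter> chart_dom c"
  "open (chart_dom c \<inter> chart_dom d)" "chart_dom c \<inter> chart_dom d \<subseteq> chart_dom c" "p \<in> chart_dom c \<inter> chart_dom d"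
  using c d p by (auto simp: regular_chart_def)

private lemma metric_partial_other_chart:
  "has_matrix_partial d k p (metric_mat g c)
     (transpose (directional_christoffel g c d p k) ** metric_mat g c p
        + metric_mat g c p ** directional_christoffel g c d p k)"
  unfolding has_matrix_partial_def
proof (intro allI conjI)
  fix i j
  let ?G = "metric_mat g c p" and ?C = "christoffel_mat g c p"
  have G: "chart_differentiable c (\<lambda>q. metric_mat g c q $ i $ j) p"
    "chart_partial c e (\<lambda>q. metric_mat g c q $ i $ j) p = (transpose (?C e) ** ?G + ?G ** ?C e) $ i $ j" for e
    using metric_compatible[OF c gc p(1)] by (auto simp: has_matrix_partial_def)
  show "chart_differentiable d (\<lambda>q. metric_mat g c q $ i $ j) p"
    by (rule chart_chain_rule(1)[OF c d dc p G(1)])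
  have "chart_partial d k (\<lambda>q. metric_mat g c q $ i $ j) p =
     (\<Sum>e\<in>UNIV. (transpose (?C e) ** ?G + ?G ** ?C e) $ i $ j * jacobian d c p e k)"
    unfolding chart_chain_rule(2)[OF c d dc p G(1)] G(2) ..
  also have "\<dots> = (transpose (directional_christoffel g c d p k) ** ?G + ?G ** directional_christoffel g c d p k) $ i $ j"
  proof -
    have "(\<Sum>e\<in>UNIV. (\<Sum>m\<in>UNIV. ?C e $ m $ i * ?G $ m $ j) * jacobian d c p e k) =
      (\<Sum>m\<in>UNIV. (\<Sum>e\<in>UNIV. jacobian d c p e k * ?C e $ m $ i) * ?G $ m $ j)"
      by (simp add: sum_distrib_left sum_distrib_right mult_ac) (rule sum.swap)
    moreover have "(\<Sum>e\<in>UNIV. (\<Sum>m\<in>UNIV. ?G $ i $ m * ?C e $ m $ j) * jacobian d c p e k) =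
      (\<Sum>m\<in>UNIV. ?G $ i $ m * (\<Sum>e\<in>UNIV. jacobian d c p e k * ?C e $ m $ j))"
      by (simp add: sum_distrib_left sum_distrib_right mult_ac) (rule sum.swap)
    ultimately show ?thesis
      by (simp add: matrix_mult_entry directional_christoffel_def transpose_def distrib_right sum.distrib sum_component)
  qed
  finally show "chart_partial d k (\<lambda>q. metric_mat g c q $ i $ j) p
     = (transpose (directional_christoffel g c d p k) ** ?G + ?G ** directional_christoffel g c d p k) $ i $ j" .
qed

text \<open>The transformation law of the Christoffel symbols. The argument is the uniqueness of the torsion-free
  metric connection: \<open>Z k\<close>, the connection of the chart \<open>c\<close> applied to the coordinate vector fields of
  the chart \<open>d\<close>, is symmetric in its lower indices and differentiates the metric of \<open>d\<close> as a metric
  connection does, so lowering its upper index gives the Christoffel symbols of \<open>d\<close>.\<close>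

lemma jacobian_mat_partial:
  "has_matrix_partial d k p (jacobian_mat d c)
     (jacobian_mat d c p ** christoffel_mat g d p k - directional_christoffel g c d p k ** jacobian_mat d c p)"
proof -
  let ?R = "jacobian_mat d c p" and ?G = "metric_mat g c p" and ?G' = "metric_mat g d p"
  let ?C = "directional_christoffel g c d p" and ?C' = "christoffel_mat g d p"
  define D where "D = (\<lambda>k. \<chi> a i. chart_partial d k (\<lambda>q. jacobian d c q a i) p)"
  have sm: "smooth_in d (chart_dom d \<inter> chart_dom c) (\<lambda>q. jacobian d c q a i)" for a i
    using dc smooth_in_partial[OF d overlaps(1,2)] by (simp add: compatible_def jacobian_def)
  have D: "has_matrix_partial d k p (jacobian_mat d c) (D k)" for k
    using smooth_in_differentiable[OF d overlaps(1,2) sm overlaps(3)]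
    by (auto simp: has_matrix_partial_def jacobian_mat_def D_def)
  \<comment> \<open>Mixed second derivatives of the transition map commute.\<close>
  have D_sym: "D k $ a $ i = D i $ a $ k" for k a i
  proof -
    have "smooth_in d (chart_dom d \<inter> chart_dom c) (\<lambda>q. coord c q $ a)" using dc by (simp add: compatible_def)
    from chart_partial_commute[OF d overlaps(1,2) this overlaps(3)] show ?thesis by (simp add: D_def jacobian_def)
  qed
  define Z where "Z = (\<lambda>k. D k + ?C k ** ?R)"
  have CR: "(?C k ** ?R) $ a $ i = (\<Sum>b\<in>UNIV. \<Sum>e\<in>UNIV. christoffel g c p a e b * jacobian d c p e k * jacobian d c p b i)" for k a i
    by (simp add: matrix_mult_entry directional_christoffel_def sum_component christoffel_mat_def jacobian_mat_def
        sum_distrib_right sum_distrib_left mult_ac)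
  have Z_sym: "Z k $ a $ i = Z i $ a $ k" for k a i
  proof -
    have "(?C k ** ?R) $ a $ i = (?C i ** ?R) $ a $ k"
      unfolding CR by (subst sum.swap) (simp add: christoffel_sym[OF c gc p(1), of a] mult_ac)
    then show ?thesis using D_sym[of k a i] by (simp add: Z_def)
  qed
  define Y where "Y = (\<lambda>k. transpose (Z k) ** ?G ** ?R)"
  have Y_sym: "Y k $ i $ j = Y i $ k $ j" for k i j
    by (simp add: Y_def matrix_mult_entry transpose_def Z_sym[of k _ i])
  have Gsym: "transpose ?G = ?G" by (rule metric_mat_inverse(3)[OF c gc p(1)])
  have dG': "has_matrix_partial d k p (metric_mat g d) (Y k + transpose (Y k))" for k
  proof (rule has_matrix_partial_cong[OF d overlaps(1-3)])
    show "transpose (jacobian_mat d c q) ** metric_mat g c q ** jacobian_mat d c q = metric_mat g d q"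
      if "q \<in> chart_dom d \<inter> chart_dom c" for q using law that by auto
    have "has_matrix_partial d k p (\<lambda>q. transpose (jacobian_mat d c q) ** metric_mat g c q ** jacobian_mat d c q)
      ((transpose (D k) ** ?G + transpose ?R ** (transpose (?C k) ** ?G + ?G ** ?C k)) ** ?R + transpose ?R ** ?G ** D k)"
      by (intro has_matrix_partial_mult[OF d p(2)] has_matrix_partial_transpose D metric_partial_other_chart)
    also have "(transpose (D k) ** ?G + transpose ?R ** (transpose (?C k) ** ?G + ?G ** ?C k)) ** ?R + transpose ?R ** ?G ** D k
      = Y k + transpose (Y k)"
      by (simp add: Y_def Z_def matrix_transpose_mul Gsym transpose_add transpose_transpose matrix_add_ldistrib matrix_add_distrib_right matrix_mul_assoc add_ac)
    finally show "has_matrix_partial d k p (\<lambda>q. transpose (jacobian_mat d c q) ** metric_mat g c q ** jacobian_mat d c q)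
      (Y k + transpose (Y k))" .
  qed
  have dg': "chart_partial d k (\<lambda>q. g d q [] [i, j]) p = Y k $ i $ j + Y k $ j $ i" for k i j
    using dG'[of k] by (simp add: has_matrix_partial_def metric_mat_def transpose_def)
  \<comment> \<open>By the symmetry of \<open>Y\<close>, four of the six terms of the lowered Christoffel symbol cancel.\<close>
  have "(?G' ** ?C' k) $ j $ i = Y k $ i $ j" for i j
    unfolding christoffel_lower[OF d gd p(2)] dg'
    using Y_sym[of k i j] Y_sym[of k j i] Y_sym[of i j k] by (simp add: field_simps)
  then have "?G' ** ?C' k = transpose (Y k)" by (simp add: vec_eq_iff transpose_def)
  also have "\<dots> = transpose ?R ** ?G ** Z k"
    by (simp add: Y_def matrix_transpose_mul Gsym transpose_transpose matrix_mul_assoc)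
  finally have "transpose ?R ** ?G ** (?R ** ?C' k) = transpose ?R ** ?G ** Z k"
    using law[OF p] by (simp add: matrix_mul_assoc)
  then have "(inv_metric_mat g c p ** transpose (jacobian_mat c d p)) ** (transpose ?R ** ?G ** (?R ** ?C' k))
     = (inv_metric_mat g c p ** transpose (jacobian_mat c d p)) ** (transpose ?R ** ?G ** Z k)" by simp
  moreover have "(inv_metric_mat g c p ** transpose (jacobian_mat c d p)) ** (transpose ?R ** ?G ** X) = X" for X :: "real^'n^'n"
  proof -
    have "transpose (jacobian_mat c d p) ** transpose ?R = mat 1"
      using arg_cong[OF jacobian_mat_inverse(2)[OF c d dc cd p], of transpose] by (simp add: matrix_transpose_mul)
    moreover have "(inv_metric_mat g c p ** transpose (jacobian_mat c d p)) ** (transpose ?R ** ?G ** X)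
      = inv_metric_mat g c p ** (transpose (jacobian_mat c d p) ** transpose ?R) ** ?G ** X"
      by (simp only: matrix_mul_assoc)
    ultimately show ?thesis using metric_mat_inverse(2)[OF c gc p(1)] by simp
  qed
  ultimately have "?R ** ?C' k = Z k" by simp
  then have "D k = ?R ** ?C' k - ?C k ** ?R" by (simp add: Z_def)
  then show ?thesis using D[of k] by simp
qed

text \<open>Differentiate the relation between the two Jacobians.\<close>

lemma jacobian_mat_partial_inverse:
  "has_matrix_partial d k p (jacobian_mat c d)
     (jacobian_mat c d p ** directional_christoffel g c d p k - christoffel_mat g d p k ** jacobian_mat c d p)"
proof -
  let ?R = "jacobian_mat d c p" and ?P = "jacobian_mat c d p"
  let ?C = "directional_christoffel g c d p k" and ?C' = "christoffel_mat g d p k"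
  define D where "D = (\<chi> a i. chart_partial d k (\<lambda>q. jacobian c d q a i) p)"
  have sm: "smooth_in c (chart_dom c \<inter> chart_dom d) (\<lambda>q. jacobian c d q a i)" for a i
    using cd smooth_in_partial[OF c overlaps(4,5)] by (simp add: compatible_def jacobian_def)
  have D: "has_matrix_partial d k p (jacobian_mat c d) D"
    using chart_chain_rule(1)[OF c d dc p smooth_in_differentiable[OF c overlaps(4,5) sm overlaps(6)]]
    by (auto simp: has_matrix_partial_def jacobian_mat_def D_def)
  have "has_matrix_partial d k p (\<lambda>q. jacobian_mat c d q ** jacobian_mat d c q) 0"
  proof (rule has_matrix_partial_cong[OF d overlaps(1-3) _ has_matrix_partial_const[OF d, of k p "mat 1"]])
    fix q assume "q \<in> chart_dom d \<inter> chart_dom c"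
    then show "mat 1 = jacobian_mat c d q ** jacobian_mat d c q"
      using jacobian_inverse[OF c d dc _ _ cd, of q]
      by (auto simp: vec_eq_iff matrix_mult_entry jacobian_mat_def mat_def)
  qed
  then have "D ** ?R + ?P ** (?R ** ?C' - ?C ** ?R) = 0"
    using has_matrix_partial_unique[OF has_matrix_partial_mult[OF d p(2) D jacobian_mat_partial]] by blast
  then have "(D ** ?R + ?P ** (?R ** ?C' + - (?C ** ?R))) ** ?P = 0" by simp
  moreover have "(D ** ?R + ?P ** (?R ** ?C' + - (?C ** ?R))) ** ?P
     = D ** (?R ** ?P) + (?P ** ?R) ** ?C' ** ?P + - (?P ** ?C ** (?R ** ?P))"
    by (simp only: matrix_add_ldistrib matrix_add_distrib_right matrix_mul_assoc add.assoc matrix_minus_mult matrix_mult_minus)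
  ultimately have "D + ?C' ** ?P - ?P ** ?C = 0"
    by (simp add: jacobian_mat_inverse[OF c d dc cd p])
  then have "D + ?C' ** ?P + - (?P ** ?C) = 0" by simp
  from add_zero_imp_eq[OF this] have "D = ?P ** ?C - ?C' ** ?P" by simp
  then show ?thesis using D by simp
qed

end

section \<open>Tensor fields and their covariant derivatives\<close>

text \<open>Covariant slots come first, so that a covariant derivative adds its new index at the head of the
  list and its list of variances is a \<open>Cons\<close>.\<close>

definition variances :: "nat \<Rightarrow> nat \<Rightarrow> bool list" where
  "variances r s = replicate s True @ replicate r False"

definition components :: "nat \<Rightarrow> ('a, 'n) tensor \<Rightarrow> ('a, 'n) chart \<Rightarrow> 'a \<Rightarrow> 'n list \<Rightarrow> real" where
  "components s T c p L = T c p (drop s L) (take s L)"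

definition metric_kernel :: "('a, 'n::finite) tensor \<Rightarrow> ('a, 'n) chart \<Rightarrow> 'a \<Rightarrow> bool \<Rightarrow> 'n \<Rightarrow> 'n \<Rightarrow> real" where
  "metric_kernel g c p v i j = (if v then inv_metric_mat g c p else metric_mat g c p) $ i $ j"

definition connection_kernel :: "('a, 'n::finite) tensor \<Rightarrow> ('a, 'n) chart \<Rightarrow> 'a \<Rightarrow> 'n \<Rightarrow> bool \<Rightarrow> 'n \<Rightarrow> 'n \<Rightarrow> real" where
  "connection_kernel g c p k v i m = (if v then - christoffel g c p m k i else christoffel g c p i k m)"

definition jacobian_kernel :: "('a, 'n::finite) chart \<Rightarrow> ('a, 'n) chart \<Rightarrow> 'a \<Rightarrow> bool \<Rightarrow> 'n \<Rightarrow> 'n \<Rightarrow> real" where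
  "jacobian_kernel c d p v i j = (if v then jacobian d c p j i else jacobian c d p i j)"

lemma length_variances [simp]: "length (variances r s) = s + r"
  by (simp add: variances_def)

lemma variances_Suc: "variances r (Suc s) = True # variances r s"
  by (simp add: variances_def)

lemma components_append: "length J = s \<Longrightarrow> components s T c p (J @ I) = T c p I J"
  by (simp add: components_def)

lemma act_variances:
  assumes "length J = s" "length I = r"
  shows "act C (variances r s) (components s T c p) (J @ I) =
    (\<Sum>b<s. \<Sum>m\<in>UNIV. C True (J ! b) m * T c p I (J[b := m]))
    + (\<Sum>a<r. \<Sum>m\<in>UNIV. C False (I ! a) m * T c p (I[a := m]) J)"
proof -
  have "act C (replicate r False @ []) (\<lambda>M. components s T c p (J @ M)) (I @ []) =
     (\<Sum>a<r. \<Sum>m\<in>UNIV. C False (I ! a) m * T c p (I[a := m]) J)"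
    by (subst act_replicate) (use assms in \<open>simp_all add: components_append\<close>)
  then show ?thesis
    unfolding variances_def by (subst act_replicate) (use assms in \<open>simp_all add: components_append\<close>)
qed

lemma components_cov_deriv:
  assumes "length L = s + r"
  shows "components (Suc s) (cov_deriv g T) c p (k # L) =
    chart_partial c k (\<lambda>q. components s T c q L) p
    + act (connection_kernel g c p k) (variances r s) (components s T c p) L"
proof -
  define J I where "J = take s L" and "I = drop s L"
  have L: "L = J @ I" "length J = s" "length I = r" using assms by (auto simp: J_def I_def)
  have "components (Suc s) (cov_deriv g T) c p (k # L) = cov_deriv g T c p I (k # J)"
    by (simp add: components_def J_def I_def)
  then show ?thesis
    unfolding L(1) act_variances[OF L(2,3)] components_append[OF L(2)]
    by (simp add: cov_deriv_def connection_kernel_def L sum_negf)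
qed

lemma contract_variances:
  assumes "length J = s" "length I = r"
  shows "contract N (variances r s) (components s T c p) (J @ I) =
    (\<Sum>I'\<in>multi_indices r. \<Sum>J'\<in>multi_indices s.
       (\<Prod>a<r. N False (I ! a) (I' ! a)) * (\<Prod>b<s. N True (J ! b) (J' ! b)) * T c p I' J')"
proof -
  have "contract N (replicate r False @ []) (\<lambda>M. components s T c p (J' @ M)) I =
     (\<Sum>I'\<in>multi_indices r. (\<Prod>a<r. N False (I ! a) (I' ! a)) * T c p I' J')" if "J' \<in> multi_indices s" for J'
    by (subst contract_replicate) (use assms that in \<open>auto simp: components_append multi_indices_def\<close>)
  then have "contract N (variances r s) (components s T c p) (J @ I) =
    (\<Sum>J'\<in>multi_indices s. \<Sum>I'\<in>multi_indices r.
       (\<Prod>a<r. N False (I ! a) (I' ! a)) * (\<Prod>b<s. N True (J ! b) (J' ! b)) * T c p I' J')"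
    unfolding variances_def
    by (subst contract_replicate) (use assms in \<open>simp_all add: nth_append sum_distrib_left mult_ac\<close>)
  then show ?thesis by (subst sum.swap) simp
qed

lemma pairing_variances:
  fixes T :: "('a, 'n::finite) tensor"
  shows "pairing W (variances r s) (components s T c p) (components s T c p) =
    (\<Sum>I\<in>multi_indices r. \<Sum>I'\<in>multi_indices r. \<Sum>J\<in>multi_indices s. \<Sum>J'\<in>multi_indices s.
       (\<Prod>a<r. W False (I ! a) (I' ! a)) * (\<Prod>b<s. W True (J ! b) (J' ! b)) * T c p I J * T c p I' J')"
proof -
  let ?A = "multi_indices r :: 'n list set" and ?B = "multi_indices s :: 'n list set"
  let ?f = "\<lambda>I I' J J'. (\<Prod>a<r. W False (I ! a) (I' ! a)) * (\<Prod>b<s. W True (J ! b) (J' ! b)) * T c p I J * T c p I' J'"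
  have "pairing W (replicate r False @ []) (\<lambda>M. components s T c p (J @ M)) (\<lambda>M. components s T c p (J' @ M)) =
     (\<Sum>I\<in>?A. \<Sum>I'\<in>?A. (\<Prod>a<r. W False (I ! a) (I' ! a)) * (T c p I J * T c p I' J'))"
    if "J \<in> ?B" "J' \<in> ?B" for J J'
    by (subst pairing_replicate) (use that in \<open>auto simp: components_append multi_indices_def\<close>)
  then have "pairing W (variances r s) (components s T c p) (components s T c p) =
    (\<Sum>J\<in>?B. \<Sum>J'\<in>?B. \<Sum>I\<in>?A. \<Sum>I'\<in>?A. ?f I I' J J')"
    unfolding variances_def by (subst pairing_replicate) (simp add: sum_distrib_left mult_ac)
  also have "\<dots> = (\<Sum>J\<in>?B. \<Sum>I\<in>?A. \<Sum>J'\<in>?B. \<Sum>I'\<in>?A. ?f I I' J J')"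
    by (intro sum.cong refl sum.swap)
  also have "\<dots> = (\<Sum>I\<in>?A. \<Sum>J\<in>?B. \<Sum>J'\<in>?B. \<Sum>I'\<in>?A. ?f I I' J J')"
    by (rule sum.swap)
  also have "\<dots> = (\<Sum>I\<in>?A. \<Sum>J\<in>?B. \<Sum>I'\<in>?A. \<Sum>J'\<in>?B. ?f I I' J J')"
    by (intro sum.cong refl sum.swap)
  also have "\<dots> = (\<Sum>I\<in>?A. \<Sum>I'\<in>?A. \<Sum>J\<in>?B. \<Sum>J'\<in>?B. ?f I I' J J')"
    by (intro sum.cong refl sum.swap)
  finally show ?thesis .
qed

lemma smooth_tensor_field_iff:
  "smooth_tensor_field atl r s T \<longleftrightarrow>
    (\<forall>c\<in>atl. \<forall>L. length L = s + r \<longrightarrow> smooth_in c (chart_dom c) (\<lambda>q. components s T c q L)) \<and>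
    (\<forall>c\<in>atl. \<forall>d\<in>atl. \<forall>p\<in>chart_dom c \<inter> chart_dom d. \<forall>L. length L = s + r \<longrightarrow>
       components s T d p L = contract (jacobian_kernel c d p) (variances r s) (components s T c p) L)"
proof -
  have split: "(\<forall>L. length L = s + r \<longrightarrow> P L) \<longleftrightarrow> (\<forall>I\<in>multi_indices r. \<forall>J\<in>multi_indices s. P (J @ I))"
    for P :: "'b list \<Rightarrow> bool"
  proof (intro iffI ballI allI impI)
    fix L :: "'b list" assume *: "\<forall>I\<in>multi_indices r. \<forall>J\<in>multi_indices s. P (J @ I)" "length L = s + r"
    then show "P L" using *(1)[rule_format, of "drop s L" "take s L"] by (simp add: multi_indices_def)
  qed (simp add: multi_indices_def)
  show ?thesis
    unfolding split smooth_tensor_field_def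
    by (intro conj_cong ball_cong refl)
       (simp_all add: smooth_in_def chart_image_def components_append multi_indices_def contract_variances jacobian_kernel_def)
qed

section \<open>Riemannian metrics on an atlas\<close>

locale riemannian_atlas =
  fixes atl :: "('a::{t2_space, second_countable_topology}, 'n::finite) chart set"
    and g :: "('a, 'n) tensor"
  assumes atlas: "smooth_atlas atl" and metric: "riemannian_metric atl g"
begin

lemma regular_chart: "c \<in> atl \<Longrightarrow> regular_chart c"
  using atlas by (auto simp: smooth_atlas_def regular_chart_def)

lemma open_dom: "c \<in> atl \<Longrightarrow> open (chart_dom c)"
  using regular_chart by (auto simp: regular_chart_def)

lemma compatible: "c \<in> atl \<Longrightarrow> d \<in> atl \<Longrightarrow> compatible c d"
  using atlas by (auto simp: smooth_atlas_def compatible_def smooth_in_def)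

lemma chart_at: "chart_at atl p \<in> atl" "p \<in> chart_dom (chart_at atl p)"
proof -
  have "p \<in> (\<Union>c\<in>atl. chart_dom c)" using atlas by (simp add: smooth_atlas_def)
  then have "\<exists>c. c \<in> atl \<and> p \<in> chart_dom c" by blast
  from someI_ex[OF this] show "chart_at atl p \<in> atl" "p \<in> chart_dom (chart_at atl p)"
    by (simp_all add: chart_at_def)
qed

lemma metric_in: "c \<in> atl \<Longrightarrow> metric_in c g"
  using metric
  by (auto simp: riemannian_metric_def metric_in_def smooth_tensor_field_def smooth_in_def chart_image_def multi_indices_def)

lemma metric_law:
  assumes "c \<in> atl" "d \<in> atl" "q \<in> chart_dom c" "q \<in> chart_dom d"
  shows "metric_mat g d q = transpose (jacobian_mat d c q) ** metric_mat g c q ** jacobian_mat d c q"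
proof -
  have "g d q [] [i, j] = (\<Sum>a\<in>UNIV. \<Sum>b\<in>UNIV. jacobian d c q a i * jacobian d c q b j * g c q [] [a, b])" for i j
  proof -
    have m: "[] \<in> multi_indices 0" "[i, j] \<in> multi_indices 2" and cdq: "q \<in> chart_dom c \<inter> chart_dom d"
      using assms by (simp_all add: multi_indices_def)
    have "smooth_tensor_field atl 0 2 g" using metric by (simp add: riemannian_metric_def)
    note conjunct2[OF this[unfolded smooth_tensor_field_def]]
    from this[THEN bspec, OF assms(1), THEN bspec, OF assms(2), THEN bspec, OF cdq, THEN bspec, OF m(1), THEN bspec, OF m(2)]
    show ?thesis by (simp add: eval_nat_numeral sum_multi_indices_Suc sum_multi_indices_0)
  qed
  then show ?thesis
    by (simp add: vec_eq_iff metric_mat_def matrix_mult_entry transpose_def jacobian_mat_def sum_distrib_right)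
       (subst sum.swap, simp add: mult_ac)
qed

text \<open>For the covariant slots, the inverse metric is positive because its value at \<open>v\<close> is the value of
  the metric at the vector obtained from \<open>v\<close> by raising the index.\<close>

lemma gram_metric_kernel:
  assumes "c \<in> atl" "p \<in> chart_dom c"
  obtains B where "gram B (metric_kernel g c p)"
proof -
  let ?G = "metric_mat g c p" and ?I = "inv_metric_mat g c p"
  note inv = metric_mat_inverse[OF regular_chart[OF assms(1)] metric_in[OF assms(1)] assms(2)]
  have sym: "?G $ i $ j = ?G $ j $ i" "?I $ i $ j = ?I $ j $ i" for i j
    using inv(3,4) by (simp_all add: transpose_def vec_eq_iff)
  have quad: "(\<Sum>i\<in>UNIV. \<Sum>j\<in>UNIV. x i * A $ i $ j * x j) = (\<chi> i. x i) \<bullet> (A *v (\<chi> i. x i))"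
    for A :: "real^'n^'n" and x
    by (simp add: inner_vec_def matrix_vector_mult_def sum_distrib_left mult_ac)
  have pos: "0 \<le> v \<bullet> (?G *v v)" for v
    using metric_in[OF assms(1)] assms(2) by (cases "v = 0") (auto simp: metric_in_def intro: less_imp_le)
  have pos': "0 \<le> v \<bullet> (?I *v v)" for v
  proof -
    have "v \<bullet> (?I *v v) = (?G *v (?I *v v)) \<bullet> (?I *v v)"
      by (simp add: matrix_vector_mul_assoc inv)
    then show ?thesis using pos[of "?I *v v"] by (simp add: inner_commute)
  qed
  have qB1: "0 \<le> (\<Sum>i\<in>UNIV. \<Sum>j\<in>UNIV. x i * ?G $ i $ j * x j)" for x
    unfolding quad by (rule pos)
  obtain B1 :: "'n \<Rightarrow> 'n \<Rightarrow> real" where B1: "\<And>i j. ?G $ i $ j = (\<Sum>k\<in>UNIV. B1 k i * B1 k j)"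
    by (rule psd_gram_decomposition[of "\<lambda>i j. ?G $ i $ j", OF sym(1) qB1]) blast
  have qB2: "0 \<le> (\<Sum>i\<in>UNIV. \<Sum>j\<in>UNIV. x i * ?I $ i $ j * x j)" for x
    unfolding quad by (rule pos')
  obtain B2 :: "'n \<Rightarrow> 'n \<Rightarrow> real" where B2: "\<And>i j. ?I $ i $ j = (\<Sum>k\<in>UNIV. B2 k i * B2 k j)"
    by (rule psd_gram_decomposition[of "\<lambda>i j. ?I $ i $ j", OF sym(2) qB2]) blast
  have "gram (\<lambda>v. if v then B2 else B1) (metric_kernel g c p)"
    by (simp add: gram_def metric_kernel_def B1 B2)
  then show ?thesis by (rule that)
qed

lemma metric_kernel_compatible:
  assumes "c \<in> atl" "p \<in> chart_dom c"
  shows "((\<lambda>x. metric_kernel g c (coord_line c k p x) v i j) has_real_derivative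
    (\<Sum>m\<in>UNIV. connection_kernel g c p k v m i * metric_kernel g c p v m j)
    + (\<Sum>m\<in>UNIV. connection_kernel g c p k v m j * metric_kernel g c p v i m)) (at 0)"
proof (cases v)
  case True
  let ?I = "inv_metric_mat g c p" and ?C = "christoffel_mat g c p k"
  have "((\<lambda>x. inv_metric_mat g c (coord_line c k p x) $ i $ j) has_real_derivative
     (- (?I ** transpose ?C) - ?C ** ?I) $ i $ j) (at 0)"
    using inv_metric_compatible[OF regular_chart[OF assms(1)] metric_in[OF assms(1)] assms(2), of k]
      has_chart_partial[of c "\<lambda>q. inv_metric_mat g c q $ i $ j" p k]
    by (auto simp: has_matrix_partial_def)
  moreover have "(- (?I ** transpose ?C) - ?C ** ?I) $ i $ j =
    (\<Sum>m\<in>UNIV. connection_kernel g c p k v m i * metric_kernel g c p v m j)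
    + (\<Sum>m\<in>UNIV. connection_kernel g c p k v m j * metric_kernel g c p v i m)"
    using True by (simp add: metric_kernel_def connection_kernel_def matrix_mult_entry transpose_def christoffel_mat_def sum_negf mult.commute)
  ultimately show ?thesis using True by (simp add: metric_kernel_def)
next
  case False
  let ?G = "metric_mat g c p" and ?C = "christoffel_mat g c p k"
  have "((\<lambda>x. metric_mat g c (coord_line c k p x) $ i $ j) has_real_derivative
     (transpose ?C ** ?G + ?G ** ?C) $ i $ j) (at 0)"
    using metric_compatible[OF regular_chart[OF assms(1)] metric_in[OF assms(1)] assms(2), of k]
      has_chart_partial[of c "\<lambda>q. metric_mat g c q $ i $ j" p k]
    by (auto simp: has_matrix_partial_def)
  then show ?thesis
    using False by (simp add: metric_kernel_def connection_kernel_def matrix_mult_entry transpose_def christoffel_mat_def mult.commute)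
qed

lemma smooth_in_metric_kernel: "c \<in> atl \<Longrightarrow> smooth_in c (chart_dom c) (\<lambda>q. metric_kernel g c q v i j)"
  using smooth_in_metric[OF regular_chart metric_in] smooth_in_inv_metric[OF regular_chart metric_in]
  by (cases v) (auto simp: metric_kernel_def)

lemma smooth_in_connection_kernel: "c \<in> atl \<Longrightarrow> smooth_in c (chart_dom c) (\<lambda>q. connection_kernel g c q k v i j)"
  using smooth_in_christoffel[OF regular_chart metric_in] smooth_in_minus[OF regular_chart open_dom]
  by (cases v) (auto simp: connection_kernel_def)

subsection \<open>Covariant derivatives are tensor fields\<close>

lemma jacobian_kernel_derivative:
  assumes c: "c \<in> atl" and d: "d \<in> atl" and p: "p \<in> chart_dom c" "p \<in> chart_dom d"
  shows "((\<lambda>x. jacobian_kernel c d (coord_line d k p x) v i j) has_real_derivative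
    (\<Sum>m\<in>UNIV. jacobian_kernel c d p v i m * (\<Sum>e\<in>UNIV. jacobian d c p e k * connection_kernel g c p e v m j))
    - (\<Sum>m\<in>UNIV. connection_kernel g d p k v i m * jacobian_kernel c d p v m j)) (at 0)"
proof -
  let ?C = "directional_christoffel g c d p k" and ?C' = "christoffel_mat g d p k"
  let ?R = "jacobian_mat d c p" and ?P = "jacobian_mat c d p"
  note asm = regular_chart[OF c] regular_chart[OF d] compatible[OF d c] compatible[OF c d] p
    metric_in[OF c] metric_in[OF d] metric_law[OF c d]
  show ?thesis
  proof (cases v)
    case True
    have "((\<lambda>x. jacobian_mat d c (coord_line d k p x) $ j $ i) has_real_derivative (?R ** ?C' - ?C ** ?R) $ j $ i) (at 0)"
      using jacobian_mat_partial[OF asm, of k] has_chart_partial[of d "\<lambda>q. jacobian_mat d c q $ j $ i" p k]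
      by (auto simp: has_matrix_partial_def)
    then show ?thesis
      using True
      by (simp add: jacobian_kernel_def connection_kernel_def matrix_mult_entry jacobian_mat_def
          christoffel_mat_def directional_christoffel_def sum_component sum_negf mult.commute)
  next
    case False
    have "((\<lambda>x. jacobian_mat c d (coord_line d k p x) $ i $ j) has_real_derivative (?P ** ?C - ?C' ** ?P) $ i $ j) (at 0)"
      using jacobian_mat_partial_inverse[OF asm, of k] has_chart_partial[of d "\<lambda>q. jacobian_mat c d q $ i $ j" p k]
      by (auto simp: has_matrix_partial_def)
    then show ?thesis
      using False
      by (simp add: jacobian_kernel_def connection_kernel_def matrix_mult_entry jacobian_mat_def
          christoffel_mat_def directional_christoffel_def sum_component)
  qed
qed

lemma smooth_in_components_cov_deriv:
  assumes T: "smooth_tensor_field atl r s T" and c: "c \<in> atl" and L: "length L = Suc s + r"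
  shows "smooth_in c (chart_dom c) (\<lambda>q. components (Suc s) (cov_deriv g T) c q L)"
proof -
  obtain k M where M: "L = k # M" "length M = s + r" using L by (cases L) auto
  have sm: "length M = s + r \<Longrightarrow> smooth_in c (chart_dom c) (\<lambda>q. components s T c q M)" for M
    using T c by (auto simp: smooth_tensor_field_iff)
  note rc = regular_chart[OF c] open_dom[OF c] order.refl
  show ?thesis
    unfolding M(1) components_cov_deriv[OF M(2)]
    by (intro smooth_in_add[OF rc] smooth_in_partial[OF rc] smooth_in_act[OF rc] smooth_in_connection_kernel c sm)
       (use M in auto)
qed

text \<open>Differentiate the transformation law of \<open>T\<close> along a coordinate line of \<open>d\<close>. The derivatives of the
  Jacobians contribute exactly the difference of the two connections, and the chain rule turns the
  direction of differentiation into one more covariant slot.\<close>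

lemma components_cov_deriv_law:
  assumes T: "smooth_tensor_field atl r s T" and c: "c \<in> atl" and d: "d \<in> atl"
    and p: "p \<in> chart_dom c" "p \<in> chart_dom d" and L: "length L = Suc s + r"
  shows "components (Suc s) (cov_deriv g T) d p L =
    contract (jacobian_kernel c d p) (variances r (Suc s)) (components (Suc s) (cov_deriv g T) c p) L"
proof -
  obtain k M where M: "L = k # M" "length M = s + r" using L by (cases L) auto
  let ?vs = "variances r s" and ?N = "jacobian_kernel c d" and ?Tc = "components s T c" and ?Td = "components s T d"
  let ?C = "\<lambda>v i m. \<Sum>e\<in>UNIV. jacobian d c p e k * connection_kernel g c p e v i m"
  let ?C' = "connection_kernel g d p k"
  let ?W = "chart_dom d \<inter> chart_dom c"
  note rc = regular_chart[OF c] open_dom[OF c] order.refl and rd = regular_chart[OF d] open_dom[OF d] order.refl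
  have W: "open ?W" "?W \<subseteq> chart_dom d" "p \<in> ?W" using open_dom[OF c] open_dom[OF d] p by auto
  have law: "?Td q K = contract (?N q) ?vs (?Tc q) K" if "q \<in> ?W" "length K = s + r" for q K
    using T c d that by (auto simp: smooth_tensor_field_iff)
  have dT: "chart_differentiable d (\<lambda>q. ?Td q K) p" "chart_differentiable c (\<lambda>q. ?Tc q K) p" if "length K = s + r" for K
  proof -
    show "chart_differentiable d (\<lambda>q. ?Td q K) p"
      by (rule smooth_in_differentiable[OF rd _ p(2)]) (use T d that in \<open>auto simp: smooth_tensor_field_iff\<close>)
    show "chart_differentiable c (\<lambda>q. ?Tc q K) p"
      by (rule smooth_in_differentiable[OF rc _ p(1)]) (use T c that in \<open>auto simp: smooth_tensor_field_iff\<close>)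
  qed
  note chain = chart_chain_rule[OF regular_chart[OF c] regular_chart[OF d] compatible[OF d c] p dT(2)]
  have p0: "coord_line d k p 0 = p" using p param_coord[OF regular_chart[OF d]] by simp
  let ?T' = "\<lambda>K. \<Sum>e\<in>UNIV. chart_partial c e (\<lambda>q. ?Tc q K) p * jacobian d c p e k"
  have "((\<lambda>x. contract (?N (coord_line d k p x)) ?vs (?Tc (coord_line d k p x)) M) has_real_derivative
     contract (?N (coord_line d k p 0)) ?vs (\<lambda>K. ?T' K + act ?C ?vs (?Tc (coord_line d k p 0)) K) M
     - act ?C' ?vs (contract (?N (coord_line d k p 0)) ?vs (?Tc (coord_line d k p 0))) M) (at 0)"
  proof (rule contract_derivative)
    show "((\<lambda>x. ?N (coord_line d k p x) v i j) has_real_derivative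
       (\<Sum>m\<in>UNIV. ?N (coord_line d k p 0) v i m * ?C v m j) - (\<Sum>m\<in>UNIV. ?C' v i m * ?N (coord_line d k p 0) v m j)) (at 0)" for v i j
      unfolding p0 by (rule jacobian_kernel_derivative[OF c d p])
    show "((\<lambda>x. ?Tc (coord_line d k p x) K) has_real_derivative ?T' K) (at 0)" if "length K = length ?vs" for K
      using has_chart_partial[OF chain(1)] chain(2) that by simp
    show "length M = length ?vs" using M by simp
  qed
  then have der: "((\<lambda>x. contract (?N (coord_line d k p x)) ?vs (?Tc (coord_line d k p x)) M) has_real_derivative
     contract (?N p) ?vs (\<lambda>K. ?T' K + act ?C ?vs (?Tc p) K) M - act ?C' ?vs (contract (?N p) ?vs (?Tc p)) M) (at 0)"
    unfolding p0 .
  note cong = chart_differentiable_cong[OF rd(1) W _ dT(1)[OF M(2)], of "\<lambda>q. contract (?N q) ?vs (?Tc q) M"]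
  have "chart_partial d k (\<lambda>q. ?Td q M) p = chart_partial d k (\<lambda>q. contract (?N q) ?vs (?Tc q) M) p"
    by (rule cong(2)) (use law M in auto)
  also have "\<dots> = contract (?N p) ?vs (\<lambda>K. ?T' K + act ?C ?vs (?Tc p) K) M - act ?C' ?vs (contract (?N p) ?vs (?Tc p)) M"
    by (rule chart_partial_unique[OF cong(1) der]) (use law M in auto)
  also have "act ?C' ?vs (contract (?N p) ?vs (?Tc p)) M = act ?C' ?vs (?Td p) M"
    by (rule act_cong) (use law W M in auto)
  finally have "components (Suc s) (cov_deriv g T) d p L = contract (?N p) ?vs (\<lambda>K. ?T' K + act ?C ?vs (?Tc p) K) M"
    unfolding M(1) components_cov_deriv[OF M(2)] by simp
  also have "\<dots> = contract (?N p) ?vs (\<lambda>K. \<Sum>e\<in>UNIV. jacobian d c p e k * components (Suc s) (cov_deriv g T) c p (e # K)) M"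
    by (rule contract_cong) (simp add: components_cov_deriv act_sum_coeff distrib_left sum.distrib mult.commute)
  also have "\<dots> = contract (?N p) (variances r (Suc s)) (components (Suc s) (cov_deriv g T) c p) L"
    by (simp add: contract_sum M(1) variances_Suc jacobian_kernel_def)
  finally show ?thesis .
qed

lemma smooth_tensor_field_cov_deriv:
  assumes T: "smooth_tensor_field atl r s T"
  shows "smooth_tensor_field atl r (Suc s) (cov_deriv g T)"
  unfolding smooth_tensor_field_iff
  by (intro conjI ballI allI impI)
     (simp_all only: Int_iff smooth_in_components_cov_deriv[OF T] components_cov_deriv_law[OF T])

lemma smooth_tensor_field_iterate:
  "smooth_tensor_field atl r s T \<Longrightarrow> smooth_tensor_field atl r (s + j) ((cov_deriv g ^^ j) T)"
  by (induction j) (auto intro: smooth_tensor_field_cov_deriv)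

subsection \<open>The norm in an arbitrary chart\<close>

text \<open>This is the transformation law of the metric, and of its inverse, solved for the metric in the chart \<open>c\<close>.\<close>

lemma metric_kernel_law:
  assumes c: "c \<in> atl" and d: "d \<in> atl" and p: "p \<in> chart_dom c" "p \<in> chart_dom d"
  shows "metric_kernel g c p v i j = (\<Sum>k\<in>UNIV. \<Sum>l\<in>UNIV. jacobian_kernel c d p v k i * metric_kernel g d p v k l * jacobian_kernel c d p v l j)"
proof -
  let ?R = "jacobian_mat d c p" and ?P = "jacobian_mat c d p"
  let ?G = "metric_mat g c p" and ?I = "inv_metric_mat g c p" and ?G' = "metric_mat g d p" and ?I' = "inv_metric_mat g d p"
  note RP = jacobian_mat_inverse[OF regular_chart[OF c] regular_chart[OF d] compatible[OF d c] compatible[OF c d] p]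
  note I = metric_mat_inverse[OF regular_chart[OF c] metric_in[OF c] p(1)]
  note I' = metric_mat_inverse[OF regular_chart[OF d] metric_in[OF d] p(2)]
  have PRt: "transpose ?P ** transpose ?R = mat 1" "transpose ?R ** transpose ?P = mat 1"
    using arg_cong[OF RP(1), of transpose] arg_cong[OF RP(2), of transpose] by (simp_all add: matrix_transpose_mul)
  have G': "?G' = transpose ?R ** ?G ** ?R" by (rule metric_law[OF c d p])
  have "transpose ?P ** ?G' ** ?P = (transpose ?P ** transpose ?R) ** ?G ** (?R ** ?P)"
    unfolding G' by (simp only: matrix_mul_assoc)
  then have Glaw: "?G = transpose ?P ** ?G' ** ?P" by (simp add: PRt RP)
  have "?G' ** (?P ** ?I ** transpose ?P) = transpose ?R ** (?G ** ((?R ** ?P) ** ?I)) ** transpose ?P"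
    unfolding G' by (simp only: matrix_mul_assoc)
  then have "?G' ** (?P ** ?I ** transpose ?P) = mat 1" by (simp add: RP I PRt)
  then have "?I' ** (?G' ** (?P ** ?I ** transpose ?P)) = ?I'" by simp
  then have "?I' = ?P ** ?I ** transpose ?P" by (simp add: matrix_mul_assoc I')
  then have "?R ** ?I' ** transpose ?R = (?R ** ?P) ** ?I ** (transpose ?P ** transpose ?R)"
    by (simp only: matrix_mul_assoc)
  then have Ilaw: "?I = ?R ** ?I' ** transpose ?R" by (simp add: PRt RP)
  show ?thesis
  proof (cases v)
    case True
    have "?I $ i $ j = (\<Sum>l\<in>UNIV. (\<Sum>k\<in>UNIV. jacobian d c p i k * ?I' $ k $ l) * jacobian d c p j l)"
      by (subst Ilaw) (simp add: matrix_mult_entry transpose_def jacobian_mat_def)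
    then show ?thesis using True
      by (subst sum.swap) (simp add: metric_kernel_def jacobian_kernel_def sum_distrib_right)
  next
    case False
    have "?G $ i $ j = (\<Sum>l\<in>UNIV. (\<Sum>k\<in>UNIV. jacobian c d p k i * ?G' $ k $ l) * jacobian c d p l j)"
      by (subst Glaw) (simp add: matrix_mult_entry transpose_def jacobian_mat_def)
    then show ?thesis using False
      by (subst sum.swap) (simp add: metric_kernel_def jacobian_kernel_def sum_distrib_right)
  qed
qed

text \<open>Near a given point the norm may therefore be computed in one and the same chart; without this
  it could not be differentiated.\<close>

lemma tensor_norm_chart:
  assumes T: "smooth_tensor_field atl r s T" and c: "c \<in> atl" and p: "p \<in> chart_dom c"
  shows "tensor_norm atl g r s T p =
    sqrt (pairing (metric_kernel g c p) (variances r s) (components s T c p) (components s T c p))"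
proof -
  define d where "d = chart_at atl p"
  have d: "d \<in> atl" "p \<in> chart_dom d" using chart_at by (auto simp: d_def)
  have "tensor_norm atl g r s T p =
    sqrt (pairing (metric_kernel g d p) (variances r s) (components s T d p) (components s T d p))"
    by (simp add: tensor_norm_def d_def[symmetric] pairing_variances metric_kernel_def inv_metric_mat_def inv_metric_def)
  also have "pairing (metric_kernel g d p) (variances r s) (components s T d p) (components s T d p) =
     pairing (metric_kernel g d p) (variances r s) (contract (jacobian_kernel c d p) (variances r s) (components s T c p))
       (contract (jacobian_kernel c d p) (variances r s) (components s T c p))"
    by (rule pairing_cong) (use T c d p in \<open>auto simp: smooth_tensor_field_iff\<close>)
  also have "\<dots> = pairing (metric_kernel g c p) (variances r s) (components s T c p) (components s T c p)"
    by (rule pairing_contract) (rule metric_kernel_law[OF c d(1) p d(2)])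
  finally show ?thesis .
qed

lemma tensor_norm_square:
  assumes "smooth_tensor_field atl r s T" "c \<in> atl" "p \<in> chart_dom c"
  shows "(tensor_norm atl g r s T p)\<^sup>2 =
    pairing (metric_kernel g c p) (variances r s) (components s T c p) (components s T c p)"
proof -
  obtain B where "gram B (metric_kernel g c p)" using gram_metric_kernel assms(2,3) by blast
  then show ?thesis using tensor_norm_chart[OF assms] pairing_nonneg by simp
qed

lemma tensor_norm_nonneg: "smooth_tensor_field atl r s T \<Longrightarrow> 0 \<le> tensor_norm atl g r s T p"
proof -
  assume T: "smooth_tensor_field atl r s T"
  obtain B where "gram B (metric_kernel g (chart_at atl p) p)" using gram_metric_kernel chart_at by metis
  then show ?thesis using tensor_norm_chart[OF T chart_at] pairing_nonneg by simp
qed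

end

context riemannian_atlas
begin

section \<open>The Laplacian in a chart\<close>

definition chart_laplacian :: "('a, 'n) chart \<Rightarrow> ('a \<Rightarrow> real) \<Rightarrow> 'a \<Rightarrow> real" where
  "chart_laplacian c f p = (\<Sum>i\<in>UNIV. \<Sum>j\<in>UNIV. metric_kernel g c p True i j *
     (chart_partial c i (chart_partial c j f) p - (\<Sum>m\<in>UNIV. christoffel g c p m i j * chart_partial c m f p)))"

definition chart_gradient_product :: "('a, 'n) chart \<Rightarrow> ('a \<Rightarrow> real) \<Rightarrow> ('a \<Rightarrow> real) \<Rightarrow> 'a \<Rightarrow> real" where
  "chart_gradient_product c f h p =
     (\<Sum>i\<in>UNIV. \<Sum>j\<in>UNIV. metric_kernel g c p True i j * (chart_partial c i f p * chart_partial c j h p))"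

lemma smooth_fun_iff: "smooth_fun atl f \<longleftrightarrow> (\<forall>c\<in>atl. smooth_in c (chart_dom c) f)"
  by (simp add: smooth_fun_def smooth_in_def chart_image_def)

lemma smooth_fun_continuous_on:
  assumes "smooth_fun atl f" shows "continuous_on S f"
proof -
  have "isCont f p" for p
    using smooth_in_continuous_on[OF regular_chart[OF chart_at(1)] open_dom[OF chart_at(1)] order.refl, of p f]
      assms chart_at[of p] open_dom[OF chart_at(1), of p]
    by (auto simp: smooth_fun_iff continuous_on_eq_continuous_at)
  then show ?thesis by (simp add: continuous_at_imp_continuous_on)
qed

lemma laplacian_eq_chart_laplacian: "laplacian atl g f p = chart_laplacian (chart_at atl p) f p"
  by (simp add: laplacian_def chart_laplacian_def Let_def cov_deriv_def fun_tensor_def metric_kernel_def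
      inv_metric_mat_def inv_metric_def)

lemma smooth_tensor_field_fun_tensor: "smooth_fun atl f \<Longrightarrow> smooth_tensor_field atl 0 0 (fun_tensor f)"
  by (auto simp: smooth_tensor_field_iff smooth_fun_iff components_def fun_tensor_def variances_def)

lemma grad_norm_square:
  assumes "smooth_fun atl f"
  shows "(grad_norm atl g f p)\<^sup>2 = chart_gradient_product (chart_at atl p) f f p"
  unfolding grad_norm_def
  using tensor_norm_square[OF smooth_tensor_field_cov_deriv[OF smooth_tensor_field_fun_tensor[OF assms]] chart_at]
  by (simp add: chart_gradient_product_def variances_def components_def cov_deriv_def fun_tensor_def)

context
  fixes c p assumes c: "c \<in> atl" and p: "p \<in> chart_dom c"
begin

private lemma rc: "regular_chart c" "open (chart_dom c)" "chart_dom c \<subseteq> chart_dom c"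
  using regular_chart[OF c] open_dom[OF c] by auto

private lemma inv_sym: "metric_kernel g c p True i j = metric_kernel g c p True j i"
  using gram_metric_kernel[OF c p] gram_sym by metis

lemma chart_laplacian_cong:
  assumes f: "smooth_in c (chart_dom c) f" and eq: "\<And>q. q \<in> chart_dom c \<Longrightarrow> f q = h q"
  shows "chart_laplacian c f p = chart_laplacian c h p"
proof -
  have 1: "chart_partial c j f q = chart_partial c j h q" if "q \<in> chart_dom c" for j q
    by (rule chart_differentiable_cong(2)[OF rc that eq smooth_in_differentiable[OF rc f that]])
  have "chart_partial c i (chart_partial c j f) p = chart_partial c i (chart_partial c j h) p" for i j
    by (rule chart_differentiable_cong(2)[OF rc p 1 smooth_in_differentiable[OF rc smooth_in_partial[OF rc f] p]])
  then show ?thesis by (simp add: chart_laplacian_def 1 p)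
qed

lemma chart_laplacian_add:
  assumes f: "smooth_in c (chart_dom c) f" and h: "smooth_in c (chart_dom c) h"
  shows "chart_laplacian c (\<lambda>q. f q + h q) p = chart_laplacian c f p + chart_laplacian c h p"
proof -
  note d = smooth_in_differentiable[OF rc]
  have 1: "chart_partial c j (\<lambda>q. f q + h q) q = chart_partial c j f q + chart_partial c j h q" if "q \<in> chart_dom c" for j q
    by (rule chart_partial_add[OF rc(1) d[OF f that] d[OF h that]])
  have s: "smooth_in c (chart_dom c) (chart_partial c j (\<lambda>q. f q + h q))" for j
    by (intro smooth_in_partial[OF rc] smooth_in_add[OF rc] f h)
  have "chart_partial c i (chart_partial c j (\<lambda>q. f q + h q)) p
      = chart_partial c i (\<lambda>q. chart_partial c j f q + chart_partial c j h q) p" for i j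
    by (rule chart_differentiable_cong(2)[OF rc p 1 d[OF s p]])
  also have "\<dots> i j = chart_partial c i (chart_partial c j f) p + chart_partial c i (chart_partial c j h) p" for i j
    by (rule chart_partial_add[OF rc(1)]) (intro d smooth_in_partial[OF rc] f h p)+
  finally show ?thesis
    by (simp add: chart_laplacian_def 1 p algebra_simps sum.distrib sum_subtractf)
qed

lemma chart_laplacian_mult:
  assumes f: "smooth_in c (chart_dom c) f" and h: "smooth_in c (chart_dom c) h"
  shows "chart_laplacian c (\<lambda>q. f q * h q) p =
    f p * chart_laplacian c h p + h p * chart_laplacian c f p + 2 * chart_gradient_product c f h p"
proof -
  note d = smooth_in_differentiable[OF rc]
  let ?g = "metric_kernel g c p True"
  let ?f = "\<lambda>i. chart_partial c i f" and ?h = "\<lambda>i. chart_partial c i h"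
  have 1: "chart_partial c j (\<lambda>q. f q * h q) q = f q * ?h j q + ?f j q * h q" if "q \<in> chart_dom c" for j q
    by (rule chart_partial_mult[OF rc(1) d[OF f that] d[OF h that] that])
  have s: "smooth_in c (chart_dom c) (chart_partial c j (\<lambda>q. f q * h q))" for j
    by (intro smooth_in_partial[OF rc] smooth_in_mult[OF rc] f h)
  have df: "chart_differentiable c f p" "chart_differentiable c h p"
    "chart_differentiable c (?f j) p" "chart_differentiable c (?h j) p" for j
    by (intro d smooth_in_partial[OF rc] f h p)+
  have 2: "chart_partial c i (chart_partial c j (\<lambda>q. f q * h q)) p
      = f p * chart_partial c i (?h j) p + chart_partial c i (?f j) p * h p + ?f i p * ?h j p + ?f j p * ?h i p" for i j
  proof -
    have "chart_partial c i (chart_partial c j (\<lambda>q. f q * h q)) p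
      = chart_partial c i (\<lambda>q. f q * ?h j q + ?f j q * h q) p"
      by (rule chart_differentiable_cong(2)[OF rc p 1 d[OF s p]])
    also have "\<dots> = chart_partial c i (\<lambda>q. f q * ?h j q) p + chart_partial c i (\<lambda>q. ?f j q * h q) p"
      by (intro chart_partial_add[OF rc(1)] chart_differentiable_mult df)
    finally show ?thesis by (simp add: chart_partial_mult[OF rc(1) _ _ p] df)
  qed
  have swap: "(\<Sum>i\<in>UNIV. \<Sum>j\<in>UNIV. ?g i j * (?f j p * ?h i p)) = chart_gradient_product c f h p"
    unfolding chart_gradient_product_def by (subst sum.swap) (simp add: inv_sym[of _ _])
  have "chart_laplacian c (\<lambda>q. f q * h q) p =
    (\<Sum>i\<in>UNIV. \<Sum>j\<in>UNIV. f p * (?g i j * (chart_partial c i (?h j) p - (\<Sum>m\<in>UNIV. christoffel g c p m i j * ?h m p)))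
      + h p * (?g i j * (chart_partial c i (?f j) p - (\<Sum>m\<in>UNIV. christoffel g c p m i j * ?f m p)))
      + ?g i j * (?f i p * ?h j p) + ?g i j * (?f j p * ?h i p))"
    unfolding chart_laplacian_def 2 1[OF p]
    by (intro sum.cong refl) (simp add: algebra_simps sum.distrib sum_distrib_left)
  also have "\<dots> = f p * chart_laplacian c h p + h p * chart_laplacian c f p
     + chart_gradient_product c f h p + (\<Sum>i\<in>UNIV. \<Sum>j\<in>UNIV. ?g i j * (?f j p * ?h i p))"
    by (simp only: chart_laplacian_def chart_gradient_product_def sum.distrib sum_distrib_left)
  finally show ?thesis unfolding swap by simp
qed

lemma chart_laplacian_cmult:
  assumes "smooth_in c (chart_dom c) f"
  shows "chart_laplacian c (\<lambda>q. a * f q) p = a * chart_laplacian c f p"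
proof -
  have "chart_partial c i (\<lambda>q. a) = (\<lambda>q. 0)" for i by (simp add: fun_eq_iff chart_partial_const[OF rc(1)])
  then show ?thesis
    by (simp add: chart_laplacian_mult[OF smooth_in_const[OF rc] assms] chart_gradient_product_def
        chart_laplacian_def[of c "\<lambda>q. a"] chart_partial_const[OF rc(1)])
qed

lemma chart_laplacian_power:
  assumes f: "smooth_in c (chart_dom c) f"
  shows "chart_laplacian c (\<lambda>q. f q ^ (m + 2)) p =
    real (m + 2) * f p ^ (m + 1) * chart_laplacian c f p
    + real (m + 2) * real (m + 1) * f p ^ m * chart_gradient_product c f f p"
proof (induction m)
  case 0
  show ?case using chart_laplacian_mult[OF f f] by (simp add: power2_eq_square)
next
  case (Suc m)
  have grad: "chart_gradient_product c f (\<lambda>q. f q ^ (m + 2)) p = real (m + 2) * f p ^ (m + 1) * chart_gradient_product c f f p"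
    using chart_partial_power[OF rc(1) smooth_in_differentiable[OF rc f p] p, of _ "m + 1"]
    by (simp add: chart_gradient_product_def sum_distrib_left mult_ac)
  have "chart_laplacian c (\<lambda>q. f q * f q ^ (m + 2)) p =
    f p * chart_laplacian c (\<lambda>q. f q ^ (m + 2)) p + f p ^ (m + 2) * chart_laplacian c f p
    + 2 * chart_gradient_product c f (\<lambda>q. f q ^ (m + 2)) p"
    by (rule chart_laplacian_mult[OF f smooth_in_power[OF rc f]])
  then show ?case unfolding Suc.IH grad by (simp add: algebra_simps)
qed

text \<open>At a maximum the first order terms vanish. Writing the inverse metric as a sum of squares turns
  the remaining trace into a sum of second derivatives in the directions of an orthonormal frame.\<close>

lemma chart_laplacian_max:
  assumes f: "smooth_in c (chart_dom c) f" and mx: "\<And>q. q \<in> chart_dom c \<Longrightarrow> f q \<le> f p"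
  shows "chart_laplacian c f p \<le> 0" "chart_partial c i f p = 0"
proof -
  note m = max_chart_second_derivative[OF rc f p mx]
  show "chart_partial c i f p = 0" by (rule m(1))
  obtain B where B: "gram B (metric_kernel g c p)" using gram_metric_kernel[OF c p] .
  let ?H = "\<lambda>i j. chart_partial c i (chart_partial c j f) p"
  have "chart_laplacian c f p = (\<Sum>i\<in>UNIV. \<Sum>j\<in>UNIV. \<Sum>k\<in>UNIV. B True k i * B True k j * ?H i j)"
    using B by (simp add: chart_laplacian_def m(1) gram_def sum_distrib_right)
  also have "\<dots> = (\<Sum>i\<in>UNIV. \<Sum>k\<in>UNIV. \<Sum>j\<in>UNIV. B True k i * B True k j * ?H i j)"
    by (intro sum.cong refl sum.swap)
  also have "\<dots> = (\<Sum>k\<in>UNIV. \<Sum>i\<in>UNIV. \<Sum>j\<in>UNIV. B True k i * B True k j * ?H i j)"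
    by (rule sum.swap)
  also have "\<dots> \<le> 0" by (intro sum_nonpos m(2))
  finally show "chart_laplacian c f p \<le> 0" .
qed

section \<open>Bochner's formula\<close>

lemma chart_partial_pairing:
  assumes X: "\<And>L. length L = length vs \<Longrightarrow> smooth_in c (chart_dom c) (\<lambda>q. X q L)"
    and Y: "\<And>L. length L = length vs \<Longrightarrow> smooth_in c (chart_dom c) (\<lambda>q. Y q L)"
  shows "chart_partial c k (\<lambda>q. pairing (metric_kernel g c q) vs (X q) (Y q)) p =
    pairing (metric_kernel g c p) vs (\<lambda>L. chart_partial c k (\<lambda>q. X q L) p + act (connection_kernel g c p k) vs (X p) L) (Y p)
    + pairing (metric_kernel g c p) vs (X p) (\<lambda>L. chart_partial c k (\<lambda>q. Y q L) p + act (connection_kernel g c p k) vs (Y p) L)"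
proof (rule chart_partial_unique)
  have p0: "coord_line c k p 0 = p" using param_coord[OF rc(1) p] by simp
  show "chart_differentiable c (\<lambda>q. pairing (metric_kernel g c q) vs (X q) (Y q)) p"
    by (intro smooth_in_differentiable[OF rc] smooth_in_pairing[OF rc] smooth_in_metric_kernel c X Y p)
  have dX: "((\<lambda>x. X (coord_line c k p x) L) has_real_derivative chart_partial c k (\<lambda>q. X q L) p) (at 0)"
    if "length L = length vs" for L
    by (rule has_chart_partial[OF smooth_in_differentiable[OF rc X[OF that] p]])
  have dY: "((\<lambda>x. Y (coord_line c k p x) L) has_real_derivative chart_partial c k (\<lambda>q. Y q L) p) (at 0)"
    if "length L = length vs" for L
    by (rule has_chart_partial[OF smooth_in_differentiable[OF rc Y[OF that] p]])
  have "((\<lambda>x. pairing (metric_kernel g c (coord_line c k p x)) vs (X (coord_line c k p x)) (Y (coord_line c k p x))) has_real_derivative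
    pairing (metric_kernel g c (coord_line c k p 0)) vs
      (\<lambda>L. chart_partial c k (\<lambda>q. X q L) p + act (connection_kernel g c p k) vs (X (coord_line c k p 0)) L) (Y (coord_line c k p 0))
    + pairing (metric_kernel g c (coord_line c k p 0)) vs (X (coord_line c k p 0))
      (\<lambda>L. chart_partial c k (\<lambda>q. Y q L) p + act (connection_kernel g c p k) vs (Y (coord_line c k p 0)) L)) (at 0)"
    by (rule pairing_derivative; (unfold p0)?)
       (rule metric_kernel_compatible[OF c p] dX dY, assumption?)+
  then show "((\<lambda>x. pairing (metric_kernel g c (coord_line c k p x)) vs (X (coord_line c k p x)) (Y (coord_line c k p x))) has_real_derivative
    pairing (metric_kernel g c p) vs (\<lambda>L. chart_partial c k (\<lambda>q. X q L) p + act (connection_kernel g c p k) vs (X p) L) (Y p)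
    + pairing (metric_kernel g c p) vs (X p) (\<lambda>L. chart_partial c k (\<lambda>q. Y q L) p + act (connection_kernel g c p k) vs (Y p) L)) (at 0)"
    unfolding p0 .
qed

end

lemma smooth_in_components:
  "smooth_tensor_field atl r s T \<Longrightarrow> c \<in> atl \<Longrightarrow> length L = s + r \<Longrightarrow>
    smooth_in c (chart_dom c) (\<lambda>q. components s T c q L)"
  by (simp add: smooth_tensor_field_iff)

lemma smooth_in_tensor_norm_square:
  assumes T: "smooth_tensor_field atl r s T" and c: "c \<in> atl"
  shows "smooth_in c (chart_dom c) (\<lambda>q. (tensor_norm atl g r s T q)\<^sup>2)"
proof -
  note rc = regular_chart[OF c] open_dom[OF c] order.refl
  have "smooth_in c (chart_dom c) (\<lambda>q. pairing (metric_kernel g c q) (variances r s) (components s T c q) (components s T c q))"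
    by (intro smooth_in_pairing[OF rc] smooth_in_metric_kernel c smooth_in_components[OF T c]) auto
  then show ?thesis
    by (rule smooth_in_cong[OF rc, rotated]) (rule tensor_norm_square[OF T c, symmetric])
qed

text \<open>By the Leibniz rule the first derivatives of \<open>|T|\<^sup>2\<close> are \<open>2\<langle>\<nabla>\<^sub>jT, T\<rangle>\<close>. A second application yields
  \<open>2\<langle>\<nabla>\<^sub>i\<nabla>\<^sub>jT, T\<rangle> + 2\<langle>\<nabla>\<^sub>jT, \<nabla>\<^sub>iT\<rangle>\<close> and a Christoffel term for the index \<open>j\<close>, which
  is the one that the Laplacian of a function subtracts.\<close>

lemma Bochner_formula:
  assumes T: "smooth_tensor_field atl r s T" and c: "c \<in> atl" and p: "p \<in> chart_dom c"
  defines "vs \<equiv> variances r s"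
  shows "chart_laplacian c (\<lambda>q. (tensor_norm atl g r s T q)\<^sup>2) p =
    2 * (tensor_norm atl g r (Suc s) (cov_deriv g T) p)\<^sup>2
    + 2 * (\<Sum>i\<in>UNIV. \<Sum>j\<in>UNIV. metric_kernel g c p True i j *
        pairing (metric_kernel g c p) vs
          (\<lambda>L. components (Suc (Suc s)) (cov_deriv g (cov_deriv g T)) c p (i # j # L)) (components s T c p))"
proof -
  note rc = regular_chart[OF c] open_dom[OF c] order.refl
  note T1 = smooth_tensor_field_cov_deriv[OF T]
  let ?K = "metric_kernel g c"
  let ?X = "components s T c" and ?Y = "\<lambda>i q L. components (Suc s) (cov_deriv g T) c q (i # L)"
  let ?Z = "\<lambda>i j L. components (Suc (Suc s)) (cov_deriv g (cov_deriv g T)) c p (i # j # L)"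
  let ?P = "pairing (?K p) vs"
  have X: "smooth_in c (chart_dom c) (\<lambda>q. ?X q L)" if "length L = length vs" for L
    using smooth_in_components[OF T c] that by (simp add: vs_def)
  have Y: "smooth_in c (chart_dom c) (\<lambda>q. ?Y i q L)" if "length L = length vs" for i L
    using smooth_in_components[OF T1 c, of "i # L"] that by (simp add: vs_def)
  have sym: "pairing (?K q) vs A B = pairing (?K q) vs B A" if "q \<in> chart_dom c" for q A B
  proof -
    obtain F where "gram F (?K q)" using gram_metric_kernel[OF c \<open>q \<in> chart_dom c\<close>] .
    then show ?thesis by (intro pairing_commute gram_sym)
  qed
  let ?n = "\<lambda>q. pairing (?K q) vs (?X q) (?X q)"
  have d1: "chart_partial c j ?n q = 2 * pairing (?K q) vs (?Y j q) (?X q)" if q: "q \<in> chart_dom c" for j q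
  proof -
    have "pairing (?K q) vs (\<lambda>L. chart_partial c j (\<lambda>q. ?X q L) q + act (connection_kernel g c q j) vs (?X q) L) (?X q)
       = pairing (?K q) vs (?Y j q) (?X q)"
      by (rule pairing_cong) (simp_all add: components_cov_deriv vs_def)
    moreover have "chart_partial c j ?n q =
      pairing (?K q) vs (\<lambda>L. chart_partial c j (\<lambda>q. ?X q L) q + act (connection_kernel g c q j) vs (?X q) L) (?X q)
      + pairing (?K q) vs (?X q) (\<lambda>L. chart_partial c j (\<lambda>q. ?X q L) q + act (connection_kernel g c q j) vs (?X q) L)"
      by (rule chart_partial_pairing[OF c q X X])
    ultimately show ?thesis
      using sym[OF q, of "?X q"] by simp
  qed
  have d2: "chart_partial c i (\<lambda>q. pairing (?K q) vs (?Y j q) (?X q)) p =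
     ?P (?Z i j) (?X p) + (\<Sum>m\<in>UNIV. christoffel g c p m i j * ?P (?Y m p) (?X p)) + ?P (?Y j p) (?Y i p)" for i j
  proof -
    have "?P (\<lambda>L. chart_partial c i (\<lambda>q. ?Y j q L) p + act (connection_kernel g c p i) vs (?Y j p) L) (?X p)
       = ?P (\<lambda>L. ?Z i j L + (\<Sum>m\<in>UNIV. christoffel g c p m i j * ?Y m p L)) (?X p)"
    proof (rule pairing_cong)
      fix L :: "'n list" assume L: "length L = length vs"
      have "?Z i j L = chart_partial c i (\<lambda>q. ?Y j q L) p
        + act (connection_kernel g c p i) (variances r (Suc s)) (components (Suc s) (cov_deriv g T) c p) (j # L)"
        by (rule components_cov_deriv) (use L in \<open>simp add: vs_def\<close>)
      then show "chart_partial c i (\<lambda>q. ?Y j q L) p + act (connection_kernel g c p i) vs (?Y j p) L =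
        ?Z i j L + (\<Sum>m\<in>UNIV. christoffel g c p m i j * ?Y m p L)"
        by (simp add: variances_Suc vs_def connection_kernel_def[of g c p i True] sum_negf)
    qed simp
    also have "\<dots> = ?P (?Z i j) (?X p) + (\<Sum>m\<in>UNIV. christoffel g c p m i j * ?P (?Y m p) (?X p))"
      by (simp add: pairing_add_left pairing_sum_left)
    finally have a: "?P (\<lambda>L. chart_partial c i (\<lambda>q. ?Y j q L) p + act (connection_kernel g c p i) vs (?Y j p) L) (?X p)
       = ?P (?Z i j) (?X p) + (\<Sum>m\<in>UNIV. christoffel g c p m i j * ?P (?Y m p) (?X p))" .
    have b: "?P (?Y j p) (\<lambda>L. chart_partial c i (\<lambda>q. ?X q L) p + act (connection_kernel g c p i) vs (?X p) L)
      = ?P (?Y j p) (?Y i p)"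
      by (rule pairing_cong) (simp_all add: components_cov_deriv vs_def)
    have "chart_partial c i (\<lambda>q. pairing (?K q) vs (?Y j q) (?X q)) p =
      ?P (\<lambda>L. chart_partial c i (\<lambda>q. ?Y j q L) p + act (connection_kernel g c p i) vs (?Y j p) L) (?X p)
      + ?P (?Y j p) (\<lambda>L. chart_partial c i (\<lambda>q. ?X q L) p + act (connection_kernel g c p i) vs (?X p) L)"
      by (rule chart_partial_pairing[OF c p Y X])
    then show ?thesis unfolding a b .
  qed
  have smn: "smooth_in c (chart_dom c) ?n"
    by (intro smooth_in_pairing[OF rc] smooth_in_metric_kernel c X)
  have smY: "chart_differentiable c (\<lambda>q. pairing (?K q) vs (?Y j q) (?X q)) p" for j
    by (intro smooth_in_differentiable[OF rc] smooth_in_pairing[OF rc] smooth_in_metric_kernel c X Y p)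
  have d3: "chart_partial c i (chart_partial c j ?n) p =
     2 * (?P (?Z i j) (?X p) + (\<Sum>m\<in>UNIV. christoffel g c p m i j * ?P (?Y m p) (?X p)) + ?P (?Y j p) (?Y i p))" for i j
  proof -
    have "chart_partial c i (chart_partial c j ?n) p = chart_partial c i (\<lambda>q. 2 * pairing (?K q) vs (?Y j q) (?X q)) p"
      by (rule chart_differentiable_cong(2)[OF rc p d1 smooth_in_differentiable[OF rc smooth_in_partial[OF rc smn] p]])
    also have "\<dots> = 2 * chart_partial c i (\<lambda>q. pairing (?K q) vs (?Y j q) (?X q)) p"
      by (simp add: chart_partial_mult[OF rc(1) chart_differentiable_const smY p] chart_partial_const[OF rc(1)])
    finally show ?thesis unfolding d2 .
  qed
  have "chart_laplacian c (\<lambda>q. (tensor_norm atl g r s T q)\<^sup>2) p = chart_laplacian c ?n p"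
    by (rule chart_laplacian_cong[OF c p smooth_in_tensor_norm_square[OF T c]])
       (simp add: tensor_norm_square[OF T c] vs_def)
  also have "\<dots> = (\<Sum>i\<in>UNIV. \<Sum>j\<in>UNIV. 2 * (?K p True i j * ?P (?Y j p) (?Y i p)) + 2 * (?K p True i j * ?P (?Z i j) (?X p)))"
    unfolding chart_laplacian_def d3 d1[OF p]
    by (intro sum.cong refl) (simp add: algebra_simps sum_distrib_left)
  also have "\<dots> = 2 * (\<Sum>i\<in>UNIV. \<Sum>j\<in>UNIV. ?K p True i j * ?P (?Y j p) (?Y i p))
     + 2 * (\<Sum>i\<in>UNIV. \<Sum>j\<in>UNIV. ?K p True i j * ?P (?Z i j) (?X p))"
    by (simp add: sum.distrib sum_distrib_left)
  also have "(\<Sum>i\<in>UNIV. \<Sum>j\<in>UNIV. ?K p True i j * ?P (?Y j p) (?Y i p)) = (tensor_norm atl g r (Suc s) (cov_deriv g T) p)\<^sup>2"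
    by (simp add: tensor_norm_square[OF T1 c p] variances_Suc vs_def[symmetric] sym[OF p])
  finally show ?thesis .
qed

lemma Bochner_inequality:
  assumes T: "smooth_tensor_field atl r s T" and c: "c \<in> atl" and p: "p \<in> chart_dom c"
  shows "2 * (tensor_norm atl g r (Suc s) (cov_deriv g T) p)\<^sup>2
     - 2 * real CARD('n) * (tensor_norm atl g r (Suc (Suc s)) (cov_deriv g (cov_deriv g T)) p * tensor_norm atl g r s T p)
     \<le> chart_laplacian c (\<lambda>q. (tensor_norm atl g r s T q)\<^sup>2) p"
proof -
  obtain B where B: "gram B (metric_kernel g c p)" using gram_metric_kernel[OF c p] .
  note T1 = smooth_tensor_field_cov_deriv[OF T]
  note T2 = smooth_tensor_field_cov_deriv[OF T1]
  show ?thesis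
    using pairing_trace_bound[OF B, of "variances r s" "components (Suc (Suc s)) (cov_deriv g (cov_deriv g T)) c p" "components s T c p"]
    unfolding Bochner_formula[OF T c p] variances_Suc[symmetric] tensor_norm_chart[OF T2 c p, symmetric] tensor_norm_chart[OF T c p, symmetric]
    by (simp add: abs_le_iff algebra_simps)
qed

end

section \<open>The maximum principle\<close>

text \<open>
  The bound produced by one application of the maximum principle. Here \<open>h\<close> bounds
  \<open>\<rho>\<^sup>m |T|\<^sup>2\<close>, the numbers \<open>a1\<close>, \<open>a2\<close>, \<open>a3\<close> bound the first three covariant derivatives of \<open>T\<close>, \<open>b\<close> is
  the constant of the cut-off function and \<open>n\<close> the dimension. It is of order \<open>\<surd>h\<close> as \<open>h\<close> tends to 0.
\<close>

definition decay_step :: "real \<Rightarrow> nat \<Rightarrow> real \<Rightarrow> real \<Rightarrow> real \<Rightarrow> real \<Rightarrow> real \<Rightarrow> real" where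
  "decay_step n m a1 a2 a3 b h = sqrt h *
     (n * a1 * a3 + n * a2 + ((real (m + 2))\<^sup>2 + real (m + 2)) * \<bar>b\<bar> * (a1\<^sup>2 + sqrt h) / 2 + 1)"

lemma decay_step_nonneg:
  assumes "0 \<le> a1" "0 \<le> a2" "0 \<le> a3" "0 \<le> h" "0 \<le> n"
  shows "0 \<le> decay_step n m a1 a2 a3 b h"
  unfolding decay_step_def using assms by (auto intro!: mult_nonneg_nonneg add_nonneg_nonneg)

text \<open>
  The arithmetic at the maximum point of \<open>\<rho>\<^sup>m\<^sup>+\<^sup>2 F\<close>, where \<open>R\<close> is the value of \<open>\<rho>\<close>, \<open>l\<close> its Laplacian, \<open>G\<close> its
  squared gradient, \<open>n0\<close>, ..., \<open>n3\<close> are the norms of \<open>T\<close> and its covariant derivatives, and \<open>L\<close> is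
  the Laplacian of \<open>F\<close>. The hypothesis on \<open>L\<close> is Bochner's inequality, and the last hypothesis says that the
  Laplacian is nonpositive at the maximum. Solving it for \<open>R\<^sup>m\<^sup>+\<^sup>2 n1\<^sup>2\<close> divides all error terms
  by the factor \<open>1/\<surd>h\<close> in \<open>F\<close>.
\<close>

lemma decay_step_from_maximum:
  fixes R n a1 a2 a3 b h n0 n1 n2 n3 L l G :: real and m :: nat
  defines "w \<equiv> real (m + 2)" and "F \<equiv> n1\<^sup>2 + 1 / sqrt h * n0\<^sup>2"
  assumes R: "0 < R" "R \<le> 1" and h: "0 < h" and n: "0 \<le> n"
    and nonneg: "0 \<le> n0" "0 \<le> n1" "0 \<le> n2" "0 \<le> n3"
    and bounds: "n1 \<le> a1" "n2 \<le> a2" "n3 \<le> a3" "R ^ m * n0\<^sup>2 \<le> h"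
    and cutoff: "0 \<le> G" "G + \<bar>l\<bar> \<le> b"
    and L: "2 * n2\<^sup>2 - 2 * n * (n3 * n1) + 1 / sqrt h * (2 * n1\<^sup>2 - 2 * n * (n2 * n0)) \<le> L"
    and max: "R ^ (m + 2) * L + F * (w * R ^ (m + 1) * l + w * (w - 1) * R ^ m * G) - 2 * w\<^sup>2 * R ^ m * F * G \<le> 0"
  shows "R ^ (m + 2) * F \<le> decay_step n m a1 a2 a3 b h"
proof -
  define s where "s = sqrt h"
  have s: "s > 0" "h = s * s" "1 / s * s = 1" "1 / s * h = s" using h by (auto simp: s_def real_div_sqrt)
  have w: "1 \<le> w" by (simp add: w_def)
  have F: "F = n1\<^sup>2 + 1 / s * n0\<^sup>2" by (simp add: F_def s_def)
  have Rk: "0 < R ^ k" "R ^ k \<le> 1" for k using R by (auto simp: power_le_one)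
  note Rm = Rk[of m] and Rw = Rk[of "m + 2"]
  have F0: "0 \<le> R ^ m * F" using Rm s nonneg by (simp add: F)
  have a0: "0 \<le> a1" "0 \<le> a2" "0 \<le> a3" using nonneg bounds by auto
  have b0: "0 \<le> b" using cutoff by linarith
  have RF: "R ^ m * F \<le> a1\<^sup>2 + s"
  proof -
    have "R ^ m * n1\<^sup>2 \<le> 1 * a1\<^sup>2" using Rm bounds(1) nonneg(2) by (intro mult_mono power_mono) auto
    moreover have "1 / s * (R ^ m * n0\<^sup>2) \<le> 1 / s * h" using s(1) bounds(4) by (intro mult_left_mono) auto
    ultimately show ?thesis unfolding F s(4) by (simp add: algebra_simps)
  qed
  have cut: "- ((w\<^sup>2 + w) * b) * (a1\<^sup>2 + s)
      \<le> F * (w * R ^ (m + 1) * l + w * (w - 1) * R ^ m * G) - 2 * w\<^sup>2 * R ^ m * F * G"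
  proof -
    have "- \<bar>l\<bar> \<le> R * l"
    proof -
      have "\<bar>R * l\<bar> \<le> 1 * \<bar>l\<bar>" unfolding abs_mult using R by (intro mult_right_mono) auto
      then show ?thesis by linarith
    qed
    then have "w * (- \<bar>l\<bar>) \<le> w * (R * l)" using w by (intro mult_left_mono) auto
    moreover have "(w\<^sup>2 + w) * (G + \<bar>l\<bar>) \<le> (w\<^sup>2 + w) * b" using cutoff(2) w by (intro mult_left_mono) auto
    moreover have "0 \<le> w\<^sup>2 * \<bar>l\<bar>" by simp
    ultimately have "- ((w\<^sup>2 + w) * b) \<le> w * (R * l) + w * (w - 1) * G - 2 * w\<^sup>2 * G"
      by (simp add: algebra_simps power2_eq_square)
    then have "(R ^ m * F) * (- ((w\<^sup>2 + w) * b)) \<le> (R ^ m * F) * (w * (R * l) + w * (w - 1) * G - 2 * w\<^sup>2 * G)"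
      using F0 by (rule mult_left_mono)
    moreover have "((w\<^sup>2 + w) * b) * (R ^ m * F) \<le> ((w\<^sup>2 + w) * b) * (a1\<^sup>2 + s)"
      using RF w b0 by (intro mult_left_mono) auto
    ultimately show ?thesis by (simp add: algebra_simps)
  qed
  \<comment> \<open>The weight needed here is at most the one known for the square: \<open>2 (m + 2) \<ge> m\<close> and \<open>R \<le> 1\<close>.\<close>
  have Rn0: "R ^ (m + 2) * n0 \<le> s"
  proof -
    have "(R ^ (m + 2) * n0)\<^sup>2 = (R ^ m * n0\<^sup>2) * R ^ (m + 4)"
      by (simp add: power_mult_distrib power_add power2_eq_square eval_nat_numeral mult_ac)
    also have "\<dots> \<le> h * 1" using bounds(4) h R by (intro mult_mono) (auto simp: power_le_one)
    finally show ?thesis unfolding s_def by (simp add: real_le_rsqrt)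
  qed
  have lap: "- 2 * n * (a1 * a3) + 1 / s * (2 * (R ^ (m + 2) * n1\<^sup>2)) - 2 * n * a2 \<le> R ^ (m + 2) * L"
  proof -
    have "R ^ (m + 2) * (n3 * n1) \<le> 1 * (a3 * a1)" using Rw bounds nonneg by (intro mult_mono) auto
    then have "n * (R ^ (m + 2) * (n3 * n1)) \<le> n * (a3 * a1)" using n by (intro mult_left_mono) auto
    moreover have "1 / s * (n * (n2 * (R ^ (m + 2) * n0))) \<le> 1 / s * (n * (a2 * s))"
      using Rn0 bounds nonneg n s Rw a0 by (intro mult_left_mono mult_mono) auto
    moreover have "1 / s * (n * (a2 * s)) = n * a2" using s(1) by simp
    moreover have "0 \<le> R ^ (m + 2) * n2\<^sup>2" using Rw by simp
    moreover have "R ^ (m + 2) * (2 * n2\<^sup>2 - 2 * n * (n3 * n1) + 1 / s * (2 * n1\<^sup>2 - 2 * n * (n2 * n0))) \<le> R ^ (m + 2) * L"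
      using L Rw unfolding s_def by (intro mult_left_mono) auto
    moreover have "R ^ (m + 2) * (2 * n2\<^sup>2 - 2 * n * (n3 * n1) + 1 / s * (2 * n1\<^sup>2 - 2 * n * (n2 * n0)))
       = 2 * (R ^ (m + 2) * n2\<^sup>2) - 2 * (n * (R ^ (m + 2) * (n3 * n1)))
         + 1 / s * (2 * (R ^ (m + 2) * n1\<^sup>2)) - 2 * (1 / s * (n * (n2 * (R ^ (m + 2) * n0))))"
      by (simp add: algebra_simps diff_divide_distrib)
    ultimately show ?thesis by (simp add: mult.commute[of a1 a3])
  qed
  define X where "X = R ^ (m + 2) * n1\<^sup>2"
  have "1 / s * (2 * X) \<le> 2 * n * (a1 * a3) + 2 * n * a2 + ((w\<^sup>2 + w) * b) * (a1\<^sup>2 + s)"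
  proof -
    define E c1 where "E = F * (w * R ^ (m + 1) * l + w * (w - 1) * R ^ m * G) - 2 * w\<^sup>2 * R ^ m * F * G"
      and "c1 = ((w\<^sup>2 + w) * b) * (a1\<^sup>2 + s)"
    have "R ^ (m + 2) * L + E \<le> 0" using max by (simp add: E_def)
    moreover have "- c1 \<le> E" using cut by (simp add: E_def c1_def)
    moreover have "- 2 * n * (a1 * a3) + 1 / s * (2 * X) - 2 * n * a2 \<le> R ^ (m + 2) * L"
      using lap by (simp add: X_def)
    ultimately have "1 / s * (2 * X) \<le> 2 * n * (a1 * a3) + 2 * n * a2 + c1" by linarith
    then show ?thesis by (simp add: c1_def)
  qed
  then have "s / 2 * (1 / s * (2 * X)) \<le> s / 2 * (2 * n * (a1 * a3) + 2 * n * a2 + ((w\<^sup>2 + w) * b) * (a1\<^sup>2 + s))"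
    using s(1) by (intro mult_left_mono) auto
  then have X: "X \<le> s * (n * a1 * a3 + n * a2 + (w\<^sup>2 + w) * b * (a1\<^sup>2 + s) / 2)"
    using s(1) by (simp add: algebra_simps add_divide_distrib)
  have "R ^ (m + 2) * (1 / s * n0\<^sup>2) \<le> s"
  proof -
    have "R ^ (m + 2) * n0\<^sup>2 = (R ^ m * n0\<^sup>2) * R\<^sup>2" by (simp add: power_add power2_eq_square mult_ac)
    also have "\<dots> \<le> h * 1" using bounds(4) h R by (intro mult_mono) (auto simp: power_le_one)
    finally have "1 / s * (R ^ (m + 2) * n0\<^sup>2) \<le> 1 / s * h" using s(1) by (intro mult_left_mono) auto
    then show ?thesis unfolding s(4) by (simp add: mult_ac)
  qed
  then have "R ^ (m + 2) * F \<le> s * (n * a1 * a3 + n * a2 + (w\<^sup>2 + w) * b * (a1\<^sup>2 + s) / 2) + s"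
    using X unfolding F X_def by (simp add: distrib_left)
  also have "\<dots> = decay_step n m a1 a2 a3 b h"
    using b0 by (simp add: decay_step_def s_def[symmetric] w_def distrib_left)
  finally show ?thesis .
qed

context riemannian_atlas
begin

text \<open>
  The maximum principle for \<open>Q = \<rho>\<^sup>m\<^sup>+\<^sup>2 (|\<nabla>T|\<^sup>2 + |T|\<^sup>2 / \<surd>h)\<close>, which attains its maximum because
  \<open>\<rho>\<close> has compact support.
\<close>

lemma weighted_derivative_estimate:
  fixes \<rho> :: "'a \<Rightarrow> real" and r s m :: nat and T :: "('a, 'n) tensor"
  defines "S \<equiv> closure {x. \<rho> x \<noteq> 0}"
    and "N0 \<equiv> tensor_norm atl g r s T"
    and "N1 \<equiv> tensor_norm atl g r (Suc s) (cov_deriv g T)"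
    and "N2 \<equiv> tensor_norm atl g r (Suc (Suc s)) (cov_deriv g (cov_deriv g T))"
    and "N3 \<equiv> tensor_norm atl g r (Suc (Suc (Suc s))) (cov_deriv g (cov_deriv g (cov_deriv g T)))"
  assumes T: "smooth_tensor_field atl r s T" and \<rho>: "smooth_fun atl \<rho>" and S: "compact S"
    and \<rho>01: "\<And>x. 0 \<le> \<rho> x" "\<And>x. \<rho> x \<le> 1"
    and cutoff: "\<And>x. x \<in> S \<Longrightarrow> (grad_norm atl g \<rho> x)\<^sup>2 + \<bar>laplacian atl g \<rho> x\<bar> \<le> b"
    and bounds: "\<And>x. x \<in> S \<Longrightarrow> N1 x \<le> a1" "\<And>x. x \<in> S \<Longrightarrow> N2 x \<le> a2" "\<And>x. x \<in> S \<Longrightarrow> N3 x \<le> a3"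
    and weighted: "\<And>x. x \<in> S \<Longrightarrow> \<rho> x ^ m * (N0 x)\<^sup>2 \<le> h" and h: "0 < h"
    and a_nonneg: "0 \<le> a1" "0 \<le> a2" "0 \<le> a3"
  shows "\<rho> x ^ (m + 2) * (N1 x)\<^sup>2 \<le> decay_step (real CARD('n)) m a1 a2 a3 b h"
proof (cases "\<rho> x = 0")
  case True
  then show ?thesis using decay_step_nonneg[OF a_nonneg] h by simp
next
  case False
  note T1 = smooth_tensor_field_cov_deriv[OF T]
  note T2 = smooth_tensor_field_cov_deriv[OF T1]
  note T3 = smooth_tensor_field_cov_deriv[OF T2]
  define F where "F = (\<lambda>q. (N1 q)\<^sup>2 + 1 / sqrt h * (N0 q)\<^sup>2)"
  define Q where "Q = (\<lambda>q. \<rho> q ^ (m + 2) * F q)"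
  have nonneg: "0 \<le> N0 q" "0 \<le> N1 q" "0 \<le> N2 q" "0 \<le> N3 q" for q
    unfolding N0_def N1_def N2_def N3_def by (intro tensor_norm_nonneg T T1 T2 T3)+
  have F0: "(N1 q)\<^sup>2 \<le> F q" for q unfolding F_def using h by simp
  have smN: "smooth_in c (chart_dom c) (\<lambda>q. (N0 q)\<^sup>2)" "smooth_in c (chart_dom c) (\<lambda>q. (N1 q)\<^sup>2)" if "c \<in> atl" for c
    unfolding N0_def N1_def by (intro smooth_in_tensor_norm_square T T1 that)+
  have smF: "smooth_in c (chart_dom c) F" and sm\<rho>: "smooth_in c (chart_dom c) \<rho>"
    and smQ: "smooth_in c (chart_dom c) Q" if "c \<in> atl" for c
  proof -
    note rc = regular_chart[OF that] open_dom[OF that] order.refl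
    show F: "smooth_in c (chart_dom c) F"
      unfolding F_def by (intro smooth_in_add[OF rc] smooth_in_mult[OF rc] smooth_in_const[OF rc] smN that)
    show \<rho>': "smooth_in c (chart_dom c) \<rho>" using \<rho> that by (simp add: smooth_fun_iff)
    show "smooth_in c (chart_dom c) Q"
      unfolding Q_def by (intro smooth_in_mult[OF rc] smooth_in_power[OF rc] F \<rho>')
  qed
  have "x \<in> S" using False closure_subset by (force simp: S_def)
  moreover have "continuous_on S Q" using smQ by (intro smooth_fun_continuous_on) (simp add: smooth_fun_iff)
  ultimately obtain p where p: "p \<in> S" "\<And>q. q \<in> S \<Longrightarrow> Q q \<le> Q p"
    using continuous_attains_sup[OF S, of Q] by auto
  have Qx: "\<rho> x ^ (m + 2) * (N1 x)\<^sup>2 \<le> Q p"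
  proof -
    have "\<rho> x ^ (m + 2) * (N1 x)\<^sup>2 \<le> Q x"
      unfolding Q_def using F0 \<rho>01 by (intro mult_left_mono) auto
    then show ?thesis using p(2)[OF \<open>x \<in> S\<close>] by linarith
  qed
  have Q0: "0 \<le> Q p"
    using \<rho>01(1)[of x] Qx by (meson mult_nonneg_nonneg order_trans zero_le_power zero_le_power2)
  show ?thesis
  proof (cases "\<rho> p = 0")
    case True
    then show ?thesis using Qx decay_step_nonneg[OF a_nonneg, of h "real CARD('n)" m b] h by (simp add: Q_def)
  next
    case \<rho>p: False
    have mx: "Q q \<le> Q p" for q
    proof (cases "q \<in> S")
      case False
      then have "\<rho> q = 0" using closure_subset by (force simp: S_def)
      then show ?thesis using Q0 by (simp add: Q_def)
    qed (use p in auto)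
    define c where "c = chart_at atl p"
    have c: "c \<in> atl" "p \<in> chart_dom c" using chart_at by (auto simp: c_def)
    note rc = regular_chart[OF c(1)] open_dom[OF c(1)] order.refl
    define R where "R = \<rho> p"
    define G where "G = chart_gradient_product c \<rho> \<rho> p"
    define l where "l = chart_laplacian c \<rho> p"
    define w where "w = real (m + 2)"
    have R: "0 < R" "R \<le> 1" using \<rho>p \<rho>01[of p] by (auto simp: R_def less_le)
    have G: "G = (grad_norm atl g \<rho> p)\<^sup>2" unfolding G_def c_def by (rule grad_norm_square[OF \<rho>, symmetric])
    have l: "l = laplacian atl g \<rho> p" unfolding l_def c_def by (rule laplacian_eq_chart_laplacian[symmetric])
    have d\<rho>: "chart_partial c i (\<lambda>q. \<rho> q ^ (m + 2)) p = w * R ^ (m + 1) * chart_partial c i \<rho> p" for i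
      using chart_partial_power[OF rc(1) smooth_in_differentiable[OF rc sm\<rho>[OF c(1)] c(2)] c(2), of i "m + 1"]
      by (simp add: w_def R_def)
    \<comment> \<open>The first derivative of \<open>Q\<close> vanishes, which expresses the gradient of \<open>F\<close> through that of \<open>\<rho>\<close>.\<close>
    have dF: "R * chart_partial c j F p = - w * F p * chart_partial c j \<rho> p" for j
    proof -
      have "0 = chart_partial c j Q p" by (rule chart_laplacian_max(2)[OF c smQ[OF c(1)] mx, symmetric])
      also have "\<dots> = \<rho> p ^ (m + 2) * chart_partial c j F p + chart_partial c j (\<lambda>q. \<rho> q ^ (m + 2)) p * F p"
        unfolding Q_def
        by (intro chart_partial_mult[OF rc(1) _ _ c(2)] smooth_in_differentiable[OF rc _ c(2)]
            smooth_in_power[OF rc] sm\<rho> smF c)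
      also have "\<dots> = R ^ (m + 1) * (R * chart_partial c j F p + w * F p * chart_partial c j \<rho> p)"
        unfolding d\<rho> R_def[symmetric] by (simp add: algebra_simps)
      finally have "R * chart_partial c j F p + w * F p * chart_partial c j \<rho> p = 0" using R by simp
      then show ?thesis by linarith
    qed
    have cross: "chart_gradient_product c (\<lambda>q. \<rho> q ^ (m + 2)) F p = - (w\<^sup>2 * R ^ m * F p * G)"
    proof -
      have "chart_gradient_product c (\<lambda>q. \<rho> q ^ (m + 2)) F p =
        (\<Sum>i\<in>UNIV. \<Sum>j\<in>UNIV. metric_kernel g c p True i j * (w * R ^ m * chart_partial c i \<rho> p * (R * chart_partial c j F p)))"
        unfolding chart_gradient_product_def d\<rho> by (simp add: mult_ac)
      also have "\<dots> = - (w\<^sup>2 * R ^ m * F p * G)"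
        unfolding dF G_def chart_gradient_product_def
        by (simp add: sum_distrib_left sum_negf power2_eq_square mult_ac)
      finally show ?thesis .
    qed
    have "chart_laplacian c Q p \<le> 0" by (rule chart_laplacian_max(1)[OF c smQ[OF c(1)] mx])
    then have max: "R ^ (m + 2) * chart_laplacian c F p
       + F p * (w * R ^ (m + 1) * l + w * (w - 1) * R ^ m * G) - 2 * w\<^sup>2 * R ^ m * F p * G \<le> 0"
      unfolding Q_def chart_laplacian_mult[OF c smooth_in_power[OF rc sm\<rho>[OF c(1)]] smF[OF c(1)]] cross
        chart_laplacian_power[OF c sm\<rho>[OF c(1)]]
      by (simp add: R_def[symmetric] l_def[symmetric] G_def[symmetric] w_def)
    have lapF: "2 * (N2 p)\<^sup>2 - 2 * real CARD('n) * (N3 p * N1 p)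
       + 1 / sqrt h * (2 * (N1 p)\<^sup>2 - 2 * real CARD('n) * (N2 p * N0 p)) \<le> chart_laplacian c F p"
    proof -
      have "chart_laplacian c F p = chart_laplacian c (\<lambda>q. (N1 q)\<^sup>2) p + 1 / sqrt h * chart_laplacian c (\<lambda>q. (N0 q)\<^sup>2) p"
        unfolding F_def using smN[OF c(1)]
        by (simp only: chart_laplacian_add[OF c] chart_laplacian_cmult[OF c] smooth_in_mult[OF rc] smooth_in_const[OF rc])
      moreover have "2 * (N2 p)\<^sup>2 - 2 * real CARD('n) * (N3 p * N1 p) \<le> chart_laplacian c (\<lambda>q. (N1 q)\<^sup>2) p"
        unfolding N1_def N2_def N3_def by (rule Bochner_inequality[OF T1 c])
      moreover have "1 / sqrt h * (2 * (N1 p)\<^sup>2 - 2 * real CARD('n) * (N2 p * N0 p)) \<le> 1 / sqrt h * chart_laplacian c (\<lambda>q. (N0 q)\<^sup>2) p"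
        unfolding N0_def N1_def N2_def using h by (intro mult_left_mono Bochner_inequality[OF T c]) auto
      ultimately show ?thesis by linarith
    qed
    have "R ^ (m + 2) * F p \<le> decay_step (real CARD('n)) m a1 a2 a3 b h"
      unfolding F_def
    proof (rule decay_step_from_maximum[OF R h _ nonneg])
      show "N1 p \<le> a1" "N2 p \<le> a2" "N3 p \<le> a3" "R ^ m * (N0 p)\<^sup>2 \<le> h"
        using bounds weighted p(1) by (auto simp: R_def)
      show "0 \<le> G" "G + \<bar>l\<bar> \<le> b" using cutoff[OF p(1)] by (auto simp: G l)
    qed (use lapF max in \<open>simp_all add: F_def w_def\<close>)
    then show ?thesis using Qx by (simp add: Q_def R_def)
  qed
qed

end

section \<open>The decay rates\<close>

text \<open>The bound \<open>h\<^sub>k\<close> for \<open>\<rho>\<^sup>2\<^sup>k |\<nabla>\<^sup>k\<eta>|\<^sup>2\<close>, where \<open>e\<close> bounds \<open>|\<eta>|\<close> itself.\<close>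

primrec weighted_decay :: "real \<Rightarrow> (nat \<Rightarrow> real) \<Rightarrow> real \<Rightarrow> real \<Rightarrow> nat \<Rightarrow> real" where
  "weighted_decay n A b e 0 = e\<^sup>2"
| "weighted_decay n A b e (Suc k) =
     decay_step n (2 * k) (A (k + 1)) (A (k + 2)) (A (k + 3)) b (weighted_decay n A b e k)"

text \<open>The cut-off function is controlled for nonnegative times only. For negative times, which do not
  influence the limit, the rate is the bound that is given on all of \<open>U\<close>.\<close>

definition decay_rate ::
  "real \<Rightarrow> nat \<Rightarrow> (nat \<Rightarrow> real) \<Rightarrow> real \<Rightarrow> (real \<Rightarrow> real) \<Rightarrow> real \<Rightarrow> real" where
  "decay_rate n k A b h0 t =
     (if t < 0 then if k = 0 then h0 t else A k
      else (\<Sum>j\<le>k. sqrt (weighted_decay n A b (h0 t) j)))"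

lemma weighted_decay_cong:
  "(\<And>j. 1 \<le> j \<Longrightarrow> j \<le> k + 2 \<Longrightarrow> A j = A' j) \<Longrightarrow> weighted_decay n A b e k = weighted_decay n A' b e k"
  by (induction k) simp_all

lemma decay_rate_cong:
  assumes "\<forall>j\<in>{1..k + 2}. A j = A' j"
  shows "decay_rate n k A b h0 = decay_rate n k A' b h0"
proof -
  have "weighted_decay n A b e j = weighted_decay n A' b e j" if "j \<le> k" for e j
    using assms that by (intro weighted_decay_cong) auto
  then show ?thesis using assms by (auto simp: decay_rate_def fun_eq_iff)
qed

lemma weighted_decay_pos:
  assumes "\<And>j. 1 \<le> j \<Longrightarrow> 0 < A j" "0 < e" "0 \<le> n"
  shows "0 < weighted_decay n A b e k"
proof (induction k)
  case (Suc k)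
  have "0 < n * A (k + 1) * A (k + 3) + n * A (k + 2)
      + ((real (2 * k + 2))\<^sup>2 + real (2 * k + 2)) * \<bar>b\<bar> * ((A (k + 1))\<^sup>2 + sqrt (weighted_decay n A b e k)) / 2 + 1"
    using assms(1)[of "k + 1"] assms(1)[of "k + 2"] assms(1)[of "k + 3"] assms(3) Suc
    by (intro add_nonneg_pos add_nonneg_nonneg mult_nonneg_nonneg divide_nonneg_nonneg) auto
  then show ?case unfolding weighted_decay.simps decay_step_def using Suc by (intro mult_pos_pos) auto
qed (use assms in simp)

lemma weighted_decay_tendsto_0:
  assumes "(h0 \<longlongrightarrow> 0) F"
  shows "((\<lambda>t. weighted_decay n A b (h0 t) k) \<longlongrightarrow> 0) F"
proof (induction k)
  case 0
  show ?case using tendsto_power[OF assms, of 2] by simp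
next
  case (Suc k)
  have s: "((\<lambda>t. sqrt (weighted_decay n A b (h0 t) k)) \<longlongrightarrow> 0) F"
    using tendsto_real_sqrt[OF Suc] by simp
  have "((\<lambda>t. weighted_decay n A b (h0 t) (Suc k)) \<longlongrightarrow>
     0 * (n * A (k + 1) * A (k + 3) + n * A (k + 2)
      + ((real (2 * k + 2))\<^sup>2 + real (2 * k + 2)) * \<bar>b\<bar> * ((A (k + 1))\<^sup>2 + 0) / 2 + 1)) F"
    unfolding weighted_decay.simps decay_step_def by (intro tendsto_intros s) simp
  then show ?case by simp
qed

lemma decay_rate_pos:
  assumes "\<And>j. 1 \<le> j \<Longrightarrow> 0 < A j" "\<And>t. 0 < h0 t" "0 \<le> n"
  shows "0 < decay_rate n k A b h0 t"
proof -
  have "0 < weighted_decay n A b (h0 t) j" for j by (rule weighted_decay_pos[OF assms])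
  then have "0 < (\<Sum>j\<le>k. sqrt (weighted_decay n A b (h0 t) j))" by (intro sum_pos) auto
  then show ?thesis using assms by (auto simp: decay_rate_def)
qed

lemma decay_rate_tendsto_0:
  assumes "(h0 \<longlongrightarrow> 0) at_top"
  shows "(decay_rate n k A b h0 \<longlongrightarrow> 0) at_top"
proof -
  have "((\<lambda>t. sqrt (weighted_decay n A b (h0 t) j)) \<longlongrightarrow> 0) at_top" for j
    using tendsto_real_sqrt[OF weighted_decay_tendsto_0[OF assms]] by simp
  then have "((\<lambda>t. \<Sum>j\<le>k. sqrt (weighted_decay n A b (h0 t) j)) \<longlongrightarrow> (\<Sum>j\<le>k. 0)) at_top"
    by (intro tendsto_sum)
  then have "((\<lambda>t. \<Sum>j\<le>k. sqrt (weighted_decay n A b (h0 t) j)) \<longlongrightarrow> 0) at_top" by simp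
  then show ?thesis
    by (rule Lim_transform_eventually)
       (rule eventually_mono[OF eventually_ge_at_top[of 0]], simp add: decay_rate_def)
qed

lemma Ck_norm_le_iff:
  assumes "0 \<le> a" and "\<And>j p. j \<le> k \<Longrightarrow> 0 \<le> tensor_norm atl g r (s + j) ((cov_deriv g ^^ j) T) p"
  shows "Ck_norm atl r s k U g T \<le> ennreal a \<longleftrightarrow>
    (\<forall>p\<in>U. (\<Sum>j\<le>k. tensor_norm atl g r (s + j) ((cov_deriv g ^^ j) T) p) \<le> a)"
  unfolding Ck_norm_def by (simp add: SUP_le_iff ennreal_le_iff[OF assms(1)])

context riemannian_atlas
begin

text \<open>The weight grows by two powers of \<open>\<rho>\<close> in each step, which is what makes a single cut-off function,
  and hence a single constant \<open>b\<close>, sufficient for all orders.\<close>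

lemma weighted_decay_bound:
  fixes \<rho> :: "'a \<Rightarrow> real" and r s :: nat and T :: "('a, 'n) tensor"
  defines "S \<equiv> closure {x. \<rho> x \<noteq> 0}"
    and "N \<equiv> \<lambda>j. tensor_norm atl g r (s + j) ((cov_deriv g ^^ j) T)"
  assumes T: "smooth_tensor_field atl r s T" and \<rho>: "smooth_fun atl \<rho>" and S: "compact S"
    and \<rho>01: "\<And>x. 0 \<le> \<rho> x" "\<And>x. \<rho> x \<le> 1"
    and cutoff: "\<And>x. x \<in> S \<Longrightarrow> (grad_norm atl g \<rho> x)\<^sup>2 + \<bar>laplacian atl g \<rho> x\<bar> \<le> b"
    and A: "\<And>j. 1 \<le> j \<Longrightarrow> 0 < A j" and e: "0 < e"
    and N0: "\<And>x. x \<in> S \<Longrightarrow> N 0 x \<le> e" and N: "\<And>j x. 1 \<le> j \<Longrightarrow> x \<in> S \<Longrightarrow> N j x \<le> A j"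
    and x: "x \<in> S"
  shows "\<rho> x ^ (2 * k) * (N k x)\<^sup>2 \<le> weighted_decay (real CARD('n)) A b e k"
  using x
proof (induction k arbitrary: x)
  case 0
  have "0 \<le> N 0 x" unfolding N_def by (intro tensor_norm_nonneg smooth_tensor_field_iterate T)
  then have "(N 0 x)\<^sup>2 \<le> e\<^sup>2" using N0[OF 0] by (intro power_mono)
  then show ?case by simp
next
  case (Suc k)
  have "\<rho> x ^ (2 * k + 2) * (tensor_norm atl g r (Suc (s + k)) (cov_deriv g ((cov_deriv g ^^ k) T)) x)\<^sup>2
    \<le> decay_step (real CARD('n)) (2 * k) (A (k + 1)) (A (k + 2)) (A (k + 3)) b (weighted_decay (real CARD('n)) A b e k)"
  proof (rule weighted_derivative_estimate)
    show "smooth_tensor_field atl r (s + k) ((cov_deriv g ^^ k) T)" by (rule smooth_tensor_field_iterate[OF T])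
    show "compact (closure {x. \<rho> x \<noteq> 0})" using S by (simp add: S_def)
    show "0 < weighted_decay (real CARD('n)) A b e k" by (rule weighted_decay_pos[OF A e]) auto
    show "0 \<le> A (k + 1)" "0 \<le> A (k + 2)" "0 \<le> A (k + 3)" using A by (auto intro: less_imp_le)
    fix y assume "y \<in> closure {x. \<rho> x \<noteq> 0}"
    then have y: "y \<in> S" by (simp add: S_def)
    show "(grad_norm atl g \<rho> y)\<^sup>2 + \<bar>laplacian atl g \<rho> y\<bar> \<le> b" by (rule cutoff[OF y])
    show "\<rho> y ^ (2 * k) * (tensor_norm atl g r (s + k) ((cov_deriv g ^^ k) T) y)\<^sup>2 \<le> weighted_decay (real CARD('n)) A b e k"
      using Suc.IH[OF y] by (simp add: N_def)
    show "tensor_norm atl g r (Suc (s + k)) (cov_deriv g ((cov_deriv g ^^ k) T)) y \<le> A (k + 1)"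
      using N[OF _ y, of "k + 1"] by (simp add: N_def)
    show "tensor_norm atl g r (Suc (Suc (s + k))) (cov_deriv g (cov_deriv g ((cov_deriv g ^^ k) T))) y \<le> A (k + 2)"
      using N[OF _ y, of "k + 2"] by (simp add: N_def)
    show "tensor_norm atl g r (Suc (Suc (Suc (s + k)))) (cov_deriv g (cov_deriv g (cov_deriv g ((cov_deriv g ^^ k) T)))) y \<le> A (k + 3)"
      using N[OF _ y, of "k + 3"] by (simp add: N_def eval_nat_numeral)
  qed (use \<rho> \<rho>01 in auto)
  then show ?case by (simp add: N_def)
qed

end

theorem lemma1p1:
  fixes r s :: nat
  shows "\<exists>H :: nat \<Rightarrow> (nat \<Rightarrow> real) \<Rightarrow> real \<Rightarrow> (real \<Rightarrow> real) \<Rightarrow> real \<Rightarrow> real.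
    (\<forall>k A A' b h0. (\<forall>j\<in>{1..k + 2}. A j = A' j) \<longrightarrow> H k A b h0 = H k A' b h0) \<and>
    (\<forall>(atl :: ('a::{t2_space, second_countable_topology}, 'n::finite) chart set)
        (gX :: ('a, 'n) tensor) (U :: 'a set)
        (g :: real \<Rightarrow> ('a, 'n) tensor) (\<eta> :: real \<Rightarrow> ('a, 'n) tensor)
        (A :: nat \<Rightarrow> real) (h0 :: real \<Rightarrow> real) (B :: 'a set \<Rightarrow> real).
      riemannian_manifold atl gX \<longrightarrow>
      open U \<longrightarrow>
      (\<forall>t. riemannian_metric atl (g t)) \<longrightarrow>
      (\<forall>t. smooth_tensor_field atl r s (\<eta> t)) \<longrightarrow>
      (\<forall>k\<ge>1. A k > 0) \<longrightarrow>
      (\<forall>t. h0 t > 0) \<longrightarrow>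
      (h0 \<longlongrightarrow> 0) at_top \<longrightarrow>
      (\<forall>t. Ck_norm atl r s 0 U (g t) (\<eta> t) \<le> ennreal (h0 t)) \<longrightarrow>
      (\<forall>t. \<forall>k\<ge>1. Ck_norm atl r s k U (g t) (\<eta> t) \<le> ennreal (A k)) \<longrightarrow>
      (\<forall>K. compact K \<and> K \<subseteq> U \<longrightarrow>
        (\<exists>\<rho> :: 'a \<Rightarrow> real.
           smooth_fun atl \<rho> \<and>
           compact (closure {x. \<rho> x \<noteq> 0}) \<and> closure {x. \<rho> x \<noteq> 0} \<subseteq> U \<and>
           (\<forall>x. 0 \<le> \<rho> x \<and> \<rho> x \<le> 1) \<and>
           (\<exists>V. open V \<and> K \<subseteq> V \<and> (\<forall>x\<in>V. \<rho> x = 1)) \<and>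
           (\<forall>x\<in>closure {x. \<rho> x \<noteq> 0}. \<forall>t\<ge>0.
              (grad_norm atl (g t) \<rho> x)\<^sup>2 + \<bar>laplacian atl (g t) \<rho> x\<bar> \<le> B K))) \<longrightarrow>
      (\<forall>K k. compact K \<and> K \<subseteq> U \<longrightarrow>
        (\<forall>t. H k A (B K) h0 t > 0) \<and>
        ((H k A (B K) h0) \<longlongrightarrow> 0) at_top \<and>
        (\<forall>t. Ck_norm atl r s k K (g t) (\<eta> t) \<le> ennreal (H k A (B K) h0 t))))"
proof (intro exI[of _ "decay_rate (real CARD('n))"] conjI allI impI)
  fix k :: nat and A A' :: "nat \<Rightarrow> real" and b :: real and h0 :: "real \<Rightarrow> real"
  assume "\<forall>j\<in>{1..k + 2}. A j = A' j"
  then show "decay_rate (real CARD('n)) k A b h0 = decay_rate (real CARD('n)) k A' b h0"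
    by (rule decay_rate_cong)
next
  fix atl :: "('a, 'n) chart set" and gX :: "('a, 'n) tensor" and U K :: "'a set"
    and g \<eta> :: "real \<Rightarrow> ('a, 'n) tensor"
    and A :: "nat \<Rightarrow> real" and h0 :: "real \<Rightarrow> real" and B :: "'a set \<Rightarrow> real" and k :: nat and t :: real
  let ?H = "decay_rate (real CARD('n)) k A (B K) h0"
  assume X: "riemannian_manifold atl gX" and g: "\<forall>t. riemannian_metric atl (g t)"
    and \<eta>: "\<forall>t. smooth_tensor_field atl r s (\<eta> t)"
    and A: "\<forall>k\<ge>1. 0 < A k" and h0: "\<forall>t. 0 < h0 t" and lim: "(h0 \<longlongrightarrow> 0) at_top"
    and C0: "\<forall>t. Ck_norm atl r s 0 U (g t) (\<eta> t) \<le> ennreal (h0 t)"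
    and Ck: "\<forall>t. \<forall>k\<ge>1. Ck_norm atl r s k U (g t) (\<eta> t) \<le> ennreal (A k)"
    and cutoffs: "\<forall>K. compact K \<and> K \<subseteq> U \<longrightarrow>
        (\<exists>\<rho> :: 'a \<Rightarrow> real.
           smooth_fun atl \<rho> \<and>
           compact (closure {x. \<rho> x \<noteq> 0}) \<and> closure {x. \<rho> x \<noteq> 0} \<subseteq> U \<and>
           (\<forall>x. 0 \<le> \<rho> x \<and> \<rho> x \<le> 1) \<and>
           (\<exists>V. open V \<and> K \<subseteq> V \<and> (\<forall>x\<in>V. \<rho> x = 1)) \<and>
           (\<forall>x\<in>closure {x. \<rho> x \<noteq> 0}. \<forall>t\<ge>0.
              (grad_norm atl (g t) \<rho> x)\<^sup>2 + \<bar>laplacian atl (g t) \<rho> x\<bar> \<le> B K))"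
    and K: "compact K \<and> K \<subseteq> U"
  have pos: "0 < ?H t" for t using A h0 by (intro decay_rate_pos) auto
  then show "0 < ?H t" .
  show "(?H \<longlongrightarrow> 0) at_top" by (rule decay_rate_tendsto_0[OF lim])
  interpret riemannian_atlas atl "g t"
    using X g by unfold_locales (auto simp: riemannian_manifold_def)
  define N where "N = (\<lambda>j. tensor_norm atl (g t) r (s + j) ((cov_deriv (g t) ^^ j) (\<eta> t)))"
  have N_nonneg: "0 \<le> N j x" for j x
    unfolding N_def using \<eta> by (intro tensor_norm_nonneg smooth_tensor_field_iterate) auto
  have norm_iff: "Ck_norm atl r s j W (g t) (\<eta> t) \<le> ennreal a \<longleftrightarrow> (\<forall>x\<in>W. (\<Sum>i\<le>j. N i x) \<le> a)"
    if "0 \<le> a" for j W a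
    using Ck_norm_le_iff[OF that N_nonneg[unfolded N_def]] by (simp add: N_def)
  have sum0: "N 0 x \<le> h0 t" if "x \<in> U" for x
    using C0 h0 norm_iff[of "h0 t" 0 U] that by (auto intro: less_imp_le)
  have sumk: "(\<Sum>i\<le>j. N i x) \<le> A j" if "1 \<le> j" "x \<in> U" for j x
    using Ck A norm_iff[of "A j" j U] that by (auto intro: less_imp_le)
  have Nk: "N j x \<le> A j" if "1 \<le> j" "x \<in> U" for j x
  proof -
    have "N j x \<le> (\<Sum>i\<le>j. N i x)" by (intro member_le_sum) (auto intro: N_nonneg)
    then show ?thesis using sumk[OF that] by linarith
  qed
  have "(\<Sum>i\<le>k. N i x) \<le> ?H t" if x: "x \<in> K" for x
  proof (cases "t < 0")
    case True
    then show ?thesis using sum0[of x] sumk[of k x] x K by (cases "k = 0") (auto simp: decay_rate_def)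
  next
    case False
    obtain \<rho> where \<rho>: "smooth_fun atl \<rho>" "compact (closure {x. \<rho> x \<noteq> 0})" "closure {x. \<rho> x \<noteq> 0} \<subseteq> U"
        "\<And>x. 0 \<le> \<rho> x" "\<And>x. \<rho> x \<le> 1" "\<And>x. x \<in> K \<Longrightarrow> \<rho> x = 1"
        "\<And>x. x \<in> closure {x. \<rho> x \<noteq> 0} \<Longrightarrow> (grad_norm atl (g t) \<rho> x)\<^sup>2 + \<bar>laplacian atl (g t) \<rho> x\<bar> \<le> B K"
    proof -
      from cutoffs[rule_format, OF K] obtain \<rho> V where "smooth_fun atl \<rho>" "compact (closure {x. \<rho> x \<noteq> 0})"
        "closure {x. \<rho> x \<noteq> 0} \<subseteq> U" "\<forall>x. 0 \<le> \<rho> x \<and> \<rho> x \<le> 1" "K \<subseteq> V" "\<forall>x\<in>V. \<rho> x = 1"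
        "\<forall>x\<in>closure {x. \<rho> x \<noteq> 0}. \<forall>t\<ge>0. (grad_norm atl (g t) \<rho> x)\<^sup>2 + \<bar>laplacian atl (g t) \<rho> x\<bar> \<le> B K"
        by blast
      then show ?thesis using False by (intro that[of \<rho>]) auto
    qed
    have xS: "x \<in> closure {x. \<rho> x \<noteq> 0}" using \<rho>(6)[OF x] closure_subset[of "{x. \<rho> x \<noteq> 0}"] by auto
    have "N j x \<le> sqrt (weighted_decay (real CARD('n)) A (B K) (h0 t) j)" for j
    proof -
      have "\<rho> x ^ (2 * j) * (N j x)\<^sup>2 \<le> weighted_decay (real CARD('n)) A (B K) (h0 t) j"
        unfolding N_def
        by (rule weighted_decay_bound) (use \<eta> \<rho> A h0 xS Nk sum0 in \<open>auto simp: N_def subset_iff\<close>)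
      then show ?thesis using \<rho>(6)[OF x] by (simp add: real_le_rsqrt)
    qed
    then have "(\<Sum>i\<le>k. N i x) \<le> (\<Sum>i\<le>k. sqrt (weighted_decay (real CARD('n)) A (B K) (h0 t) i))"
      by (intro sum_mono)
    then show ?thesis using False by (simp add: decay_rate_def)
  qed
  then show "Ck_norm atl r s k K (g t) (\<eta> t) \<le> ennreal (?H t)"
    using norm_iff[of "?H t" k K] pos[of t] by auto
qed

end
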